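(* Let $n\in\mathbb{N}^*$, let $X$ be an irreducible normal (reduced) complex space, let $A:X\to\mathrm{Mat}(n\times n,\mathbb{C})$ be holomorphic, and denote by $\mathrm{Jst}\,A$ the set of Jordan stable points of $A$. (1) If $A$ is bounded on $X$, then $X\setminus\mathrm{Jst}\,A$ is the common zero set of finitely many bounded holomorphic functions on $X$. In particular, if $X=\{\zeta\in\mathbb{C}: |\zeta|<1\}$ and $A$ is bounded, then $X\setminus\mathrm{Jst}\,A$ satisfies the Blaschke condition, i.e. $\sum_{\zeta\in X\setminus \mathrm{Jst}\,A}(1-|\zeta|)<\infty$. (2) If $X=\mathbb{C}^N$ and the elements of $A$ are holomorphic polynomials, then $\mathbb{C}^N\setminus\mathrm{Jst}\,A$ is the common zero set of finitely many holomorphic polynomials, i.e. it is affine algebraic. For $N=1$, $\mathbb{C}\setminus\mathrm{Jst}\,A$ is finite.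
   Context: $\mathbb{N}^*=\{1,2,\ldots\}$; $\mathrm{Mat}(n\times n,\mathbb{C})$ is the space of complex $n\times n$ matrices with the operator norm. Complex spaces are always reduced; irreducible means globally irreducible (the manifold of smooth points is connected). Eigenvalues are listed without counting multiplicities. For $\Phi\in\mathrm{Mat}(n\times n,\mathbb{C})$ and $\ell\in\mathbb{N}^*$, let $\vartheta_\ell(\Phi,\bullet)$ be the total number (over all eigenvalues) of Jordan blocks of size $\ell$ in the Jordan normal forms of $\Phi$. A point $\xi\in X$ is a splitting point of the eigenvalues of $A$ if for each neighborhood $U$ of $\xi$ there is $\zeta\in U$ such that $A(\zeta)$ has more (distinct) eigenvalues than $A(\xi)$. A point $\xi\in X$ is Jordan stable for $A$ if $\xi$ is not a splitting point of the eigenvalues of $A$ and there is a neighborhood $V$ of $\xi$ such that for each $1\le\ell\le n$ the function $V\ni\zeta\mapsto\vartheta_\ell(A(\zeta),\bullet)$ is constant. *)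

theory Defs
  imports "HOL-Analysis.Analysis" "Jordan_Normal_Form.Spectral_Radius"
    "Jordan_Normal_Form.Jordan_Normal_Form_Uniqueness"
begin

section \<open>Holomorphic functions on subsets of complex number space\<close>

text \<open>The dimension varies from chart to chart, so the space of complex \<open>N\<close>-tuples is the set of
  those sequences which vanish from index \<open>N\<close> on. The product topology on sequences induces the
  Euclidean topology on it.\<close>

definition Cn :: "nat \<Rightarrow> (nat \<Rightarrow> complex) set" where
  "Cn N = {z. \<forall>i\<ge>N. z i = 0}"

text \<open>Complex differentiability at each point of an open set \<open>D\<close>; \<open>a\<close> is the complex gradient.\<close>

definition holomorphic_Cn ::
  "nat \<Rightarrow> (nat \<Rightarrow> complex) set \<Rightarrow> ((nat \<Rightarrow> complex) \<Rightarrow> complex) \<Rightarrow> bool" where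
  "holomorphic_Cn N D f \<longleftrightarrow> openin (top_of_set (Cn N)) D \<and>
     (\<forall>z\<in>D. \<exists>a::nat \<Rightarrow> complex.
        ((\<lambda>w. (f w - f z - (\<Sum>i<N. a i * (w i - z i))) /
               complex_of_real (L2_set (\<lambda>i. cmod (w i - z i)) {..<N})) \<longlongrightarrow> 0) (at z within D))"

text \<open>A function on an arbitrary subset \<open>W\<close> is holomorphic if it is locally the restriction of
  a holomorphic function of the ambient space. For analytic \<open>W\<close> these are the sections of the
  reduced structure sheaf; for open \<open>W\<close> they are the usual holomorphic functions.\<close>

definition holomorphic_subset ::
  "nat \<Rightarrow> (nat \<Rightarrow> complex) set \<Rightarrow> ((nat \<Rightarrow> complex) \<Rightarrow> complex) \<Rightarrow> bool" where
  "holomorphic_subset N W g \<longleftrightarrow>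
     (\<forall>z\<in>W. \<exists>D h. z \<in> D \<and> holomorphic_Cn N D h \<and> (\<forall>w\<in>D \<inter> W. g w = h w))"

definition polynomial_Cn :: "nat \<Rightarrow> ((nat \<Rightarrow> complex) \<Rightarrow> complex) \<Rightarrow> bool" where
  "polynomial_Cn N p \<longleftrightarrow> (\<exists>(S :: (nat \<Rightarrow> nat) set) c. finite S \<and>
     (\<forall>z\<in>Cn N. p z = (\<Sum>\<alpha>\<in>S. c \<alpha> * (\<Prod>i<N. z i ^ \<alpha> i))))"


section \<open>Reduced complex spaces\<close>

text \<open>The structure sheaf \<open>\<O>\<close> of a reduced complex space is a sheaf of complex valued functions.
  A section over \<open>U\<close> is represented by any function on the whole type with the right values
  on \<open>U\<close>.\<close>

text \<open>\<open>\<phi>\<close> is an isomorphism of ringed spaces from the open set \<open>U\<close> onto \<open>Z\<close>, a subset of \<open>Cn N\<close>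
  with the sheaf of locally extendable holomorphic functions.\<close>

definition complex_chart ::
  "'a topology \<Rightarrow> ('a set \<Rightarrow> ('a \<Rightarrow> complex) set) \<Rightarrow> 'a set \<Rightarrow> nat \<Rightarrow> (nat \<Rightarrow> complex) set
    \<Rightarrow> ('a \<Rightarrow> nat \<Rightarrow> complex) \<Rightarrow> bool" where
  "complex_chart X \<O> U N Z \<phi> \<longleftrightarrow>
     openin X U \<and> Z \<subseteq> Cn N \<and> homeomorphic_map (subtopology X U) (top_of_set Z) \<phi> \<and>
     (\<forall>V f. openin X V \<longrightarrow> V \<subseteq> U \<longrightarrow>
        (f \<in> \<O> V \<longleftrightarrow> holomorphic_subset N (\<phi> ` V) (f \<circ> inv_into U \<phi>)))"

locale reduced_complex_space =
  fixes X :: "'a topology" and \<O> :: "'a set \<Rightarrow> ('a \<Rightarrow> complex) set"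
  assumes Hausdorff: "Hausdorff_space X"
    and section_cong:
      "\<And>U f g. openin X U \<Longrightarrow> f \<in> \<O> U \<Longrightarrow> (\<And>x. x \<in> U \<Longrightarrow> g x = f x) \<Longrightarrow> g \<in> \<O> U"
    and section_restrict:
      "\<And>U V f. openin X U \<Longrightarrow> openin X V \<Longrightarrow> V \<subseteq> U \<Longrightarrow> f \<in> \<O> U \<Longrightarrow> f \<in> \<O> V"
    and section_glue:
      "\<And>U f. openin X U \<Longrightarrow> (\<And>x. x \<in> U \<Longrightarrow> \<exists>V. openin X V \<and> x \<in> V \<and> V \<subseteq> U \<and> f \<in> \<O> V) \<Longrightarrow> f \<in> \<O> U"
    and local_model:
      "\<And>x. x \<in> topspace X \<Longrightarrow> \<exists>U N D F \<phi>. x \<in> U \<and>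
         openin (top_of_set (Cn N)) D \<and> finite F \<and> (\<forall>h\<in>F. holomorphic_Cn N D h) \<and>
         complex_chart X \<O> U N {z\<in>D. \<forall>h\<in>F. h z = 0} \<phi>"

definition smooth_points :: "'a topology \<Rightarrow> ('a set \<Rightarrow> ('a \<Rightarrow> complex) set) \<Rightarrow> 'a set" where
  "smooth_points X \<O> = {x \<in> topspace X. \<exists>U k D \<phi>. x \<in> U \<and>
     openin (top_of_set (Cn k)) D \<and> complex_chart X \<O> U k D \<phi>}"

definition irreducible_complex_space :: "'a topology \<Rightarrow> ('a set \<Rightarrow> ('a \<Rightarrow> complex) set) \<Rightarrow> bool" where
  "irreducible_complex_space X \<O> \<longleftrightarrow> connectedin X (smooth_points X \<O>)"

text \<open>The germ of \<open>b\<close> at \<open>x\<close> is not a zero divisor of the stalk.\<close>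

definition regular_germ ::
  "'a topology \<Rightarrow> ('a set \<Rightarrow> ('a \<Rightarrow> complex) set) \<Rightarrow> 'a \<Rightarrow> 'a set \<Rightarrow> ('a \<Rightarrow> complex) \<Rightarrow> bool" where
  "regular_germ X \<O> x U b \<longleftrightarrow>
     (\<forall>V g. openin X V \<longrightarrow> x \<in> V \<longrightarrow> V \<subseteq> U \<longrightarrow> g \<in> \<O> V \<longrightarrow> (\<forall>y\<in>V. g y * b y = 0) \<longrightarrow>
        (\<exists>W. openin X W \<and> x \<in> W \<and> W \<subseteq> V \<and> (\<forall>y\<in>W. g y = 0)))"

text \<open>The stalk at \<open>x\<close> is integrally closed in its total ring of fractions. A fraction \<open>a / b\<close> is
  integral over the stalk if it satisfies \<open>(a/b)^d + (\<Sum>i<d. c i * (a/b)^i) = 0\<close>; the non zero divisor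
  \<open>b ^ d\<close> is cleared from this equation. All germs involved have representatives on a common
  neighbourhood \<open>U\<close> on which the equation holds.\<close>

definition normal_point ::
  "'a topology \<Rightarrow> ('a set \<Rightarrow> ('a \<Rightarrow> complex) set) \<Rightarrow> 'a \<Rightarrow> bool" where
  "normal_point X \<O> x \<longleftrightarrow>
     (\<forall>U a b d c. openin X U \<longrightarrow> x \<in> U \<longrightarrow> a \<in> \<O> U \<longrightarrow> b \<in> \<O> U \<longrightarrow> regular_germ X \<O> x U b \<longrightarrow>
        (\<forall>i<d. c i \<in> \<O> U) \<longrightarrow>
        (\<forall>y\<in>U. a y ^ d + (\<Sum>i<d. c i y * a y ^ i * b y ^ (d - i)) = 0) \<longrightarrow>
        (\<exists>V h. openin X V \<and> x \<in> V \<and> V \<subseteq> U \<and> h \<in> \<O> V \<and> (\<forall>y\<in>V. a y = h y * b y)))"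

definition normal_complex_space :: "'a topology \<Rightarrow> ('a set \<Rightarrow> ('a \<Rightarrow> complex) set) \<Rightarrow> bool" where
  "normal_complex_space X \<O> \<longleftrightarrow> (\<forall>x\<in>topspace X. normal_point X \<O> x)"


section \<open>Matrix functions and Jordan stable points\<close>

definition op_norm :: "complex mat \<Rightarrow> real" where
  "op_norm M = (SUP v \<in> {v \<in> carrier_vec (dim_col M).
                          L2_set (\<lambda>i. cmod (vec_index v i)) {..<dim_col M} \<le> 1}.
                  L2_set (\<lambda>i. cmod (vec_index (M *\<^sub>v v) i)) {..<dim_row M})"

definition bounded_matrix :: "'a set \<Rightarrow> ('a \<Rightarrow> complex mat) \<Rightarrow> bool" where
  "bounded_matrix S A \<longleftrightarrow> (\<exists>C. \<forall>x\<in>S. op_norm (A x) \<le> C)"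

text \<open>The list given by \<open>jordan_nf\<close> consists of the pairs (size, eigenvalue) of the Jordan blocks.
  The number does not depend on the normal form chosen, see \<open>num_jordan_blocks_eq\<close>.\<close>

definition num_jordan_blocks :: "nat \<Rightarrow> complex mat \<Rightarrow> nat" where
  "num_jordan_blocks l M =
     length (filter (\<lambda>(k, ev). k = l) (SOME n_as. jordan_nf M n_as))"

lemma jordan_nf_mset_unique:
  assumes "jordan_nf (M :: complex mat) bs" "jordan_nf M cs"
  shows "mset bs = mset cs"
proof (rule multiset_eqI)
  fix p :: "nat \<times> complex"
  obtain k ev where p: "p = (k, ev)" by (cases p)
  have cnt: "count (mset xs) p = (if k = 0 then 0 else compute_nr_of_jordan_blocks M ev k)"
    if "jordan_nf M xs" for xs
  proof (cases "k = 0")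
    case True
    then have "p \<notin> set xs"
      using that p unfolding jordan_nf_def by force
    then show ?thesis using True by simp
  next
    case False
    have "count (mset xs) p = length (filter ((=) p) xs)"
      by (induction xs) auto
    then show ?thesis
      using compute_nr_of_jordan_blocks[OF that False, of ev] False p by simp
  qed
  show "count (mset bs) p = count (mset cs) p"
    using cnt[OF assms(1)] cnt[OF assms(2)] by simp
qed

lemma num_jordan_blocks_eq:
  assumes "jordan_nf M bs"
  shows "num_jordan_blocks l M = length (filter (\<lambda>(k, ev). k = l) bs)"
proof -
  have "jordan_nf M (SOME n_as. jordan_nf M n_as)"
    using assms by (rule someI)
  then have "mset (SOME n_as. jordan_nf M n_as) = mset bs"
    using assms by (rule jordan_nf_mset_unique)
  then show ?thesis
    unfolding num_jordan_blocks_def by (metis mset_filter size_mset)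
qed

definition splitting_point :: "'a topology \<Rightarrow> ('a \<Rightarrow> complex mat) \<Rightarrow> 'a \<Rightarrow> bool" where
  "splitting_point X A \<xi> \<longleftrightarrow>
     (\<forall>U. openin X U \<and> \<xi> \<in> U \<longrightarrow> (\<exists>\<zeta>\<in>U. card (spectrum (A \<zeta>)) > card (spectrum (A \<xi>))))"

definition Jst :: "nat \<Rightarrow> 'a topology \<Rightarrow> ('a \<Rightarrow> complex mat) \<Rightarrow> 'a set" where
  "Jst n X A = {\<xi> \<in> topspace X. \<not> splitting_point X A \<xi> \<and>
     (\<exists>V. openin X V \<and> \<xi> \<in> V \<and>
        (\<forall>l\<in>{1..n}. (\<lambda>\<zeta>. num_jordan_blocks l (A \<zeta>)) constant_on V))}"

end

theory Submission
  imports Defs "HOL-Complex_Analysis.Complex_Analysis"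
begin

text \<open>Why the theorem is true. The Jordan stable points are those where the matrix has the generic number of
  eigenvalues and the generic Jordan type, and polynomials in the entries of the matrix detect both.

  Let \<open>m\<close> be the largest number of distinct eigenvalues of \<open>A x\<close> for \<open>x\<close> in the space. The Hankel matrix
  \<open>H\<close> with the entries \<open>tr M^(i+j)\<close>, \<open>i, j < m\<close>, is a sum of \<open>card (spectrum M)\<close> matrices of rank one, so
  its determinant \<open>D\<close> detects whether \<open>M = A x\<close> has \<open>m\<close> eigenvalues or fewer
  (\<open>det_hankel_eq_0\<close>, \<open>det_hankel_neq_0\<close>). If it has \<open>m\<close>, the coefficients of
  \<open>q = (\<Prod>a\<in>spectrum M. X - a)\<close> solve a linear system with the matrix \<open>H\<close>, and Cramer's rule
  (\<open>hankel_cramer\<close>) gives \<open>D * q\<close> as a polynomial expression in the entries of \<open>M\<close>. So there is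
  a matrix \<open>Q\<close> whose entries are polynomials in those of \<open>M\<close> and which equals \<open>D * q(M)\<close> wherever
  \<open>D \<noteq> 0\<close>. There the kernel of \<open>Q^k\<close> is the sum of the kernels of \<open>(M - a)^k\<close> over all eigenvalues \<open>a\<close>, of
  dimension \<open>\<Sum> min k s\<close> with \<open>s\<close> running through the sizes of the Jordan blocks
  (\<open>kernel_dim_mat_poly_pow\<close>). These dimensions and the numbers of blocks of each size determine each
  other (\<open>kernel_dim_scaled_radical\<close>), and a bound on the dimension of a kernel means that one of finitely
  many determinants does not vanish (\<open>kernel_dim_le_iff_completion\<close>).

  Call a set cozero if it is nonempty and the set where one of finitely many functions of a given ring does not
  vanish. Suppose that a function of this ring which vanishes on a nonempty open set is zero. Then cozero sets
  are open and dense, and finite intersections of them are cozero, by multiplying the functions. The set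
  \<open>W\<close> where \<open>D \<noteq> 0\<close> and where all the kernel dimensions are minimal is cozero. On \<open>W\<close> the Jordan type
  is constant; conversely a Jordan stable point has points of \<open>W\<close> arbitrarily near, hence the same data
  as these, and so it lies in \<open>W\<close>. Therefore \<open>Jst A = W\<close> (\<open>cozero_Jst\<close>).

  It remains to supply the rings. For bounded holomorphic functions on an irreducible complex space the
  identity theorem (\<open>identity_theorem\<close>) follows from the one on polydiscs, because the smooth points are connected
  by definition of irreducibility and dense (\<open>smooth_points_dense\<close>). Density is proved by induction on the
  dimension of the ambient number space (\<open>analytic_set_regular_point\<close>): either some function vanishing on
  the analytic set has a partial derivative which does not vanish somewhere on the set, and the implicit function
  theorem removes one coordinate, or all iterated partial derivatives of the defining functions vanish on the set,
  and the set is open. On the unit disc the classical Blaschke condition (\<open>blaschke_condition\<close>) applies to one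
  of the functions. The identity theorem for polynomials is again the one on polydiscs, and in one variable
  a nonzero polynomial has finitely many zeros.\<close>

section \<open>Kernel dimensions and determinants\<close>

lemma det_eq_0_iff_function:
  fixes A :: "complex mat"
  assumes A: "A \<in> carrier_mat n n"
  shows "Determinant.det A = 0 \<longleftrightarrow>
    (\<exists>x :: nat \<Rightarrow> complex. (\<exists>i<n. x i \<noteq> 0) \<and> (\<forall>i<n. (\<Sum>j<n. A $$ (i, j) * x j) = 0))"
proof -
  have mv: "vec_index (A *\<^sub>v v) i = (\<Sum>j<n. A $$ (i, j) * vec_index v j)"
    if "i < n" "v \<in> carrier_vec n" for i v
    using that A by (auto simp: scalar_prod_def Matrix.row_def atLeast0LessThan intro!: sum.cong)
  show ?thesis
  proof
    assume "Determinant.det A = 0"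
    then obtain v where v: "v \<in> carrier_vec n" "v \<noteq> 0\<^sub>v n" "A *\<^sub>v v = 0\<^sub>v n"
      using det_0_iff_vec_prod_zero[OF A] by blast
    from v obtain i where "i < n" "vec_index v i \<noteq> 0"
      by (metis carrier_vecD eq_vecI index_zero_vec)
    moreover have "(\<Sum>j<n. A $$ (i, j) * vec_index v j) = 0" if "i < n" for i
      using mv[OF that v(1)] v(3) that by simp
    ultimately show "\<exists>x. (\<exists>i<n. x i \<noteq> 0) \<and> (\<forall>i<n. (\<Sum>j<n. A $$ (i, j) * x j) = 0)"
      by blast
  next
    assume "\<exists>x. (\<exists>i<n. x i \<noteq> 0) \<and> (\<forall>i<n. (\<Sum>j<n. A $$ (i, j) * x j) = 0)"
    then obtain x i where x: "i < n" "x i \<noteq> 0" "\<forall>i<n. (\<Sum>j<n. A $$ (i, j) * x j) = 0" by blast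
    let ?v = "Matrix.vec n x"
    have "?v \<noteq> 0\<^sub>v n" using x by (metis index_vec index_zero_vec(1))
    moreover have "A *\<^sub>v ?v = 0\<^sub>v n"
      using x(3) A mv[of _ ?v] by (intro eq_vecI) auto
    ultimately show "Determinant.det A = 0"
      using det_0_iff_vec_prod_zero[OF A] by (meson vec_carrier)
  qed
qed

lemma det_nonzero_inverse:
  fixes A :: "complex mat"
  assumes A: "A \<in> carrier_mat n n" and d: "Determinant.det A \<noteq> 0"
  obtains B where "B \<in> carrier_mat n n" "A * B = 1\<^sub>m n" "B * A = 1\<^sub>m n"
proof
  let ?B = "inverse (Determinant.det A) \<cdot>\<^sub>m adj_mat A"
  show "?B \<in> carrier_mat n n" using adj_mat(1)[OF A] by simp
  show "A * ?B = 1\<^sub>m n"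
    using adj_mat[OF A] A d by (simp add: mult_smult_distrib[OF A adj_mat(1)[OF A]]) (intro eq_matI; simp)
  show "?B * A = 1\<^sub>m n"
    using adj_mat[OF A] A d by (simp add: mult_smult_assoc_mat[OF adj_mat(1)[OF A] A]) (intro eq_matI; simp)
qed

text \<open>The rows of \<open>B\<close> outside \<open>I\<close> are replaced by unit vectors. By Laplace expansion the determinant is, up to sign,
  a minor of \<open>B\<close> with the rows \<open>I\<close>, or zero. Working with square matrices of the full size avoids submatrices.\<close>

definition unit_row_completion :: "nat \<Rightarrow> complex mat \<Rightarrow> nat set \<Rightarrow> (nat \<Rightarrow> nat) \<Rightarrow> complex mat" where
  "unit_row_completion n B I g = mat n n (\<lambda>(i, j). if i \<in> I then B $$ (i, j) else if j = g i then 1 else 0)"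

lemma unit_row_completion_carrier [simp]: "unit_row_completion n B I g \<in> carrier_mat n n"
  by (simp add: unit_row_completion_def)

lemma unit_row_completion_dim [simp]:
  "dim_row (unit_row_completion n B I g) = n" "dim_col (unit_row_completion n B I g) = n"
  by (simp_all add: unit_row_completion_def)

lemma kernel_dim_diagonal_projection:
  "kernel.dim n (mat n n (\<lambda>(i, j). if i = j \<and> i \<in> I then 1 else 0) :: complex mat) = card ({..<n} - I)"
proof (induction n)
  case 0
  have e: "(mat 0 0 (\<lambda>(i, j). if i = j \<and> i \<in> I then 1 else 0) :: complex mat) = 1\<^sub>m 0"
    by (rule eq_matI) auto
  show ?case unfolding e by (simp add: kernel_one_mat)
next
  case (Suc n)
  let ?D = "\<lambda>n. mat n n (\<lambda>(i, j). if i = j \<and> i \<in> I then 1 else 0) :: complex mat"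
  define E where "E = (if n \<in> I then 1\<^sub>m 1 else 0\<^sub>m 1 1 :: complex mat)"
  have E: "E \<in> carrier_mat 1 1" by (simp add: E_def)
  have "?D (Suc n) = four_block_mat (?D n) (0\<^sub>m n 1) (0\<^sub>m 1 n) E"
    by (rule eq_matI) (auto simp: E_def less_Suc_eq)
  from kernel_four_block_0_mat[OF this _ E]
  have "kernel.dim (n + 1) (?D (Suc n)) = kernel.dim n (?D n) + kernel.dim 1 E" by simp
  moreover have "kernel.dim 1 E = card ({n} - I)"
  proof (cases "n \<in> I")
    case True
    then have "E = 1\<^sub>m 1" by (simp add: E_def)
    then show ?thesis using True kernel_one_mat(1)[where n=1 and ?'a=complex] by simp
  next
    case False
    then have "E = jordan_block 1 0" by (auto simp: E_def jordan_block_def intro!: eq_matI)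
    moreover have "jordan_block 1 0 ^\<^sub>m 1 = (jordan_block 1 0 :: complex mat)" by simp
    ultimately have "kernel.dim 1 E = 1"
      using dim_kernel_zero_jordan_block_pow[of 1 1, where ?'a=complex] by (simp only: min.idem)
    then show ?thesis using False by (simp add: insert_Diff_if)
  qed
  moreover have "card ({..<Suc n} - I) = card ({..<n} - I) + card ({n} - I)"
    by (subst card_Un_disjoint[symmetric]) (auto intro!: arg_cong[where f=card])
  ultimately show ?case using Suc by simp
qed

lemma kernel_dim_cong:
  assumes "mat_kernel A = mat_kernel B" 
  shows "kernel.dim n (A :: complex mat) = kernel.dim n B"
  using assms by simp

text \<open>An exchange argument. Write \<open>B = Y * C\<close> with the invertible completion \<open>C\<close>. If \<open>Y\<close> had a nonzero entry
  \<open>(k, j)\<close> with \<open>k, j \<notin> I\<close>, the unit row \<open>j\<close> could be exchanged for row \<open>k\<close> of \<open>B\<close>, and \<open>I\<close> would not be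
  maximal. So \<open>Y\<close> has the kernel of the coordinate projection to \<open>I\<close>.\<close>

lemma unit_row_completion_extend:
  fixes B :: "complex mat"
  assumes B: "B \<in> carrier_mat n n" and I: "I \<subseteq> {..<n}" and g: "\<And>i. i < n \<Longrightarrow> g i < n"
    and d: "Determinant.det (unit_row_completion n B I g) \<noteq> 0"
    and max: "\<And>J h. J \<subseteq> {..<n} \<Longrightarrow> (\<And>i. i < n \<Longrightarrow> h i < n) \<Longrightarrow> Determinant.det (unit_row_completion n B J h) \<noteq> 0 \<Longrightarrow> card J \<le> card I"
  shows "kernel.dim n B = n - card I"
proof -
  let ?C = "unit_row_completion n B I g"
  have C: "?C \<in> carrier_mat n n" by simp
  obtain Ci where Ci: "Ci \<in> carrier_mat n n" "?C * Ci = 1\<^sub>m n" "Ci * ?C = 1\<^sub>m n"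
    using det_nonzero_inverse[OF C d] by blast
  define Y where "Y = B * Ci"
  have Y: "Y \<in> carrier_mat n n" using B Ci by (simp add: Y_def)
  have YC: "Y * ?C = B" unfolding Y_def assoc_mult_mat[OF B Ci(1) C] using B Ci(3) by simp
  have Bkj: "B $$ (k, j) = (\<Sum>i<n. Y $$ (k, i) * ?C $$ (i, j))" if "k < n" "j < n" for k j
    using that Y C by (subst YC[symmetric]) (auto simp: scalar_prod_def atLeast0LessThan)
  have Ykj: "Y $$ (k, j) = (\<Sum>i<n. B $$ (k, i) * Ci $$ (i, j))" if "k < n" "j < n" for k j
    using that B Ci unfolding Y_def by (auto simp: scalar_prod_def atLeast0LessThan)
  have YI: "Y $$ (k, j) = (if k = j then 1 else 0)" if "k \<in> I" "j < n" for k j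
  proof -
    have k: "k < n" using that I by auto
    have "Y $$ (k, j) = (\<Sum>i<n. ?C $$ (k, i) * Ci $$ (i, j))"
      using Ykj[OF k that(2)] that k by (simp add: unit_row_completion_def)
    also have "\<dots> = (?C * Ci) $$ (k, j)" using k that C Ci(1) by (auto simp: scalar_prod_def atLeast0LessThan)
    finally show ?thesis using Ci k that by simp
  qed
  have Y0: "Y $$ (k, j) = 0" if k: "k < n" "k \<notin> I" and j: "j < n" "j \<notin> I" for k j
  proof (rule ccontr)
    assume nz: "Y $$ (k, j) \<noteq> 0"
    \<comment> \<open>row \<open>k\<close> of \<open>B\<close> goes to position \<open>k\<close>, so the unit row that stood there moves to position \<open>j\<close>\<close>
    let ?C' = "unit_row_completion n B (insert k I) (g(j := g k))"
    have "Determinant.det ?C' \<noteq> 0"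
    proof
      assume "Determinant.det ?C' = 0"
      then obtain x :: "nat \<Rightarrow> complex" where x: "\<exists>i<n. x i \<noteq> 0"
        "\<And>i. i < n \<Longrightarrow> (\<Sum>l<n. ?C' $$ (i, l) * x l) = 0"
        using det_eq_0_iff_function[of ?C' n] by auto
      define w where "w i = (\<Sum>l<n. ?C $$ (i, l) * x l)" for i
      have w1: "w i = 0" if "i < n" "i \<noteq> j" "i \<noteq> k" for i
        using x(2)[OF that(1)] that unfolding w_def
        by (subst sum.cong[OF refl, where h="\<lambda>l. ?C' $$ (i, l) * x l"]) (auto simp: unit_row_completion_def)
      have w2: "w k = 0" if "j \<noteq> k"
        using x(2)[OF j(1)] that j k unfolding w_def
        by (subst sum.cong[OF refl, where h="\<lambda>l. ?C' $$ (j, l) * x l"]) (auto simp: unit_row_completion_def)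
      have "0 = (\<Sum>l<n. B $$ (k, l) * x l)"
        using x(2)[OF k(1)] k by (simp add: unit_row_completion_def)
      also have "\<dots> = (\<Sum>l<n. (\<Sum>i<n. Y $$ (k, i) * ?C $$ (i, l)) * x l)"
        by (intro sum.cong refl) (simp add: Bkj k)
      also have "\<dots> = (\<Sum>l<n. \<Sum>i<n. Y $$ (k, i) * (?C $$ (i, l) * x l))"
        by (simp add: sum_distrib_right mult.assoc)
      also have "\<dots> = (\<Sum>i<n. \<Sum>l<n. Y $$ (k, i) * (?C $$ (i, l) * x l))" by (rule sum.swap)
      also have "\<dots> = (\<Sum>i<n. Y $$ (k, i) * w i)" by (simp add: w_def sum_distrib_left)
      also have "\<dots> = (\<Sum>i<n. if i = j then Y $$ (k, j) * w j else 0)"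
        using w1 w2 by (intro sum.cong refl) auto
      also have "\<dots> = Y $$ (k, j) * w j" using j by simp
      finally have "w j = 0" using nz by simp
      then have "\<forall>i<n. w i = 0" using w1 w2 by metis
      then show False using d x(1) det_eq_0_iff_function[OF C] unfolding w_def by blast
    qed
    then have "card (insert k I) \<le> card I" using max[of "insert k I" "g(j := g k)"] I k g by auto
    then show False using k I finite_subset[OF I] by simp
  qed
  let ?D = "mat n n (\<lambda>(i, j). if i = j \<and> i \<in> I then 1 else 0) :: complex mat"
  have Yv: "vec_index (Y *\<^sub>v v) i = (\<Sum>j\<in>I. Y $$ (i, j) * vec_index v j)" if "i < n" "v \<in> carrier_vec n" for i v
  proof -
    have "vec_index (Y *\<^sub>v v) i = (\<Sum>j<n. Y $$ (i, j) * vec_index v j)"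
      using that Y by (auto simp: scalar_prod_def Matrix.row_def atLeast0LessThan intro!: sum.cong)
    also have "\<dots> = (\<Sum>j\<in>I. Y $$ (i, j) * vec_index v j)"
    proof (rule sum.mono_neutral_right)
      show "\<forall>j\<in>{..<n} - I. Y $$ (i, j) * vec_index v j = 0"
        using Y0[of i] YI[of i] that by (metis Diff_iff lessThan_iff mult_zero_left)
    qed (use I in auto)
    finally show ?thesis .
  qed
  have Dv: "vec_index (?D *\<^sub>v v) i = (if i \<in> I then vec_index v i else 0)" if "i < n" "v \<in> carrier_vec n" for i v
  proof -
    have "vec_index (?D *\<^sub>v v) i = (\<Sum>j<n. (if i = j \<and> i \<in> I then 1 else 0) * vec_index v j)"
      using that by (auto simp: scalar_prod_def Matrix.row_def atLeast0LessThan intro!: sum.cong)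
    also have "\<dots> = (\<Sum>j<n. if j = i then (if i \<in> I then vec_index v i else 0) else 0)"
      by (intro sum.cong) auto
    finally show ?thesis using that by simp
  qed
  have iff: "Y *\<^sub>v v = 0\<^sub>v n \<longleftrightarrow> ?D *\<^sub>v v = 0\<^sub>v n" if v: "v \<in> carrier_vec n" for v
  proof
    assume "Y *\<^sub>v v = 0\<^sub>v n"
    then have "vec_index v i = 0" if "i \<in> I" for i
    proof -
      have i: "i < n" using that I by auto
      have "0 = (\<Sum>j\<in>I. Y $$ (i, j) * vec_index v j)" using Yv[OF i v] \<open>Y *\<^sub>v v = 0\<^sub>v n\<close> i by simp
      also have "\<dots> = (\<Sum>j\<in>I. if j = i then vec_index v i else 0)"
        using YI[OF that] I by (intro sum.cong) auto
      finally show ?thesis using that finite_subset[OF I] by simp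
    qed
    then show "?D *\<^sub>v v = 0\<^sub>v n" using Dv[OF _ v] by (intro eq_vecI) auto
  next
    assume "?D *\<^sub>v v = 0\<^sub>v n"
    then have "vec_index v i = 0" if "i \<in> I" for i
      using Dv[OF _ v, of i] that I by auto
    then show "Y *\<^sub>v v = 0\<^sub>v n" using Yv[OF _ v] Y by (intro eq_vecI) auto
  qed
  have "mat_kernel Y = mat_kernel ?D"
    unfolding mat_kernel[OF Y] mat_kernel[OF mat_carrier[of n n]] using iff by blast
  then have "kernel.dim n Y = kernel.dim n ?D" by (rule kernel_dim_cong)
  moreover have "kernel.dim n B = kernel.dim n Y"
    using mat_kernel_dim_mult_eq_right[OF Y C Ci(1,2)] YC by simp
  moreover have "card ({..<n} - I) = n - card I" using I by (simp add: card_Diff_subset finite_subset)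
  ultimately show ?thesis by (simp add: kernel_dim_diagonal_projection)
qed

text \<open>The classical criterion that the rank is at least \<open>r\<close> if and only if some minor of size \<open>r\<close> does not vanish. The
  restriction of \<open>g\<close> makes the family of determinants finite.\<close>

theorem kernel_dim_le_iff_completion:
  fixes B :: "complex mat"
  assumes B: "B \<in> carrier_mat n n" and r: "r \<le> n"
  shows "kernel.dim n B \<le> n - r \<longleftrightarrow>
    (\<exists>I g. I \<subseteq> {..<n} \<and> g \<in> {..<n} \<rightarrow>\<^sub>E {..<n} \<and> r \<le> card I \<and> Determinant.det (unit_row_completion n B I g) \<noteq> 0)"
proof -
  define P where "P I \<longleftrightarrow> I \<subseteq> {..<n} \<and>
    (\<exists>g. (\<forall>i<n. g i < n) \<and> Determinant.det (unit_row_completion n B I g) \<noteq> 0)" for I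
  have le: "card I \<le> n" if "I \<subseteq> {..<n}" for I
    using card_mono[OF finite_lessThan that] by simp
  have "unit_row_completion n B {} id = 1\<^sub>m n"
    by (rule eq_matI) (auto simp: unit_row_completion_def)
  then have "Determinant.det (unit_row_completion n B {} id) \<noteq> 0" by simp
  then have "P {}" unfolding P_def by (intro conjI exI[of _ id]) auto
  moreover have "\<forall>I. P I \<longrightarrow> card I < Suc n"
    using le by (simp add: P_def less_Suc_eq_le)
  ultimately have "\<exists>I. P I \<and> (\<forall>J. P J \<longrightarrow> card J \<le> card I)"
    by (rule ex_has_greatest_nat)
  then obtain I where I: "P I" "\<And>J. P J \<Longrightarrow> card J \<le> card I" by blast
  then obtain g where g: "\<And>i. i < n \<Longrightarrow> g i < n" "Determinant.det (unit_row_completion n B I g) \<noteq> 0"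
    unfolding P_def by blast
  have sub: "I \<subseteq> {..<n}" using I(1) by (simp add: P_def)
  have dim: "kernel.dim n B = n - card I"
  proof (rule unit_row_completion_extend[OF B sub g])
    fix J h assume "J \<subseteq> {..<n}" "\<And>i. i < n \<Longrightarrow> h i < n" "Determinant.det (unit_row_completion n B J h) \<noteq> 0"
    then show "card J \<le> card I" using I(2)[of J] unfolding P_def by blast
  qed
  have cI: "card I \<le> n" using sub by (rule le)
  show ?thesis
  proof
    assume "kernel.dim n B \<le> n - r"
    then have "r \<le> card I" using dim r cI by linarith
    have "unit_row_completion n B I (restrict g {..<n}) = unit_row_completion n B I g"
      by (intro eq_matI) (auto simp: unit_row_completion_def)
    moreover have "restrict g {..<n} \<in> {..<n} \<rightarrow>\<^sub>E {..<n}" using g by auto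
    ultimately show "\<exists>I g. I \<subseteq> {..<n} \<and> g \<in> {..<n} \<rightarrow>\<^sub>E {..<n} \<and> r \<le> card I \<and> Determinant.det (unit_row_completion n B I g) \<noteq> 0"
      using sub g \<open>r \<le> card I\<close> by (intro exI[of _ I] exI[of _ "restrict g {..<n}"]) auto
  next
    assume "\<exists>I g. I \<subseteq> {..<n} \<and> g \<in> {..<n} \<rightarrow>\<^sub>E {..<n} \<and> r \<le> card I \<and> Determinant.det (unit_row_completion n B I g) \<noteq> 0"
    then obtain J h where J: "J \<subseteq> {..<n}" "h \<in> {..<n} \<rightarrow>\<^sub>E {..<n}" "r \<le> card J"
      "Determinant.det (unit_row_completion n B J h) \<noteq> 0" by blast
    then have "P J" unfolding P_def by (metis PiE_mem lessThan_iff)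
    then have "r \<le> card I" using I(2)[of J] J(3) by simp
    then show "kernel.dim n B \<le> n - r" unfolding dim by simp
  qed
qed

section \<open>Traces of powers\<close>

lemma index_mult_sum:
  assumes "A \<in> carrier_mat n n" "B \<in> carrier_mat n n" "i < n" "j < n"
  shows "(A * B) $$ (i, j) = (\<Sum>k<n. A $$ (i, k) * B $$ (k, j) :: complex)"
  using assms by (auto simp: scalar_prod_def atLeast0LessThan)

definition mat_trace :: "complex mat \<Rightarrow> complex" where
  "mat_trace M = (\<Sum>i<dim_row M. M $$ (i, i))"

lemma mat_trace_similar:
  assumes "similar_mat_wit A B P Q"
  shows "mat_trace A = mat_trace B"
proof -
  define n where "n = dim_row A"
  note * = similar_mat_witD[OF n_def assms]
  have PB: "P * B \<in> carrier_mat n n" using * by simp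
  have "mat_trace A = (\<Sum>i<n. (P * B * Q) $$ (i, i))"
    by (simp only: mat_trace_def n_def[symmetric] *(3)[symmetric])
  also have "\<dots> = (\<Sum>i<n. \<Sum>v<n. (P * B) $$ (i, v) * Q $$ (v, i))"
    by (intro sum.cong refl) (simp only: index_mult_sum[OF PB *(7)] lessThan_iff)
  also have "\<dots> = (\<Sum>i<n. \<Sum>v<n. \<Sum>u<n. P $$ (i, u) * B $$ (u, v) * Q $$ (v, i))"
    by (intro sum.cong refl) (simp add: index_mult_sum[OF *(6,5)] sum_distrib_right)
  also have "\<dots> = (\<Sum>v<n. \<Sum>i<n. \<Sum>u<n. P $$ (i, u) * B $$ (u, v) * Q $$ (v, i))"
    by (rule sum.swap)
  also have "\<dots> = (\<Sum>v<n. \<Sum>u<n. \<Sum>i<n. P $$ (i, u) * B $$ (u, v) * Q $$ (v, i))"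
    by (intro sum.cong refl sum.swap)
  also have "\<dots> = (\<Sum>v<n. \<Sum>u<n. B $$ (u, v) * (Q * P) $$ (v, u))"
    by (intro sum.cong refl) (simp add: index_mult_sum[OF *(7,6)] sum_distrib_left mult_ac)
  also have "\<dots> = (\<Sum>v<n. \<Sum>u<n. if u = v then B $$ (v, v) else 0)"
    by (intro sum.cong refl) (simp add: *(2))
  also have "\<dots> = mat_trace B" using * by (simp add: mat_trace_def)
  finally show ?thesis .
qed

lemma mat_trace_four_block_diag:
  assumes "A \<in> carrier_mat n n" "D \<in> carrier_mat m m"
  shows "mat_trace (four_block_mat A (0\<^sub>m n m) (0\<^sub>m m n) D) = mat_trace A + mat_trace D"
proof -
  have "mat_trace (four_block_mat A (0\<^sub>m n m) (0\<^sub>m m n) D) =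
    (\<Sum>i<n + m. if i < n then A $$ (i, i) else D $$ (i - n, i - n))"
    using assms by (auto simp: mat_trace_def intro!: sum.cong)
  also have "\<dots> = (\<Sum>i<n. A $$ (i, i)) + (\<Sum>i\<in>{n..<n + m}. D $$ (i - n, i - n))"
    by (subst lessThan_atLeast0, subst sum.atLeastLessThan_concat[of 0 n "n + m", symmetric])
      (auto simp: lessThan_atLeast0)
  also have "(\<Sum>i\<in>{n..<n + m}. D $$ (i - n, i - n)) = (\<Sum>i<m. D $$ (i, i))"
    by (rule sum.reindex_bij_witness[of _ "\<lambda>i. i + n" "\<lambda>i. i - n"]) auto
  finally show ?thesis using assms by (simp add: mat_trace_def)
qed

lemma jordan_matrix_Cons_pow:
  "jordan_matrix ((s, a) # bs) ^\<^sub>m k = four_block_mat (jordan_block s a ^\<^sub>m k)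
     (0\<^sub>m s (sum_list (map fst bs))) (0\<^sub>m (sum_list (map fst bs)) s) (jordan_matrix bs ^\<^sub>m k :: complex mat)"
  unfolding jordan_matrix_Cons
  by (rule pow_four_block_mat[of _ s _ "sum_list (map fst bs)"]) auto

lemma mat_trace_jordan_matrix_pow:
  "mat_trace (jordan_matrix bs ^\<^sub>m k) = (\<Sum>(s, a)\<leftarrow>bs. of_nat s * a ^ k)"
proof (induction bs)
  case Nil
  then show ?case by (simp add: mat_trace_def jordan_matrix_def)
next
  case (Cons p bs)
  obtain s a where p: "p = (s, a)" by (cases p)
  have "mat_trace (jordan_block s a ^\<^sub>m k) = of_nat s * a ^ k"
    by (simp add: mat_trace_def jordan_block_pow)
  then show ?case
    unfolding p jordan_matrix_Cons_pow
    by (subst mat_trace_four_block_diag) (auto simp: Cons)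
qed

text \<open>The algebraic multiplicity of \<open>a\<close>, read off from the list of Jordan blocks.\<close>

definition block_weight :: "(nat \<times> complex) list \<Rightarrow> complex \<Rightarrow> nat" where
  "block_weight bs a = (\<Sum>(s, b)\<leftarrow>bs. if b = a then s else 0)"

lemma sum_list_block_weight:
  fixes f :: "complex \<Rightarrow> complex"
  assumes "finite S" "snd ` set bs \<subseteq> S"
  shows "(\<Sum>(s, a)\<leftarrow>bs. of_nat s * f a) = (\<Sum>a\<in>S. of_nat (block_weight bs a) * f a)"
  using assms(2)
proof (induction bs)
  case (Cons p bs)
  obtain s b where p: "p = (s, b)" by (cases p)
  have "(\<Sum>a\<in>S. of_nat (block_weight (p # bs) a) * f a) =
    (\<Sum>a\<in>S. (if a = b then of_nat s * f b else 0) + of_nat (block_weight bs a) * f a)"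
    by (intro sum.cong refl) (auto simp: p block_weight_def algebra_simps)
  also have "\<dots> = of_nat s * f b + (\<Sum>a\<in>S. of_nat (block_weight bs a) * f a)"
    using Cons.prems assms(1) by (simp add: sum.distrib p)
  finally show ?case using Cons by (simp add: p)
qed (simp add: block_weight_def)

lemma block_weight_pos:
  assumes "0 \<notin> fst ` set bs" "a \<in> snd ` set bs"
  shows "block_weight bs a > 0"
  using assms
proof (induction bs)
  case (Cons p bs)
  then show ?case by (cases p) (auto simp: block_weight_def)
qed simp

lemma jordan_nf_sum_sizes:
  assumes "M \<in> carrier_mat n n" "jordan_nf M bs"
  shows "sum_list (map fst bs) = n"
  using assms unfolding jordan_nf_def
  by (metis carrier_matD(1) jordan_matrix_dim(1) similar_mat_def similar_mat_witD(5))

lemma spectrum_jordan_nf: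
  fixes M :: "complex mat"
  assumes M: "M \<in> carrier_mat n n" and bs: "jordan_nf M bs"
  shows "spectrum M = snd ` set bs"
proof -
  have 0: "0 \<notin> fst ` set bs" using bs by (simp add: jordan_nf_def)
  have "poly (\<Prod>(s, a)\<leftarrow>bs. [:- a, 1:] ^ s) x = 0 \<longleftrightarrow> x \<in> snd ` set bs" for x
    using 0
  proof (induction bs)
    case (Cons p bs)
    then show ?case by (cases p) (auto simp: image_iff)
  qed simp
  then show ?thesis
    unfolding spectrum_def eigenvalue_root_char_poly[OF M] jordan_nf_char_poly[OF bs] by auto
qed

lemma jordan_nf_complex_exists:
  fixes M :: "complex mat"
  assumes "M \<in> carrier_mat n n"
  obtains bs where "jordan_nf M bs"
  using char_poly_factorized[OF assms] jordan_nf_exists[OF assms] by blast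

text \<open>The traces of the powers are moments of a measure on the spectrum with nonzero weights, the multiplicities. This
  is where characteristic zero enters.\<close>

lemma mat_trace_pow_spectrum:
  assumes M: "M \<in> carrier_mat n n"
  obtains w :: "complex \<Rightarrow> complex" where "\<And>a. a \<in> spectrum M \<Longrightarrow> w a \<noteq> 0"
    "\<And>k. mat_trace (M ^\<^sub>m k) = (\<Sum>a\<in>spectrum M. w a * a ^ k)"
proof -
  obtain bs where bs: "jordan_nf M bs" using jordan_nf_complex_exists[OF M] .
  then obtain P Q where wit: "similar_mat_wit M (jordan_matrix bs) P Q"
    unfolding jordan_nf_def similar_mat_def by blast
  have sp: "spectrum M = snd ` set bs" by (rule spectrum_jordan_nf[OF M bs])
  show thesis
  proof (rule that[of "\<lambda>a. of_nat (block_weight bs a)"])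
    show "of_nat (block_weight bs a) \<noteq> (0::complex)" if "a \<in> spectrum M" for a
      using block_weight_pos[of bs a] that bs by (auto simp: sp jordan_nf_def)
    show "mat_trace (M ^\<^sub>m k) = (\<Sum>a\<in>spectrum M. of_nat (block_weight bs a) * a ^ k)" for k
      unfolding mat_trace_similar[OF similar_mat_wit_pow[OF wit]] mat_trace_jordan_matrix_pow
      by (rule sum_list_block_weight) (auto simp: sp)
  qed
qed

section \<open>Hankel matrices\<close>

definition hankel :: "nat \<Rightarrow> (nat \<Rightarrow> complex) \<Rightarrow> complex mat" where
  "hankel m t = mat m m (\<lambda>(i, j). t (i + j))"

lemma hankel_carrier [simp]: "hankel m t \<in> carrier_mat m m"
  by (simp add: hankel_def)

definition root_poly :: "complex set \<Rightarrow> complex poly" where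
  "root_poly S = (\<Prod>a\<in>S. [:-a, 1:])"

lemma root_poly_props:
  assumes "finite S"
  shows "degree (root_poly S) = card S" "coeff (root_poly S) (card S) = 1"
    "poly (root_poly S) x = 0 \<longleftrightarrow> x \<in> S"
proof -
  show d: "degree (root_poly S) = card S"
    unfolding root_poly_def by (subst degree_prod_eq_sum_degree) auto
  have "lead_coeff (root_poly S) = 1"
    unfolding root_poly_def lead_coeff_prod by (simp)
  then show "coeff (root_poly S) (card S) = 1" by (simp add: d)
  show "poly (root_poly S) x = 0 \<longleftrightarrow> x \<in> S"
    unfolding root_poly_def poly_prod using assms by auto
qed

lemma poly_eq_sum_lessThan:
  fixes p :: "complex poly"
  assumes "degree p < m"
  shows "poly p x = (\<Sum>i<m. coeff p i * x ^ i)"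
  unfolding poly_altdef
  by (rule sum.mono_neutral_left) (use assms in \<open>auto simp: coeff_eq_0\<close>)

context
  fixes S :: "complex set" and w :: "complex \<Rightarrow> complex" and t :: "nat \<Rightarrow> complex"
  assumes fin: "finite S" and w: "\<And>a. a \<in> S \<Longrightarrow> w a \<noteq> 0"
    and t: "\<And>k. t k = (\<Sum>a\<in>S. w a * a ^ k)"
begin

text \<open>The Hankel matrix applied to the coefficients \<open>x\<close> of a polynomial tests the values of this polynomial on \<open>S\<close>
  against powers.\<close>

lemma hankel_apply:
  "(\<Sum>j<m. t (i + j) * x j) = (\<Sum>a\<in>S. w a * a ^ i * (\<Sum>j<m. x j * a ^ j))"
  unfolding t sum_distrib_right sum_distrib_left
  by (subst sum.swap) (simp add: power_add mult_ac)

lemma det_hankel_eq_0: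
  assumes "card S < m"
  shows "Determinant.det (hankel m t) = 0"
proof -
  \<comment> \<open>the polynomial with the roots \<open>S\<close> has degree less than \<open>m\<close>, its coefficients lie in the kernel\<close>
  let ?q = "root_poly S"
  have "(\<Sum>j<m. hankel m t $$ (i, j) * coeff ?q j) = 0" if "i < m" for i
  proof -
    have "(\<Sum>j<m. hankel m t $$ (i, j) * coeff ?q j) = (\<Sum>j<m. t (i + j) * coeff ?q j)"
      using that by (simp add: hankel_def)
    also have "\<dots> = (\<Sum>a\<in>S. w a * a ^ i * poly ?q a)"
      unfolding hankel_apply using assms root_poly_props(1)[OF fin]
      by (simp add: poly_eq_sum_lessThan)
    also have "\<dots> = 0" using root_poly_props(3)[OF fin] by simp
    finally show ?thesis .
  qed
  moreover have "coeff ?q (card S) \<noteq> 0" using root_poly_props(2)[OF fin] by simp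
  ultimately show ?thesis
    using det_eq_0_iff_function[OF hankel_carrier, of m t] assms by blast
qed

lemma det_hankel_neq_0:
  "Determinant.det (hankel (card S) t) \<noteq> 0"
proof
  let ?m = "card S"
  assume "Determinant.det (hankel ?m t) = 0"
  then obtain x where x: "\<exists>i<?m. x i \<noteq> 0"
    "\<And>i. i < ?m \<Longrightarrow> (\<Sum>j<?m. hankel ?m t $$ (i, j) * x j) = 0"
    using det_eq_0_iff_function[OF hankel_carrier, of ?m t] by auto
  define p where "p = (\<Sum>j<?m. monom (x j) j)"
  have cp: "coeff p i = (if i < ?m then x i else 0)" for i
    unfolding p_def coeff_sum by (simp)
  have pp: "poly p a = (\<Sum>j<?m. x j * a ^ j)" for a
    by (simp add: p_def poly_sum poly_monom)
  have ps: "(\<Sum>a\<in>S. w a * a ^ i * poly p a) = 0" if "i < ?m" for i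
    using x(2)[OF that] that by (simp add: hankel_def hankel_apply pp)
  have root: "poly p a = 0" if a: "a \<in> S" for a
  proof -
    \<comment> \<open>testing against the Lagrange polynomial of \<open>a\<close> isolates the value at \<open>a\<close>\<close>
    let ?y = "root_poly (S - {a})"
    have dy: "degree ?y < ?m"
      using card_Diff1_less[OF fin a] fin by (simp add: root_poly_props)
    have "(\<Sum>b\<in>S. w b * poly ?y b * poly p b) = (\<Sum>b\<in>S. \<Sum>i<?m. coeff ?y i * (w b * b ^ i * poly p b))"
      unfolding poly_eq_sum_lessThan[OF dy] by (simp add: sum_distrib_left sum_distrib_right mult_ac)
    also have "\<dots> = (\<Sum>i<?m. \<Sum>b\<in>S. coeff ?y i * (w b * b ^ i * poly p b))" by (rule sum.swap)
    also have "\<dots> = 0" by (simp add: sum_distrib_left[symmetric] ps)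
    finally have "0 = (\<Sum>b\<in>S. w b * poly ?y b * poly p b)" by simp
    also have "\<dots> = (\<Sum>b\<in>S. if b = a then w a * poly ?y a * poly p a else 0)"
      using fin root_poly_props(3)[of "S - {a}"] by (intro sum.cong refl) auto
    also have "\<dots> = w a * poly ?y a * poly p a" using fin a by simp
    finally show ?thesis using w[OF a] fin root_poly_props(3)[of "S - {a}" a] by simp
  qed
  have "p = 0"
  proof (rule ccontr)
    assume p: "p \<noteq> 0"
    have "?m \<le> card {a. poly p a = 0}" using root p by (intro card_mono poly_roots_finite) auto
    also have "\<dots> \<le> degree p" by (rule card_poly_roots_bound[OF p])
    also have "degree p < ?m" 
      using x(1) cp by (intro degree_lessI) auto
    finally show False by simp
  qed
  then show False using x(1) cp by (metis coeff_0)
qed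

text \<open>The relations \<open>\<Sum>a\<in>S. w a * a^j * q(a) = 0\<close> are linear equations with the matrix \<open>H\<close> for the lower coefficients
  of the monic polynomial \<open>q\<close>; multiplying by the adjugate matrix avoids the division by the determinant.\<close>

lemma hankel_cramer:
  assumes "i < card S"
  shows "(\<Sum>j<card S. adj_mat (hankel (card S) t) $$ (i, j) * - t (j + card S)) =
    Determinant.det (hankel (card S) t) * coeff (root_poly S) i"
proof -
  let ?m = "card S" and ?q = "root_poly S"
  let ?H = "hankel ?m t"
  have rhs: "- t (j + ?m) = (\<Sum>l<?m. t (j + l) * coeff ?q l)" for j
  proof -
    have "(\<Sum>l<?m. t (j + l) * coeff ?q l) + t (j + ?m) = (\<Sum>l<Suc ?m. t (j + l) * coeff ?q l)"
      using root_poly_props(2)[OF fin] by simp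
    also have "\<dots> = (\<Sum>a\<in>S. w a * a ^ j * poly ?q a)"
      unfolding hankel_apply using root_poly_props(1)[OF fin]
      by (simp only: poly_eq_sum_lessThan[of ?q "Suc ?m"])
    also have "\<dots> = 0" using root_poly_props(3)[OF fin] by simp
    finally show ?thesis by (simp add: add_eq_0_iff)
  qed
  have "(\<Sum>j<?m. adj_mat ?H $$ (i, j) * - t (j + ?m)) =
      (\<Sum>j<?m. \<Sum>l<?m. adj_mat ?H $$ (i, j) * ?H $$ (j, l) * coeff ?q l)"
    unfolding rhs by (intro sum.cong refl) (simp add: sum_distrib_left hankel_def mult.assoc)
  also have "\<dots> = (\<Sum>l<?m. \<Sum>j<?m. adj_mat ?H $$ (i, j) * ?H $$ (j, l) * coeff ?q l)" by (rule sum.swap)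
  also have "\<dots> = (\<Sum>l<?m. (adj_mat ?H * ?H) $$ (i, l) * coeff ?q l)"
    by (intro sum.cong refl)
      (simp add: index_mult_sum[OF adj_mat(1)[OF hankel_carrier] hankel_carrier] assms sum_distrib_right)
  also have "\<dots> = (\<Sum>l<?m. if l = i then Determinant.det ?H * coeff ?q i else 0)"
    using assms by (intro sum.cong refl) (auto simp: adj_mat(3)[OF hankel_carrier])
  finally show ?thesis using assms by simp
qed

end

section \<open>Polynomials of a matrix\<close>

definition mat_poly :: "nat \<Rightarrow> complex poly \<Rightarrow> complex mat \<Rightarrow> complex mat" where
  "mat_poly n f M = mat n n (\<lambda>(i, j). \<Sum>k\<le>degree f. coeff f k * (M ^\<^sub>m k) $$ (i, j))"

lemma mat_poly_carrier [simp]: "mat_poly n f M \<in> carrier_mat n n"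
  by (simp add: mat_poly_def)

lemma mat_poly_dim [simp]: "dim_row (mat_poly n f M) = n" "dim_col (mat_poly n f M) = n"
  by (simp_all add: mat_poly_def)

lemma mat_poly_index:
  assumes "i < n" "j < n" "degree f \<le> K"
  shows "mat_poly n f M $$ (i, j) = (\<Sum>k\<le>K. coeff f k * (M ^\<^sub>m k) $$ (i, j))"
  unfolding mat_poly_def using assms
  by (simp, intro sum.mono_neutral_left) (auto simp: coeff_eq_0)

lemma pow_mat_Suc_left:
  assumes M: "M \<in> carrier_mat n n"
  shows "M * M ^\<^sub>m k = M ^\<^sub>m Suc k"
proof (induction k)
  case 0
  then show ?case using M by simp
next
  case (Suc k)
  have "M * M ^\<^sub>m Suc k = M * M ^\<^sub>m k * M"
    using assoc_mult_mat[OF M pow_carrier_mat[OF M] M, of k] by simp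
  then show ?case using Suc by simp
qed

lemma mat_poly_linear_mult:
  fixes M :: "complex mat"
  assumes M: "M \<in> carrier_mat n n"
  shows "mat_poly n ([:-a, 1:] * g) M = (M + (- a) \<cdot>\<^sub>m 1\<^sub>m n) * mat_poly n g M" (is "?L = ?R1")
    and "mat_poly n ([:-a, 1:] * g) M = mat_poly n g M * (M + (- a) \<cdot>\<^sub>m 1\<^sub>m n)" (is "_ = ?R2")
proof -
  define d where "d = degree g"
  define M' where "M' = M + (- a) \<cdot>\<^sub>m 1\<^sub>m n"
  have M': "M' \<in> carrier_mat n n" using M by (simp add: M'_def)
  have M'ij: "M' $$ (i, j) = M $$ (i, j) - (if i = j then a else 0)" if "i < n" "j < n" for i j
    using that M by (simp add: M'_def)
  have mm: "(M * M ^\<^sub>m k) $$ (i, j) = (M ^\<^sub>m k * M) $$ (i, j)" for i j k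
    using pow_mat_Suc_left[OF M] by simp
  have L: "?L $$ (i, j) = (\<Sum>k\<le>d. coeff g k * ((M ^\<^sub>m Suc k) $$ (i, j) - a * (M ^\<^sub>m k) $$ (i, j)))"
    if "i < n" "j < n" for i j
  proof -
    have "degree ([:-a, 1:] * g) \<le> Suc d"
      using degree_mult_le[of "[:-a, 1:]" g] by (simp add: d_def)
    then have "?L $$ (i, j) = (\<Sum>k\<le>Suc d. coeff ([:-a, 1:] * g) k * (M ^\<^sub>m k) $$ (i, j))"
      by (rule mat_poly_index[OF that])
    also have "\<dots> = (\<Sum>k\<le>Suc d. coeff (pCons 0 g) k * (M ^\<^sub>m k) $$ (i, j)) -
        (\<Sum>k\<le>Suc d. a * coeff g k * (M ^\<^sub>m k) $$ (i, j))"
      by (simp add: algebra_simps sum_subtractf del: sum.atMost_Suc pow_mat.simps)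
    also have "(\<Sum>k\<le>Suc d. coeff (pCons 0 g) k * (M ^\<^sub>m k) $$ (i, j)) =
        (\<Sum>k\<le>d. coeff g k * (M ^\<^sub>m Suc k) $$ (i, j))"
      by (subst sum.atMost_Suc_shift) (simp del: pow_mat.simps)
    also have "(\<Sum>k\<le>Suc d. a * coeff g k * (M ^\<^sub>m k) $$ (i, j)) = (\<Sum>k\<le>d. a * coeff g k * (M ^\<^sub>m k) $$ (i, j))"
      by (simp add: d_def coeff_eq_0 del: pow_mat.simps)
    finally show ?thesis by (simp add: algebra_simps sum_subtractf del: pow_mat.simps)
  qed
  have G: "mat_poly n g M $$ (i, j) = (\<Sum>k\<le>d. coeff g k * (M ^\<^sub>m k) $$ (i, j))" if "i < n" "j < n" for i j
    using mat_poly_index[OF that, of g d] by (simp add: d_def)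
  show "?L = ?R1"
  proof (rule eq_matI)
    fix i j assume "i < dim_row ?R1" "j < dim_col ?R1"
    then have ij: "i < n" "j < n" using M by auto
    have "?R1 $$ (i, j) = (\<Sum>u<n. (M $$ (i, u) - (if i = u then a else 0)) * (\<Sum>k\<le>d. coeff g k * (M ^\<^sub>m k) $$ (u, j)))"
      unfolding M'_def[symmetric] index_mult_sum[OF M' mat_poly_carrier ij]
      by (intro sum.cong refl) (simp add: M'ij G ij)
    also have "\<dots> = (\<Sum>k\<le>d. \<Sum>u<n. coeff g k * (M $$ (i, u) * (M ^\<^sub>m k) $$ (u, j) - (if u = i then a * (M ^\<^sub>m k) $$ (i, j) else 0)))"
      unfolding sum_distrib_left by (subst sum.swap) (intro sum.cong refl, auto simp: algebra_simps)
    also have "\<dots> = (\<Sum>k\<le>d. coeff g k * ((M * M ^\<^sub>m k) $$ (i, j) - a * (M ^\<^sub>m k) $$ (i, j)))"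
      using ij by (simp add: sum_distrib_left[symmetric] sum_subtractf index_mult_sum[OF M pow_carrier_mat[OF M]] del: pow_mat.simps)
    also have "\<dots> = ?L $$ (i, j)" unfolding L[OF ij] by (simp only: pow_mat.simps mm)
    finally show "?L $$ (i, j) = ?R1 $$ (i, j)" by (rule sym)
  qed (use M in auto)
  show "?L = ?R2"
  proof (rule eq_matI)
    fix i j assume "i < dim_row ?R2" "j < dim_col ?R2"
    then have ij: "i < n" "j < n" using M by auto
    have "?R2 $$ (i, j) = (\<Sum>u<n. (\<Sum>k\<le>d. coeff g k * (M ^\<^sub>m k) $$ (i, u)) * (M $$ (u, j) - (if u = j then a else 0)))"
      unfolding M'_def[symmetric] index_mult_sum[OF mat_poly_carrier M' ij]
      by (intro sum.cong refl) (simp add: M'ij G ij)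
    also have "\<dots> = (\<Sum>k\<le>d. \<Sum>u<n. coeff g k * ((M ^\<^sub>m k) $$ (i, u) * M $$ (u, j) - (if u = j then a * (M ^\<^sub>m k) $$ (i, j) else 0)))"
      unfolding sum_distrib_right by (subst sum.swap) (intro sum.cong refl, auto simp: algebra_simps)
    also have "\<dots> = (\<Sum>k\<le>d. coeff g k * ((M ^\<^sub>m k * M) $$ (i, j) - a * (M ^\<^sub>m k) $$ (i, j)))"
      using ij by (simp add: sum_distrib_left[symmetric] sum_subtractf index_mult_sum[OF pow_carrier_mat[OF M] M] del: pow_mat.simps)
    also have "\<dots> = ?L $$ (i, j)" unfolding L[OF ij] by (simp only: pow_mat.simps)
    finally show "?L $$ (i, j) = ?R2 $$ (i, j)" by (rule sym)
  qed (use M in auto)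
qed

lemma mat_poly_similar:
  assumes wit: "similar_mat_wit M J P Q" and M: "M \<in> carrier_mat n n"
  shows "similar_mat_wit (mat_poly n f M) (mat_poly n f J) P Q"
proof -
  note * = similar_mat_witD2[OF M wit]
  define d where "d = degree f"
  have PfJ: "P * mat_poly n f J \<in> carrier_mat n n" using * by simp
  have G: "mat_poly n f X $$ (i, j) = (\<Sum>k\<le>d. coeff f k * (X ^\<^sub>m k) $$ (i, j))" if "i < n" "j < n" for i j X
    using mat_poly_index[OF that, of f d] by (simp add: d_def)
  have "mat_poly n f M = P * mat_poly n f J * Q"
  proof (rule eq_matI)
    fix i j assume "i < dim_row (P * mat_poly n f J * Q)" "j < dim_col (P * mat_poly n f J * Q)"
    then have ij: "i < n" "j < n" using * by auto
    have "mat_poly n f M $$ (i, j) = (\<Sum>k\<le>d. coeff f k * (P * J ^\<^sub>m k * Q) $$ (i, j))"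
      by (simp add: G[OF ij] similar_mat_wit_pow_id[OF wit])
    also have "\<dots> = (\<Sum>k\<le>d. coeff f k * (\<Sum>v<n. \<Sum>u<n. P $$ (i, u) * (J ^\<^sub>m k) $$ (u, v) * Q $$ (v, j)))"
      by (intro sum.cong refl arg_cong2[where f="(*)"])
        (simp add: index_mult_sum[OF mult_carrier_mat[OF *(6) pow_carrier_mat[OF *(5)]] *(7)]
          index_mult_sum[OF *(6) pow_carrier_mat[OF *(5)]] ij sum_distrib_right del: pow_mat.simps)
    also have "\<dots> = (\<Sum>k\<le>d. \<Sum>v<n. \<Sum>u<n. P $$ (i, u) * (coeff f k * (J ^\<^sub>m k) $$ (u, v)) * Q $$ (v, j))"
      by (simp add: sum_distrib_left mult_ac)
    also have "\<dots> = (\<Sum>v<n. \<Sum>k\<le>d. \<Sum>u<n. P $$ (i, u) * (coeff f k * (J ^\<^sub>m k) $$ (u, v)) * Q $$ (v, j))"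
      by (rule sum.swap)
    also have "\<dots> = (\<Sum>v<n. \<Sum>u<n. \<Sum>k\<le>d. P $$ (i, u) * (coeff f k * (J ^\<^sub>m k) $$ (u, v)) * Q $$ (v, j))"
      by (intro sum.cong refl sum.swap)
    also have "\<dots> = (P * mat_poly n f J * Q) $$ (i, j)"
      unfolding index_mult_sum[OF PfJ *(7) ij]
      by (intro sum.cong refl)
        (simp add: index_mult_sum[OF *(6) mat_poly_carrier] ij G sum_distrib_right sum_distrib_left del: pow_mat.simps)
    finally show "mat_poly n f M $$ (i, j) = (P * mat_poly n f J * Q) $$ (i, j)" .
  qed (use * in auto)
  then show ?thesis using *(1,2,6,7) mult_carrier_mat[OF PfJ *(7)] by (simp add: similar_mat_wit_def Let_def)
qed

lemma mat_poly_jordan_matrix_Cons: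
  "mat_poly (s + sum_list (map fst bs)) f (jordan_matrix ((s, a) # bs)) =
   four_block_mat (mat_poly s f (jordan_block s a)) (0\<^sub>m s (sum_list (map fst bs)))
     (0\<^sub>m (sum_list (map fst bs)) s) (mat_poly (sum_list (map fst bs)) f (jordan_matrix bs))"
proof (rule eq_matI, goal_cases)
  case (1 i j)
  have dims: "dim_row (jordan_matrix bs ^\<^sub>m k) = sum_list (map fst bs)"
    "dim_col (jordan_matrix bs ^\<^sub>m k) = sum_list (map fst bs)" for k
    using pow_carrier_mat[OF jordan_matrix_carrier] carrier_matD by blast+
  from 1 show ?case
    unfolding mat_poly_def jordan_matrix_Cons_pow by (auto simp: dims simp del: pow_mat_dim)
qed auto

lemma pow_mat_mult_commute:
  fixes A B :: "complex mat"
  assumes A: "A \<in> carrier_mat n n" and B: "B \<in> carrier_mat n n" and c: "A * B = B * A"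
  shows "(A * B) ^\<^sub>m k = A ^\<^sub>m k * B ^\<^sub>m k"
proof (induction k)
  case 0
  then show ?case using A B by simp
next
  case (Suc k)
  have comm: "B ^\<^sub>m k * A = A * B ^\<^sub>m k" for k
  proof (induction k)
    case 0
    then show ?case using A B by simp
  next
    case (Suc k)
    have "B ^\<^sub>m Suc k * A = B ^\<^sub>m k * (B * A)"
      using assoc_mult_mat[OF pow_carrier_mat[OF B] B A] by simp
    also have "\<dots> = B ^\<^sub>m k * A * B"
      using assoc_mult_mat[OF pow_carrier_mat[OF B] A B] c by simp
    also have "\<dots> = A * (B ^\<^sub>m k * B)"
      unfolding Suc by (rule assoc_mult_mat[OF A pow_carrier_mat[OF B] B])
    finally show ?case by simp
  qed
  note Ak = pow_carrier_mat[OF A, of k] and Bk = pow_carrier_mat[OF B, of k]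
  have "(A * B) ^\<^sub>m Suc k = A ^\<^sub>m k * B ^\<^sub>m k * (A * B)" using Suc by simp
  also have "\<dots> = A ^\<^sub>m k * (B ^\<^sub>m k * (A * B))"
    by (rule assoc_mult_mat[OF Ak Bk mult_carrier_mat[OF A B]])
  also have "B ^\<^sub>m k * (A * B) = A * (B ^\<^sub>m k * B)"
    using assoc_mult_mat[OF Bk A B] assoc_mult_mat[OF A Bk B] comm by metis
  also have "A ^\<^sub>m k * (A * (B ^\<^sub>m k * B)) = A ^\<^sub>m k * A * (B ^\<^sub>m k * B)"
    by (rule assoc_mult_mat[OF Ak A mult_carrier_mat[OF Bk B], symmetric])
  finally show ?case by simp
qed

text \<open>Only the factor \<open>X - a\<close> of the polynomial matters on a Jordan block with the eigenvalue \<open>a\<close>: the value of the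
  other factor is an upper triangular matrix with the diagonal entries \<open>poly g a\<close>, hence invertible, and commutes with
  the nilpotent block.\<close>

lemma kernel_dim_mat_poly_jordan_block:
  assumes g: "poly g a \<noteq> 0"
  shows "kernel.dim s (mat_poly s ([:-a, 1:] * g) (jordan_block s a) ^\<^sub>m k) = min k s"
proof -
  let ?J = "jordan_block s a" and ?N = "jordan_block s (0::complex)"
  define R where "R = mat_poly s g ?J"
  have R: "R \<in> carrier_mat s s" by (simp add: R_def)
  have N: "?J + (- a) \<cdot>\<^sub>m 1\<^sub>m s = ?N" by (rule eq_matI) auto
  have eq: "mat_poly s ([:-a, 1:] * g) ?J = ?N * R" "?N * R = R * ?N"
    using mat_poly_linear_mult[OF jordan_block_carrier, of s a g a] unfolding N R_def by auto
  have ut: "upper_triangular R"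
    by (rule upper_triangularI) (auto simp: R_def mat_poly_def jordan_block_pow)
  have "diag_mat R = replicate s (poly g a)"
    by (rule nth_equalityI) (auto simp: R_def mat_poly_def diag_mat_def jordan_block_pow poly_altdef)
  then have "Determinant.det R = poly g a ^ s"
    using det_upper_triangular[OF ut R] by simp
  moreover have "Determinant.det (R ^\<^sub>m k) = Determinant.det R ^ k"
    by (induction k) (use R in \<open>simp_all add: det_mult[OF pow_carrier_mat[OF R] R]\<close>)
  ultimately have "Determinant.det (R ^\<^sub>m k) \<noteq> 0" using g by simp
  then obtain Ri where Ri: "Ri \<in> carrier_mat s s" "R ^\<^sub>m k * Ri = 1\<^sub>m s"
    using det_nonzero_inverse[OF pow_carrier_mat[OF R]] by blast
  have "kernel.dim s (?N ^\<^sub>m k * R ^\<^sub>m k) = kernel.dim s (?N ^\<^sub>m k)"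
    by (rule mat_kernel_dim_mult_eq_right[OF _ _ Ri]) (use R in auto)
  then show ?thesis
    unfolding eq(1) pow_mat_mult_commute[OF jordan_block_carrier R eq(2)]
    using dim_kernel_zero_jordan_block_pow[of s k, where ?'a=complex] by simp
qed

lemma kernel_dim_mat_poly_jordan_matrix:
  assumes "\<And>a. a \<in> snd ` set bs \<Longrightarrow> \<exists>g. f = [:-a, 1:] * g \<and> poly g a \<noteq> 0"
  shows "kernel.dim (sum_list (map fst bs)) (mat_poly (sum_list (map fst bs)) f (jordan_matrix bs) ^\<^sub>m k) =
    (\<Sum>(s, a)\<leftarrow>bs. min k s)"
  using assms
proof (induction bs)
  case Nil
  have "mat_poly 0 f (jordan_matrix []) ^\<^sub>m k = 1\<^sub>m 0"
    by (rule eq_matI) (auto)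
  then show ?case using kernel_one_mat(1)[where n=0 and ?'a=complex] by simp
next
  case (Cons p bs)
  obtain s a where p: "p = (s, a)" by (cases p)
  let ?n = "sum_list (map fst bs)"
  obtain g where g: "f = [:-a, 1:] * g" "poly g a \<noteq> 0" using Cons.prems[of a] p by auto
  have "mat_poly (s + ?n) f (jordan_matrix ((s, a) # bs)) ^\<^sub>m k =
    four_block_mat (mat_poly s f (jordan_block s a) ^\<^sub>m k) (0\<^sub>m s ?n) (0\<^sub>m ?n s)
      (mat_poly ?n f (jordan_matrix bs) ^\<^sub>m k)"
    unfolding mat_poly_jordan_matrix_Cons by (rule pow_four_block_mat) auto
  from kernel_four_block_0_mat[OF this] have
    "kernel.dim (s + ?n) (mat_poly (s + ?n) f (jordan_matrix ((s, a) # bs)) ^\<^sub>m k) =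
     kernel.dim s (mat_poly s f (jordan_block s a) ^\<^sub>m k) + kernel.dim ?n (mat_poly ?n f (jordan_matrix bs) ^\<^sub>m k)"
    by simp
  also have "kernel.dim s (mat_poly s f (jordan_block s a) ^\<^sub>m k) = min k s"
    unfolding g(1) by (rule kernel_dim_mat_poly_jordan_block[OF g(2)])
  also have "kernel.dim ?n (mat_poly ?n f (jordan_matrix bs) ^\<^sub>m k) = (\<Sum>(s, a)\<leftarrow>bs. min k s)"
    by (rule Cons.IH) (use Cons.prems in auto)
  finally show ?case by (simp add: p)
qed

text \<open>The roots of \<open>root_poly (spectrum M)\<close> are simple, so each Jordan block of size \<open>s\<close> contributes \<open>min k s\<close>.\<close>

lemma kernel_dim_mat_poly_pow:
  fixes M :: "complex mat"
  assumes M: "M \<in> carrier_mat n n" and bs: "jordan_nf M bs" and c: "c \<noteq> 0"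
  shows "kernel.dim n (mat_poly n (Polynomial.smult c (root_poly (spectrum M))) M ^\<^sub>m k) = (\<Sum>(s, a)\<leftarrow>bs. min k s)"
proof -
  let ?f = "Polynomial.smult c (root_poly (spectrum M))"
  obtain P Q where wit: "similar_mat_wit M (jordan_matrix bs) P Q"
    using bs unfolding jordan_nf_def similar_mat_def by blast
  have n: "sum_list (map fst bs) = n" by (rule jordan_nf_sum_sizes[OF M bs])
  have fin: "finite (spectrum M)" by (rule card_finite_spectrum(1)[OF M])
  have roots: "\<exists>g. ?f = [:-a, 1:] * g \<and> poly g a \<noteq> 0" if "a \<in> snd ` set bs" for a
  proof (intro exI conjI)
    have a: "a \<in> spectrum M" using that spectrum_jordan_nf[OF M bs] by simp
    show "?f = [:-a, 1:] * Polynomial.smult c (root_poly (spectrum M - {a}))"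
      unfolding root_poly_def using prod.remove[OF fin a, of "\<lambda>a. [:-a, 1:]"] by simp
    show "poly (Polynomial.smult c (root_poly (spectrum M - {a}))) a \<noteq> 0"
      using fin c root_poly_props(3)[of "spectrum M - {a}" a] by simp
  qed
  show ?thesis
    using kernel_dim_mat_poly_jordan_matrix[of bs ?f k, OF roots]
      similar_mat_wit_kernel_dim[OF pow_carrier_mat[OF mat_poly_carrier] similar_mat_wit_pow[OF mat_poly_similar[OF wit M]]]
    unfolding n by simp
qed

section \<open>The Jordan type from kernel dimensions\<close>

text \<open>The second statement is the second difference \<open>2 * min l s - min (l - 1) s - min (l + 1) s\<close>, which is \<open>1\<close> for
  \<open>s = l\<close> and \<open>0\<close> otherwise.\<close>

lemma Jordan_block_counts:
  fixes M :: "complex mat"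
  assumes M: "M \<in> carrier_mat n n" and bs: "jordan_nf M bs"
  shows "(\<Sum>(s, a)\<leftarrow>bs. min k s) = (\<Sum>l\<in>{1..n}. min k l * num_jordan_blocks l M)"
    and "l \<ge> 1 \<Longrightarrow> 2 * (\<Sum>(s, a)\<leftarrow>bs. min l s) =
      (\<Sum>(s, a)\<leftarrow>bs. min (l - 1) s) + (\<Sum>(s, a)\<leftarrow>bs. min (l + 1) s) + num_jordan_blocks l M"
proof -
  have pos: "\<forall>(s, a)\<in>set bs. 1 \<le> s \<and> s \<le> n"
  proof (clarify)
    fix s a assume sa: "(s, a) \<in> set bs"
    then have "s \<in> set (map fst bs)" by force
    then have "s \<le> sum_list (map fst bs)" by (rule member_le_sum_list) simp_all
    moreover have "s \<noteq> 0" using bs sa unfolding jordan_nf_def by force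
    ultimately show "1 \<le> s \<and> s \<le> n" using jordan_nf_sum_sizes[OF M bs] by simp
  qed
  show "(\<Sum>(s, a)\<leftarrow>bs. min k s) = (\<Sum>l\<in>{1..n}. min k l * num_jordan_blocks l M)"
    unfolding num_jordan_blocks_eq[OF bs] using pos
  proof (induction bs)
    case (Cons p bs)
    obtain s a where p: "p = (s, a)" by (cases p)
    have "(\<Sum>l\<in>{1..n}. min k l * length (filter (\<lambda>(k, ev). k = l) (p # bs))) =
      (\<Sum>l\<in>{1..n}. (if l = s then min k s else 0) + min k l * length (filter (\<lambda>(k, ev). k = l) bs))"
      by (intro sum.cong refl) (auto simp: p)
    also have "\<dots> = min k s + (\<Sum>l\<in>{1..n}. min k l * length (filter (\<lambda>(k, ev). k = l) bs))"
      using Cons.prems by (simp add: sum.distrib p)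
    finally show ?case using Cons by (simp add: p)
  qed simp
  show "2 * (\<Sum>(s, a)\<leftarrow>bs. min l s) =
      (\<Sum>(s, a)\<leftarrow>bs. min (l - 1) s) + (\<Sum>(s, a)\<leftarrow>bs. min (l + 1) s) + num_jordan_blocks l M" if "l \<ge> 1"
    unfolding num_jordan_blocks_eq[OF bs]
  proof (induction bs)
    case (Cons p bs)
    obtain s a where p: "p = (s, a)" by (cases p)
    have "2 * min l s = min (l - 1) s + min (l + 1) s + (if s = l then 1 else 0)"
      using that by (auto simp: min_def)
    then show ?case using Cons by (simp add: p)
  qed simp
qed

lemma kernel_dim_le:
  fixes B :: "complex mat"
  assumes B: "B \<in> carrier_mat n n"
  shows "kernel.dim n B \<le> n"
proof -
  have "unit_row_completion n B {} (restrict id {..<n}) = 1\<^sub>m n"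
    by (rule eq_matI) (auto simp: unit_row_completion_def)
  then have "Determinant.det (unit_row_completion n B {} (restrict id {..<n})) \<noteq> 0" by simp
  moreover have "restrict id {..<n} \<in> {..<n} \<rightarrow>\<^sub>E {..<n}" by auto
  ultimately show ?thesis
    using kernel_dim_le_iff_completion[OF B, of 0] by (metis diff_zero empty_subsetI zero_le)
qed

text \<open>The matrix \<open>D * q(M)\<close>, where \<open>q\<close> is the radical of the characteristic polynomial and \<open>D\<close> the Hankel determinant,
  written as a polynomial in the entries of \<open>M\<close>. It has this meaning if \<open>M\<close> has exactly \<open>m\<close> eigenvalues.\<close>

definition scaled_radical :: "nat \<Rightarrow> nat \<Rightarrow> complex mat \<Rightarrow> complex mat" where
  "scaled_radical n m M =
    (let t = \<lambda>k. mat_trace (M ^\<^sub>m k); H = hankel m t in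
     mat n n (\<lambda>(i, j). (\<Sum>k<m. (\<Sum>l<m. adj_mat H $$ (k, l) * - t (l + m)) * (M ^\<^sub>m k) $$ (i, j))
       + Determinant.det H * (M ^\<^sub>m m) $$ (i, j)))"

text \<open>If \<open>M\<close> has size \<open>m\<close>, this is the discriminant of the characteristic polynomial.\<close>

definition spectral_discriminant :: "nat \<Rightarrow> complex mat \<Rightarrow> complex" where
  "spectral_discriminant m M = Determinant.det (hankel m (\<lambda>k. mat_trace (M ^\<^sub>m k)))"

lemma spectral_discriminant_eq_0:
  assumes "M \<in> carrier_mat n n" "card (spectrum M) < m"
  shows "spectral_discriminant m M = 0"
proof -
  obtain w where w: "\<And>a. a \<in> spectrum M \<Longrightarrow> w a \<noteq> 0"
    "\<And>k. mat_trace (M ^\<^sub>m k) = (\<Sum>a\<in>spectrum M. w a * a ^ k)"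
    using mat_trace_pow_spectrum[OF assms(1)] by blast
  show ?thesis unfolding spectral_discriminant_def
    by (rule det_hankel_eq_0[OF card_finite_spectrum(1)[OF assms(1)] w assms(2)])
qed

lemma spectral_discriminant_neq_0:
  assumes "M \<in> carrier_mat n n"
  shows "spectral_discriminant (card (spectrum M)) M \<noteq> 0"
proof -
  obtain w where w: "\<And>a. a \<in> spectrum M \<Longrightarrow> w a \<noteq> 0"
    "\<And>k. mat_trace (M ^\<^sub>m k) = (\<Sum>a\<in>spectrum M. w a * a ^ k)"
    using mat_trace_pow_spectrum[OF assms(1)] by blast
  show ?thesis unfolding spectral_discriminant_def
    by (rule det_hankel_neq_0[OF card_finite_spectrum(1)[OF assms(1)] w])
qed

lemma scaled_radical_eq:
  assumes M: "M \<in> carrier_mat n n" and m: "m = card (spectrum M)"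
  shows "scaled_radical n m M = mat_poly n (Polynomial.smult (spectral_discriminant m M) (root_poly (spectrum M))) M"
proof -
  obtain w where w: "\<And>a. a \<in> spectrum M \<Longrightarrow> w a \<noteq> 0"
    "\<And>k. mat_trace (M ^\<^sub>m k) = (\<Sum>a\<in>spectrum M. w a * a ^ k)"
    using mat_trace_pow_spectrum[OF M] by blast
  note fin = card_finite_spectrum(1)[OF M]
  let ?D = "spectral_discriminant m M" and ?q = "root_poly (spectrum M)"
  have deg: "degree (Polynomial.smult ?D ?q) \<le> m"
    using root_poly_props(1)[OF fin] by (simp add: m)
  show ?thesis
  proof (rule eq_matI, goal_cases)
    case (1 i j)
    then have ij: "i < n" "j < n" by auto
    have "mat_poly n (Polynomial.smult ?D ?q) M $$ (i, j) =
      (\<Sum>k<m. (?D * coeff ?q k) * (M ^\<^sub>m k) $$ (i, j)) + ?D * (M ^\<^sub>m m) $$ (i, j)"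
      unfolding mat_poly_index[OF ij deg] using root_poly_props(2)[OF fin] m
      by (simp add: lessThan_Suc_atMost[symmetric])
    also have "\<dots> = scaled_radical n m M $$ (i, j)"
      using ij hankel_cramer[OF fin w] unfolding scaled_radical_def Let_def m spectral_discriminant_def
      by simp
    finally show ?case by simp
  qed (simp_all add: scaled_radical_def Let_def)
qed

lemma kernel_dim_scaled_radical:
  assumes M: "M \<in> carrier_mat n n" and m: "m = card (spectrum M)"
  shows "kernel.dim n (scaled_radical n m M ^\<^sub>m k) = (\<Sum>l\<in>{1..n}. min k l * num_jordan_blocks l M)"
    and "l \<ge> 1 \<Longrightarrow> 2 * kernel.dim n (scaled_radical n m M ^\<^sub>m l) =
      kernel.dim n (scaled_radical n m M ^\<^sub>m (l - 1)) + kernel.dim n (scaled_radical n m M ^\<^sub>m (l + 1))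
      + num_jordan_blocks l M"
proof -
  obtain bs where bs: "jordan_nf M bs" using jordan_nf_complex_exists[OF M] .
  have *: "kernel.dim n (scaled_radical n m M ^\<^sub>m k) = (\<Sum>(s, a)\<leftarrow>bs. min k s)" for k
    unfolding scaled_radical_eq[OF M m]
    by (rule kernel_dim_mat_poly_pow[OF M bs]) (use spectral_discriminant_neq_0[OF M] m in simp)
  show "kernel.dim n (scaled_radical n m M ^\<^sub>m k) = (\<Sum>l\<in>{1..n}. min k l * num_jordan_blocks l M)"
    unfolding * by (rule Jordan_block_counts(1)[OF M bs])
  show "l \<ge> 1 \<Longrightarrow> 2 * kernel.dim n (scaled_radical n m M ^\<^sub>m l) =
      kernel.dim n (scaled_radical n m M ^\<^sub>m (l - 1)) + kernel.dim n (scaled_radical n m M ^\<^sub>m (l + 1))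
      + num_jordan_blocks l M"
    unfolding * by (rule Jordan_block_counts(2)[OF M bs])
qed

section \<open>Rings of functions with the identity property\<close>

text \<open>Bounded holomorphic functions on a complex space, bounded holomorphic functions on the disc and polynomials on
  number space are treated at once through these common properties.\<close>

locale identity_ring =
  fixes X :: "'a topology" and R :: "('a \<Rightarrow> complex) set"
  assumes const: "(\<lambda>_. c) \<in> R"
    and add: "f \<in> R \<Longrightarrow> g \<in> R \<Longrightarrow> (\<lambda>x. f x + g x) \<in> R"
    and mult: "f \<in> R \<Longrightarrow> g \<in> R \<Longrightarrow> (\<lambda>x. f x * g x) \<in> R"
    and continuous: "f \<in> R \<Longrightarrow> continuous_map X euclidean f"
    and identity: "f \<in> R \<Longrightarrow> openin X U \<Longrightarrow> U \<noteq> {} \<Longrightarrow> (\<And>x. x \<in> U \<Longrightarrow> f x = 0) \<Longrightarrow>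
      x \<in> topspace X \<Longrightarrow> f x = 0"
begin

lemma uminus: "f \<in> R \<Longrightarrow> (\<lambda>x. - f x) \<in> R"
  using mult[OF const[of "-1"]] by simp

lemma sum: "(\<And>i. i \<in> I \<Longrightarrow> f i \<in> R) \<Longrightarrow> (\<lambda>x. \<Sum>i\<in>I. f i x) \<in> R"
  by (induction I rule: infinite_finite_induct) (auto intro: const add)

lemma prod: "(\<And>i. i \<in> I \<Longrightarrow> f i \<in> R) \<Longrightarrow> (\<lambda>x. \<Prod>i\<in>I. f i x) \<in> R"
  by (induction I rule: infinite_finite_induct) (auto intro: const mult)

definition ring_mat_fun :: "nat \<Rightarrow> ('a \<Rightarrow> complex mat) \<Rightarrow> bool" where
  "ring_mat_fun m B \<longleftrightarrow> (\<forall>x. B x \<in> carrier_mat m m) \<and> (\<forall>i<m. \<forall>j<m. (\<lambda>x. B x $$ (i, j)) \<in> R)"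

lemma ring_mat_funD: "ring_mat_fun m B \<Longrightarrow> B x \<in> carrier_mat m m"
  "ring_mat_fun m B \<Longrightarrow> i < m \<Longrightarrow> j < m \<Longrightarrow> (\<lambda>x. B x $$ (i, j)) \<in> R"
  by (auto simp: ring_mat_fun_def)

lemma ring_mat_fun_mat:
  "(\<And>i j. i < m \<Longrightarrow> j < m \<Longrightarrow> (\<lambda>x. b x (i, j)) \<in> R) \<Longrightarrow> ring_mat_fun m (\<lambda>x. mat m m (b x))"
  by (auto simp: ring_mat_fun_def)

lemma det_in:
  assumes "ring_mat_fun m B"
  shows "(\<lambda>x. Determinant.det (B x)) \<in> R"
proof -
  have "(\<lambda>x. \<Sum>p\<in>{p. p permutes {0..<m}}. signof p * (\<Prod>i\<in>{0..<m}. B x $$ (i, p i))) \<in> R"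
  proof (intro sum mult const prod)
    fix p i assume "p \<in> {p. p permutes {0..<m}}" "i \<in> {0..<m}"
    then show "(\<lambda>x. B x $$ (i, p i)) \<in> R"
      using ring_mat_funD(2)[OF assms, of i "p i"] permutes_in_image[of p "{0..<m}" i] by auto
  qed
  then show ?thesis by (simp add: det_def'[OF ring_mat_funD(1)[OF assms]])
qed

lemma adj_mat_in:
  assumes "ring_mat_fun m B" "i < m" "j < m"
  shows "(\<lambda>x. adj_mat (B x) $$ (i, j)) \<in> R"
proof -
  have dim: "dim_row (B x) = m" "dim_col (B x) = m" for x using ring_mat_funD(1)[OF assms(1)] by auto
  have "ring_mat_fun (m - 1) (\<lambda>x. mat_delete (B x) j i)"
    unfolding mat_delete_def dim
  proof (rule ring_mat_fun_mat, goal_cases)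
    case (1 k l)
    then show ?case
      using ring_mat_funD(2)[OF assms(1), of "if k < j then k else Suc k" "if l < i then l else Suc l"] by auto
  qed
  then show ?thesis
    using assms(2,3) by (simp add: adj_mat_def cofactor_def dim mult const det_in)
qed

lemma ring_mat_fun_mult:
  assumes "ring_mat_fun m B" "ring_mat_fun m C"
  shows "ring_mat_fun m (\<lambda>x. B x * C x)"
  unfolding ring_mat_fun_def
proof (intro conjI allI impI)
  show "B x * C x \<in> carrier_mat m m" for x
    using assms ring_mat_funD(1) mult_carrier_mat by blast
  fix i j assume "i < m" "j < m"
  then show "(\<lambda>x. (B x * C x) $$ (i, j)) \<in> R"
    unfolding index_mult_sum[OF ring_mat_funD(1)[OF assms(1)] ring_mat_funD(1)[OF assms(2)] \<open>i < m\<close> \<open>j < m\<close>]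
    by (intro sum mult ring_mat_funD(2)[OF assms(1)] ring_mat_funD(2)[OF assms(2)]) auto
qed

lemma ring_mat_fun_pow:
  assumes "ring_mat_fun m B"
  shows "ring_mat_fun m (\<lambda>x. B x ^\<^sub>m k)"
proof (induction k)
  case 0
  have "dim_row (B x) = m" for x using ring_mat_funD(1)[OF assms] by auto
  then show ?case by (simp add: ring_mat_fun_def const)
next
  case (Suc k)
  then show ?case using ring_mat_fun_mult[OF Suc assms] by simp
qed

lemma trace_in:
  assumes "ring_mat_fun m B"
  shows "(\<lambda>x. mat_trace (B x)) \<in> R"
proof -
  have "dim_row (B x) = m" for x using ring_mat_funD(1)[OF assms] by auto
  then show ?thesis unfolding mat_trace_def by (auto intro!: sum ring_mat_funD(2)[OF assms])
qed

lemma ring_mat_fun_hankel: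
  assumes "ring_mat_fun n A"
  shows "ring_mat_fun m (\<lambda>x. hankel m (\<lambda>k. mat_trace (A x ^\<^sub>m k)))"
  unfolding hankel_def by (rule ring_mat_fun_mat) (simp add: trace_in[OF ring_mat_fun_pow[OF assms]])

lemma spectral_discriminant_in:
  assumes "ring_mat_fun n A"
  shows "(\<lambda>x. spectral_discriminant m (A x)) \<in> R"
  unfolding spectral_discriminant_def by (intro det_in[OF ring_mat_fun_hankel[OF assms]])

lemma ring_mat_fun_scaled_radical:
  assumes "ring_mat_fun n A"
  shows "ring_mat_fun n (\<lambda>x. scaled_radical n m (A x))"
  unfolding scaled_radical_def Let_def
  by (rule ring_mat_fun_mat, simp only: prod.case)
    (intro add sum mult uminus det_in[OF ring_mat_fun_hankel[OF assms]] adj_mat_in[OF ring_mat_fun_hankel[OF assms]]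
      trace_in[OF ring_mat_fun_pow[OF assms]] ring_mat_funD(2)[OF ring_mat_fun_pow[OF assms]]; simp)

text \<open>The zero set of finitely many functions of the ring is handled through its complement, since Jordan stability is the
  generic behaviour.\<close>

definition cozero :: "'a set \<Rightarrow> bool" where
  "cozero T \<longleftrightarrow> (\<exists>F. finite F \<and> F \<subseteq> R \<and> T = {x\<in>topspace X. \<exists>f\<in>F. f x \<noteq> 0}) \<and> T \<noteq> {}"

lemma cozero_open:
  assumes "cozero T"
  shows "openin X T"
proof -
  obtain F where F: "F \<subseteq> R" "T = {x\<in>topspace X. \<exists>f\<in>F. f x \<noteq> 0}"
    using assms by (auto simp: cozero_def)
  have "openin X {x\<in>topspace X. f x \<in> - {0}}" if "f \<in> F" for f
    by (rule openin_continuous_map_preimage[OF continuous]) (use that F(1) in \<open>auto simp: open_openin[symmetric]\<close>)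
  then have "openin X (\<Union>f\<in>F. {x\<in>topspace X. f x \<in> - {0}})" by (intro openin_Union) blast
  also have "(\<Union>f\<in>F. {x\<in>topspace X. f x \<in> - {0}}) = T" using F(2) by auto
  finally show ?thesis .
qed

lemma cozero_dense:
  assumes "cozero T" "openin X U" "U \<noteq> {}"
  shows "T \<inter> U \<noteq> {}"
proof -
  obtain F where F: "F \<subseteq> R" "T = {x\<in>topspace X. \<exists>f\<in>F. f x \<noteq> 0}" "T \<noteq> {}"
    using assms by (auto simp: cozero_def)
  then obtain x f where "x \<in> topspace X" "f \<in> F" "f x \<noteq> 0" by auto
  then obtain y where "y \<in> U" "f y \<noteq> 0" using identity[of f U x] F(1) assms by blast
  then show ?thesis using F \<open>f \<in> F\<close> openin_subset[OF assms(2)] by auto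
qed

lemma cozero_Int:
  assumes "cozero S" "cozero T"
  shows "cozero (S \<inter> T)"
proof -
  obtain F where F: "finite F" "F \<subseteq> R" "S = {x\<in>topspace X. \<exists>f\<in>F. f x \<noteq> 0}"
    using assms(1) by (auto simp: cozero_def)
  obtain G where G: "finite G" "G \<subseteq> R" "T = {x\<in>topspace X. \<exists>f\<in>G. f x \<noteq> 0}"
    using assms(2) by (auto simp: cozero_def)
  let ?H = "(\<lambda>(f, g) x. f x * g x) ` (F \<times> G)"
  have "finite ?H" using F G by auto
  moreover have "?H \<subseteq> R" using F(2) G(2) by (auto intro!: mult)
  moreover have "S \<inter> T = {x\<in>topspace X. \<exists>f\<in>?H. f x \<noteq> 0}" unfolding F(3) G(3) by auto
  moreover have "S \<inter> T \<noteq> {}"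
    using cozero_dense[OF assms(1) cozero_open[OF assms(2)]] assms(2) by (auto simp: cozero_def)
  ultimately show ?thesis unfolding cozero_def by blast
qed

lemma cozero_INT:
  assumes "\<And>k. k \<le> (K::nat) \<Longrightarrow> cozero (T k)"
  shows "cozero (\<Inter>k\<le>K. T k)"
  using assms
proof (induction K)
  case (Suc K)
  then show ?case by (simp add: atMost_Suc cozero_Int)
qed simp

text \<open>A kernel dimension that is attained is not exceeded on a cozero set, because the condition is that a determinant of
  unit row completions does not vanish.\<close>

lemma cozero_kernel_dim:
  assumes B: "ring_mat_fun n B" and x: "x \<in> topspace X" "kernel.dim n (B x) = d"
  shows "cozero {y\<in>topspace X. kernel.dim n (B y) \<le> d}"
proof -
  have "d \<le> n" using kernel_dim_le[OF ring_mat_funD(1)[OF B]] x(2) by blast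
  let ?P = "{(I, g). I \<subseteq> {..<n} \<and> g \<in> {..<n} \<rightarrow>\<^sub>E {..<n} \<and> n - d \<le> card I}"
  let ?F = "(\<lambda>(I, g) y. Determinant.det (unit_row_completion n (B y) I g)) ` ?P"
  have "finite ?P"
    by (rule finite_subset[of _ "Pow {..<n} \<times> ({..<n} \<rightarrow>\<^sub>E {..<n})"]) (auto intro: finite_PiE)
  then have "finite ?F" by simp
  moreover have "?F \<subseteq> R"
  proof clarify
    fix I g assume "g \<in> {..<n} \<rightarrow>\<^sub>E {..<n}"
    show "(\<lambda>y. Determinant.det (unit_row_completion n (B y) I g)) \<in> R"
      unfolding unit_row_completion_def
    proof (rule det_in[OF ring_mat_fun_mat[of n]])
      fix i j assume "i < n" "j < n"
      then show "(\<lambda>y. case (i, j) of (i, j) \<Rightarrow> if i \<in> I then B y $$ (i, j) else if j = g i then 1 else 0) \<in> R"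
        by (cases "i \<in> I") (simp_all add: const ring_mat_funD(2)[OF B])
    qed
  qed
  moreover have "{y\<in>topspace X. kernel.dim n (B y) \<le> d} = {y\<in>topspace X. \<exists>f\<in>?F. f y \<noteq> 0}"
    using kernel_dim_le_iff_completion[OF ring_mat_funD(1)[OF B], of "n - d"] \<open>d \<le> n\<close> by auto
  moreover have "x \<in> {y\<in>topspace X. kernel.dim n (B y) \<le> d}" using x by simp
  ultimately show ?thesis unfolding cozero_def by blast
qed

text \<open>Near every point the generic Jordan type occurs. So a Jordan stable point has this type, and the points of this type
  form a cozero set.\<close>

theorem cozero_Jst:
  assumes A: "ring_mat_fun n A" and ne: "topspace X \<noteq> {}"
  shows "cozero (Jst n X A)"
proof -
  note Ac = ring_mat_funD(1)[OF A]
  let ?c = "\<lambda>x. card (spectrum (A x))"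
  obtain x1 where "x1 \<in> topspace X" using ne by blast
  moreover have "\<forall>x. x \<in> topspace X \<longrightarrow> ?c x < Suc n"
    using card_finite_spectrum(2)[OF Ac] by (simp add: less_Suc_eq_le)
  ultimately have "\<exists>x. x \<in> topspace X \<and> (\<forall>y. y \<in> topspace X \<longrightarrow> ?c y \<le> ?c x)"
    by (rule ex_has_greatest_nat)
  then obtain x0 where x0: "x0 \<in> topspace X" "\<And>y. y \<in> topspace X \<Longrightarrow> ?c y \<le> ?c x0" by blast
  define m where "m = ?c x0"
  define Q where "Q x = scaled_radical n m (A x)" for x
  have Q: "ring_mat_fun n Q" unfolding Q_def by (rule ring_mat_fun_scaled_radical[OF A])
  define D where "D x = spectral_discriminant m (A x)" for x
  define T0 where "T0 = {x\<in>topspace X. D x \<noteq> 0}"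
  have T0: "cozero T0"
    unfolding cozero_def T0_def
  proof (intro conjI exI[of _ "{D}"])
    show "{D} \<subseteq> R" using spectral_discriminant_in[OF A] by (simp add: D_def[abs_def])
    have "D x0 \<noteq> 0" unfolding D_def m_def by (rule spectral_discriminant_neq_0[OF Ac])
    then show "{x\<in>topspace X. D x \<noteq> 0} \<noteq> {}" using x0 by blast
  qed auto
  have T0_iff: "x \<in> T0 \<longleftrightarrow> ?c x = m" if "x \<in> topspace X" for x
    using that x0(2)[OF that] spectral_discriminant_eq_0[OF Ac, of x m] spectral_discriminant_neq_0[OF Ac, of x]
    unfolding T0_def D_def m_def[symmetric] by (auto simp: le_less)
  define d where "d k = (LEAST e. \<exists>x\<in>topspace X. kernel.dim n (Q x ^\<^sub>m k) = e)" for k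
  have d: "\<exists>x\<in>topspace X. kernel.dim n (Q x ^\<^sub>m k) = d k" for k
    unfolding d_def by (rule LeastI_ex) (use ne in blast)
  have d_le: "d k \<le> kernel.dim n (Q x ^\<^sub>m k)" if "x \<in> topspace X" for k x
    unfolding d_def by (rule Least_le) (use that in blast)
  define T where "T k = {x\<in>topspace X. kernel.dim n (Q x ^\<^sub>m k) \<le> d k}" for k
  have T: "cozero (T k)" for k
    using d[of k] unfolding T_def by (auto intro: cozero_kernel_dim[OF ring_mat_fun_pow[OF Q]])
  \<comment> \<open>exponents up to \<open>n + 1\<close>: the second difference for blocks of size \<open>n\<close> uses \<open>n + 1\<close>\<close>
  define W where "W = T0 \<inter> (\<Inter>k\<le>Suc n. T k)"
  have W: "cozero W" unfolding W_def by (intro cozero_Int cozero_INT T0 T)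
  have W_top: "W \<subseteq> topspace X" by (auto simp: W_def T0_def)
  have W_card: "?c x = m" if "x \<in> W" for x
    using that T0_iff W_top by (auto simp: W_def)
  have W_dim: "kernel.dim n (Q x ^\<^sub>m k) = d k" if "x \<in> W" "k \<le> Suc n" for x k
    using that d_le[of x k] W_top by (force simp: W_def T_def)
  have "Jst n X A = W"
  proof (intro equalityI subsetI)
    fix \<xi> assume \<xi>: "\<xi> \<in> W"
    have W_const: "num_jordan_blocks l (A x) = 2 * d l - (d (l - 1) + d (l + 1))"
      if l: "l \<in> {1..n}" and x: "x \<in> W" for l x
    proof -
      have le: "l \<le> Suc n" "l - 1 \<le> Suc n" "l + 1 \<le> Suc n" using l by auto
      have "2 * kernel.dim n (Q x ^\<^sub>m l) =
        kernel.dim n (Q x ^\<^sub>m (l - 1)) + kernel.dim n (Q x ^\<^sub>m (l + 1)) + num_jordan_blocks l (A x)"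
        unfolding Q_def
        by (rule kernel_dim_scaled_radical(2)[OF Ac W_card[OF x, symmetric]]) (use l in simp)
      then have "2 * d l = d (l - 1) + d (l + 1) + num_jordan_blocks l (A x)"
        unfolding W_dim[OF x le(1)] W_dim[OF x le(2)] W_dim[OF x le(3)] .
      then show ?thesis by simp
    qed
    have "\<not> splitting_point X A \<xi>"
    proof
      assume "splitting_point X A \<xi>"
      then obtain \<zeta> where "\<zeta> \<in> W" "?c \<xi> < ?c \<zeta>"
        unfolding splitting_point_def using cozero_open[OF W] \<xi> by blast
      then show False using W_card[OF \<xi>] W_card[of \<zeta>] by simp
    qed
    moreover have "(\<lambda>\<zeta>. num_jordan_blocks l (A \<zeta>)) constant_on W" if "l \<in> {1..n}" for l
      unfolding constant_on_def by (intro exI ballI, rule W_const[OF that])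
    ultimately show "\<xi> \<in> Jst n X A"
      unfolding Jst_def mem_Collect_eq using \<xi> cozero_open[OF W] W_top
      by (intro conjI exI[of _ W]) auto
  next
    fix \<xi> assume "\<xi> \<in> Jst n X A"
    then have \<xi>: "\<xi> \<in> topspace X" and ns: "\<not> splitting_point X A \<xi>" and
      "\<exists>V. openin X V \<and> \<xi> \<in> V \<and> (\<forall>l\<in>{1..n}. (\<lambda>\<zeta>. num_jordan_blocks l (A \<zeta>)) constant_on V)"
      unfolding Jst_def mem_Collect_eq by blast+
    then obtain V where V: "openin X V" "\<xi> \<in> V"
      "\<And>l. l \<in> {1..n} \<Longrightarrow> (\<lambda>\<zeta>. num_jordan_blocks l (A \<zeta>)) constant_on V" by metis
    obtain U where U: "openin X U" "\<xi> \<in> U" "\<And>\<zeta>. \<zeta> \<in> U \<Longrightarrow> ?c \<zeta> \<le> ?c \<xi>"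
      using ns unfolding splitting_point_def by (metis not_less)
    \<comment> \<open>the generic Jordan type is attained arbitrarily close to \<open>\<xi>\<close>\<close>
    obtain \<zeta> where \<zeta>: "\<zeta> \<in> W" "\<zeta> \<in> U" "\<zeta> \<in> V"
      using cozero_dense[OF W openin_Int[OF U(1) V(1)]] U(2) V(2) by blast
    have "m \<le> ?c \<xi>" using U(3)[OF \<zeta>(2)] W_card[OF \<zeta>(1)] by simp
    then have c\<xi>: "?c \<xi> = m" using x0(2)[OF \<xi>] by (simp add: m_def)
    have "num_jordan_blocks l (A \<xi>) = num_jordan_blocks l (A \<zeta>)" if "l \<in> {1..n}" for l
      using V(3)[OF that] \<zeta>(3) V(2) unfolding constant_on_def by metis
    then have "kernel.dim n (Q \<xi> ^\<^sub>m k) = kernel.dim n (Q \<zeta> ^\<^sub>m k)" for k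
      unfolding Q_def kernel_dim_scaled_radical(1)[OF Ac c\<xi>[symmetric]]
        kernel_dim_scaled_radical(1)[OF Ac W_card[OF \<zeta>(1), symmetric]] by simp
    then have dims: "kernel.dim n (Q \<xi> ^\<^sub>m k) = d k" if "k \<le> Suc n" for k
      using W_dim[OF \<zeta>(1) that] by (rule trans)
    have "\<xi> \<in> T k" if "k \<le> Suc n" for k
      unfolding T_def dims[OF that] mem_Collect_eq using \<xi> by (intro conjI order_refl)
    then show "\<xi> \<in> W" using T0_iff[OF \<xi>] c\<xi> by (simp add: W_def)
  qed
  then show ?thesis using W by simp
qed

end

section \<open>Polydiscs\<close>

text \<open>Polydiscs are a neighbourhood basis of \<open>Cn N\<close> which suits the arguments one coordinate at a time.\<close>

definition polydisc :: "nat \<Rightarrow> (nat \<Rightarrow> complex) \<Rightarrow> real \<Rightarrow> (nat \<Rightarrow> complex) set" where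
  "polydisc N z r = {w\<in>Cn N. \<forall>i<N. cmod (w i - z i) < r}"

abbreviation open_Cn :: "nat \<Rightarrow> (nat \<Rightarrow> complex) set \<Rightarrow> bool" where
  "open_Cn N D \<equiv> openin (top_of_set (Cn N)) D"

lemma CnD: "z \<in> Cn N \<Longrightarrow> N \<le> i \<Longrightarrow> z i = 0"
  by (simp add: Cn_def)

lemma polydisc_center: "z \<in> Cn N \<Longrightarrow> r > 0 \<Longrightarrow> z \<in> polydisc N z r"
  by (simp add: polydisc_def)

lemma polydisc_mono: "r \<le> s \<Longrightarrow> polydisc N z r \<subseteq> polydisc N z s"
  by (force simp: polydisc_def)

lemma polydisc_subset_Cn: "polydisc N z r \<subseteq> Cn N"
  by (auto simp: polydisc_def)

lemma open_cylinder: "open {w::nat \<Rightarrow> complex. \<forall>i<N. cmod (w i - z i) < r}"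
proof -
  have "open {w::nat \<Rightarrow> complex. cmod (w i - z i) < r}" for i
    by (intro open_Collect_less continuous_intros)
      (rule continuous_on_subset[OF continuous_on_product_coordinates], simp)
  then have "open (\<Inter>i\<in>{..<N}. {w::nat \<Rightarrow> complex. cmod (w i - z i) < r})"
    by (intro open_INT) auto
  also have "(\<Inter>i\<in>{..<N}. {w::nat \<Rightarrow> complex. cmod (w i - z i) < r}) =
    {w. \<forall>i<N. cmod (w i - z i) < r}" by auto
  finally show ?thesis .
qed

lemma polydisc_openin: "open_Cn N (polydisc N z r)"
proof -
  have eq: "polydisc N z r = Cn N \<inter> {w. \<forall>i<N. cmod (w i - z i) < r}" by (auto simp: polydisc_def)
  show ?thesis unfolding eq by (rule openin_open_Int[OF open_cylinder])
qed

lemma openin_Cn_polydisc: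
  assumes D: "open_Cn N D" and z: "z \<in> D"
  obtains r where "r > 0" "polydisc N z r \<subseteq> D"
proof -
  obtain T where T: "open T" "D = Cn N \<inter> T" using D by (auto simp: openin_open)
  have op: "openin (product_topology (\<lambda>i. euclidean) UNIV) T" using T by (simp add: open_fun_def)
  have zT: "z \<in> T" using z T by blast
  from product_topology_open_contains_basis[OF op zT] obtain X where
    X0: "z \<in> (\<Pi>\<^sub>E i\<in>UNIV. X i)" "\<forall>i. openin euclidean (X i)" "(\<Pi>\<^sub>E i\<in>UNIV. X i) \<subseteq> T"
    by (elim exE conjE)
  then have X: "\<And>i. z i \<in> X i" "\<And>i. open (X i)" "\<And>w. (\<And>i. w i \<in> X i) \<Longrightarrow> w \<in> T"
    by (auto simp: PiE_iff)
  have "\<exists>r>0. ball (z i) r \<subseteq> X i" for i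
    using X(1)[of i] open_contains_ball_eq[OF X(2)[of i]] by simp
  then obtain r where r: "\<And>i. r i > 0" "\<And>i. ball (z i) (r i) \<subseteq> X i" by metis
  define s where "s = Min (insert 1 (r ` {..<N}))"
  have s: "s > 0" "\<And>i. i < N \<Longrightarrow> s \<le> r i" using r by (auto simp: s_def)
  have "polydisc N z s \<subseteq> D"
  proof
    fix w assume w: "w \<in> polydisc N z s"
    have "w i \<in> X i" for i
    proof (cases "i < N")
      case True
      then have "w i \<in> ball (z i) (r i)"
        using w s(2)[OF True] by (force simp: polydisc_def dist_norm norm_minus_commute)
      then show ?thesis using r(2) by blast
    next
      case False
      then have "w i = z i" using w z T by (auto simp: polydisc_def Cn_def)
      then show ?thesis using X(1)[of i] by simp
    qed
    then have "w \<in> T" by (rule X(3))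
    then show "w \<in> D" using w T by (auto simp: polydisc_def)
  qed
  then show thesis using s(1) that by blast
qed

lemma openin_Cn_subset: "open_Cn N D \<Longrightarrow> D \<subseteq> Cn N"
  by (rule openin_imp_subset)

lemma at_within_open_Cn:
  assumes "open_Cn N D" "open_Cn N E" "z \<in> D" "z \<in> E"
  shows "at z within D = at z within E"
proof -
  obtain S T where S: "open S" "D = Cn N \<inter> S" and T: "open T" "E = Cn N \<inter> T"
    using assms by (auto simp: openin_open)
  have "D \<inter> (S \<inter> T) - {z} = E \<inter> (S \<inter> T) - {z}" using S T by auto
  then show ?thesis using assms S T by (intro at_within_nhd[of z "S \<inter> T"]) auto
qed

lemma continuous_within_polydisc:
  fixes u :: "(nat \<Rightarrow> complex) \<Rightarrow> complex"
  assumes D: "open_Cn N D" and z: "z \<in> D"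
  shows "continuous (at z within D) u \<longleftrightarrow>
    (\<forall>e>0. \<exists>d>0. polydisc N z d \<subseteq> D \<and> (\<forall>w\<in>polydisc N z d. cmod (u w - u z) < e))"
proof
  assume c: "continuous (at z within D) u"
  show "\<forall>e>0. \<exists>d>0. polydisc N z d \<subseteq> D \<and> (\<forall>w\<in>polydisc N z d. cmod (u w - u z) < e)"
  proof (intro allI impI)
    fix e :: real assume e: "e > 0"
    then obtain S where S: "open S" "z \<in> S" "\<And>w. w \<in> S \<Longrightarrow> w \<noteq> z \<Longrightarrow> w \<in> D \<Longrightarrow> dist (u w) (u z) < e"
      using c unfolding continuous_within tendsto_iff eventually_at_topological by meson
    have "open_Cn N (D \<inter> S)" using openin_Int_open[OF D S(1)] .
    then obtain d where d: "d > 0" "polydisc N z d \<subseteq> D \<inter> S"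
      using openin_Cn_polydisc[of N "D \<inter> S" z] z S by blast
    have "cmod (u w - u z) < e" if "w \<in> polydisc N z d" for w
      using S(3)[of w] that d e by (cases "w = z") (auto simp: dist_norm)
    then show "\<exists>d>0. polydisc N z d \<subseteq> D \<and> (\<forall>w\<in>polydisc N z d. cmod (u w - u z) < e)" using d by blast
  qed
next
  assume *: "\<forall>e>0. \<exists>d>0. polydisc N z d \<subseteq> D \<and> (\<forall>w\<in>polydisc N z d. cmod (u w - u z) < e)"
  show "continuous (at z within D) u"
    unfolding continuous_within tendsto_iff eventually_at_topological
  proof (intro allI impI)
    fix e :: real assume "e > 0"
    then obtain d where d: "d > 0" "polydisc N z d \<subseteq> D" "\<forall>w\<in>polydisc N z d. cmod (u w - u z) < e" using * by blast
    show "\<exists>S. open S \<and> z \<in> S \<and> (\<forall>w\<in>S. w \<noteq> z \<longrightarrow> w \<in> D \<longrightarrow> dist (u w) (u z) < e)"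
      by (rule exI[of _ "{w. \<forall>i<N. cmod (w i - z i) < d}"], intro conjI open_cylinder)
        (use d openin_Cn_subset[OF D] in \<open>auto simp: polydisc_def dist_norm\<close>)
  qed
qed

lemma continuous_on_polydisc:
  fixes u :: "(nat \<Rightarrow> complex) \<Rightarrow> complex"
  assumes "open_Cn N D"
  shows "continuous_on D u \<longleftrightarrow> (\<forall>z\<in>D.
    \<forall>e>0. \<exists>d>0. polydisc N z d \<subseteq> D \<and> (\<forall>w\<in>polydisc N z d. cmod (u w - u z) < e))"
  unfolding continuous_on_eq_continuous_within using continuous_within_polydisc[OF assms] by auto

section \<open>Holomorphic functions of several variables\<close>

lemma tendsto_mult_bounded_zero:
  fixes f g :: "'a \<Rightarrow> complex"
  assumes "(f \<longlongrightarrow> 0) F" "\<And>x. cmod (g x) \<le> 1"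
  shows "((\<lambda>x. f x * g x) \<longlongrightarrow> 0) F"
proof (rule Lim_null_comparison)
  show "\<forall>\<^sub>F x in F. norm (f x * g x) \<le> cmod (f x)"
    using assms(2) by (intro always_eventually allI) (simp add: norm_mult mult_left_le)
  show "((\<lambda>x. cmod (f x)) \<longlongrightarrow> 0) F" using assms(1) by (simp add: tendsto_norm_zero)
qed

lemma L2_set_sq: "(L2_set f A)\<^sup>2 = (\<Sum>i\<in>A. (f i)\<^sup>2)"
  unfolding L2_set_def by (simp add: sum_nonneg)

text \<open>Differentiability at \<open>z\<close> in the form of Caratheodory: the increment is a combination of the coordinate increments
  whose coefficients are continuous at \<open>z\<close>. In this form sums, products, compositions and implicit functions are
  treated by algebra, without estimates of remainders.\<close>

definition caratheodory ::
  "nat \<Rightarrow> (nat \<Rightarrow> complex) set \<Rightarrow> ((nat \<Rightarrow> complex) \<Rightarrow> complex) \<Rightarrow> (nat \<Rightarrow> complex) \<Rightarrow>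
    (nat \<Rightarrow> (nat \<Rightarrow> complex) \<Rightarrow> complex) \<Rightarrow> bool" where
  "caratheodory N D f z u \<longleftrightarrow> (\<forall>i<N. continuous (at z within D) (u i)) \<and>
     (\<forall>w\<in>D. f w - f z = (\<Sum>i<N. u i w * (w i - z i)))"

lemma caratheodoryD:
  assumes "caratheodory N D f z u"
  shows "\<And>i. i < N \<Longrightarrow> continuous (at z within D) (u i)"
    "\<And>w. w \<in> D \<Longrightarrow> f w - f z = (\<Sum>i<N. u i w * (w i - z i))"
  using assms by (simp_all add: caratheodory_def)

lemma holomorphic_Cn_caratheodory:
  assumes f: "holomorphic_Cn N D f" and z: "z \<in> D"
  obtains u where "caratheodory N D f z u"
proof -
  have D: "open_Cn N D" using f by (simp add: holomorphic_Cn_def)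
  define L where "L w = complex_of_real (L2_set (\<lambda>i. cmod (w i - z i)) {..<N})" for w
  obtain a where a: "((\<lambda>w. (f w - f z - (\<Sum>i<N. a i * (w i - z i))) / L w) \<longlongrightarrow> 0) (at z within D)"
    using f z unfolding holomorphic_Cn_def L_def by blast
  define R where "R w = (f w - f z - (\<Sum>i<N. a i * (w i - z i))) / L w" for w
  \<comment> \<open>the remainder \<open>R w * L w\<close> is distributed over the coordinates by \<open>L w * L w = (\<Sum>i. cnj (w i - z i) * (w i - z i))\<close>\<close>
  define u where "u i w = a i + R w * (cnj (w i - z i) / L w)" for i w
  have le: "cmod (cnj (w i - z i) / L w) \<le> 1" if "i < N" for i w
  proof -
    have "cmod (w i - z i) \<le> L2_set (\<lambda>i. cmod (w i - z i)) {..<N}"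
      using that by (intro member_le_L2_set[where f="\<lambda>i. cmod (w i - z i)"]) auto
    moreover have "L2_set (\<lambda>i. cmod (w i - z i)) {..<N} \<ge> 0" by (rule L2_set_nonneg)
    ultimately show ?thesis
      by (cases "L2_set (\<lambda>i. cmod (w i - z i)) {..<N} = 0")
        (simp_all add: L_def norm_divide divide_le_eq_1 complex_mod_cnj less_le del: complex_cnj_diff)
  qed
  show thesis
  proof (rule that[of u], unfold caratheodory_def, intro conjI allI impI ballI)
    fix i assume i: "i < N"
    have "((\<lambda>w. R w * (cnj (w i - z i) / L w)) \<longlongrightarrow> 0) (at z within D)"
      by (rule tendsto_mult_bounded_zero[OF _ le[OF i]]) (use a in \<open>simp add: R_def[abs_def]\<close>)
    then have "((\<lambda>w. a i + R w * (cnj (w i - z i) / L w)) \<longlongrightarrow> a i + 0) (at z within D)"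
      by (intro tendsto_intros)
    then show "continuous (at z within D) (u i)"
      unfolding continuous_within u_def[abs_def] by simp
  next
    fix w assume w: "w \<in> D"
    show "f w - f z = (\<Sum>i<N. u i w * (w i - z i))"
    proof (cases "L w = 0")
      case True
      then have "w i = z i" if "i < N" for i
        using that unfolding L_def by (simp add: L2_set_eq_0_iff)
      moreover have "w i = z i" if "i \<ge> N" for i
        using CnD[OF subsetD[OF openin_Cn_subset[OF D] w] that] CnD[OF subsetD[OF openin_Cn_subset[OF D] z] that] by simp
      ultimately have "w = z" by (metis ext linorder_not_le)
      then show ?thesis by simp
    next
      case False
      have "(\<Sum>i<N. cnj (w i - z i) * (w i - z i)) = complex_of_real (\<Sum>i<N. (cmod (w i - z i))\<^sup>2)"
        by (simp add: mult.commute[of "cnj _"] complex_norm_square[symmetric] del: complex_cnj_diff)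
      also have "\<dots> = L w * L w"
        unfolding L2_set_sq[symmetric] L_def by (simp add: power2_eq_square)
      finally have LL: "(\<Sum>i<N. cnj (w i - z i) * (w i - z i)) = L w * L w" .
      have "(\<Sum>i<N. u i w * (w i - z i)) = (\<Sum>i<N. a i * (w i - z i)) + R w / L w * (\<Sum>i<N. cnj (w i - z i) * (w i - z i))"
        unfolding u_def sum_distrib_left sum.distrib[symmetric]
        by (intro sum.cong refl) (simp add: distrib_right)
      also have "\<dots> = (\<Sum>i<N. a i * (w i - z i)) + R w * L w" unfolding LL using False by simp
      finally show ?thesis using False by (simp add: R_def)
    qed
  qed
qed

lemma holomorphic_CnI_local:
  assumes D: "open_Cn N D"
    and u: "\<And>z. z \<in> D \<Longrightarrow> \<exists>E u. z \<in> E \<and> open_Cn N E \<and> caratheodory N E f z u"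
  shows "holomorphic_Cn N D f"
  unfolding holomorphic_Cn_def
proof (intro conjI D ballI)
  fix z assume z: "z \<in> D"
  from u[OF z] obtain E u where E: "z \<in> E" "open_Cn N E" and cu': "caratheodory N E f z u"
    by (elim exE conjE)
  note cu = caratheodoryD(1)[OF cu'] and u = caratheodoryD(2)[OF cu']
  define L where "L w = complex_of_real (L2_set (\<lambda>i. cmod (w i - z i)) {..<N})" for w
  have le: "cmod ((w i - z i) / L w) \<le> 1" if "i < N" for i w
  proof -
    have "cmod (w i - z i) \<le> L2_set (\<lambda>i. cmod (w i - z i)) {..<N}"
      using that by (intro member_le_L2_set[where f="\<lambda>i. cmod (w i - z i)"]) auto
    moreover have "L2_set (\<lambda>i. cmod (w i - z i)) {..<N} \<ge> 0" by (rule L2_set_nonneg)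
    ultimately show ?thesis
      by (cases "L2_set (\<lambda>i. cmod (w i - z i)) {..<N} = 0")
        (simp_all add: L_def norm_divide divide_le_eq_1 less_le)
  qed
  have "((\<lambda>w. \<Sum>i<N. (u i w - u i z) * ((w i - z i) / L w)) \<longlongrightarrow> 0) (at z within E)"
  proof (rule tendsto_null_sum)
    fix i assume "i \<in> {..<N}"
    then have i: "i < N" by simp
    have "((\<lambda>w. u i w - u i z) \<longlongrightarrow> 0) (at z within E)"
      using cu[OF i] unfolding continuous_within by (simp add: LIM_zero)
    then show "((\<lambda>w. (u i w - u i z) * ((w i - z i) / L w)) \<longlongrightarrow> 0) (at z within E)"
      by (rule tendsto_mult_bounded_zero[OF _ le[OF i]])
  qed
  moreover have "(f w - f z - (\<Sum>i<N. u i z * (w i - z i))) / L w = (\<Sum>i<N. (u i w - u i z) * ((w i - z i) / L w))"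
    if "w \<in> E" for w
    unfolding u[OF that] sum_subtractf[symmetric] sum_divide_distrib
    by (intro sum.cong refl) (simp add: algebra_simps diff_divide_distrib add_divide_distrib)
  ultimately have "((\<lambda>w. (f w - f z - (\<Sum>i<N. u i z * (w i - z i))) / L w) \<longlongrightarrow> 0) (at z within E)"
    by (subst tendsto_cong[where g="\<lambda>w. \<Sum>i<N. (u i w - u i z) * ((w i - z i) / L w)"])
      (auto simp: eventually_at_filter)
  then show "\<exists>a. ((\<lambda>w. (f w - f z - (\<Sum>i<N. a i * (w i - z i))) /
      complex_of_real (L2_set (\<lambda>i. cmod (w i - z i)) {..<N})) \<longlongrightarrow> 0) (at z within D)"
    unfolding at_within_open_Cn[OF D E(2) z E(1)] L_def by (rule exI[of _ "\<lambda>i. u i z"])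
qed

lemma holomorphic_CnI:
  assumes "open_Cn N D" "\<And>z. z \<in> D \<Longrightarrow> \<exists>u. caratheodory N D f z u"
  shows "holomorphic_Cn N D f"
  by (rule holomorphic_CnI_local[OF assms(1)]) (use assms in blast)

lemma holomorphic_Cn_openin: "holomorphic_Cn N D f \<Longrightarrow> open_Cn N D"
  by (simp add: holomorphic_Cn_def)

lemma holomorphic_Cn_const: "open_Cn N D \<Longrightarrow> holomorphic_Cn N D (\<lambda>_. c)"
  by (rule holomorphic_CnI) (auto simp: caratheodory_def intro!: exI[of _ "\<lambda>_ _. 0"])

lemma holomorphic_Cn_coordinate:
  assumes D: "open_Cn N D" and i: "i < N"
  shows "holomorphic_Cn N D (\<lambda>z. z i)"
proof (rule holomorphic_CnI[OF D])
  fix z assume z: "z \<in> D"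
  show "\<exists>u. caratheodory N D (\<lambda>w. w i) z u"
    unfolding caratheodory_def
    by (rule exI[of _ "\<lambda>j _. if j = i then 1 else 0"])
      (use i in \<open>auto simp: if_distrib[of "\<lambda>x. x * _"] cong: if_cong\<close>)
qed

lemma holomorphic_Cn_add:
  assumes f: "holomorphic_Cn N D f" and g: "holomorphic_Cn N D g"
  shows "holomorphic_Cn N D (\<lambda>z. f z + g z)"
proof (rule holomorphic_CnI[OF holomorphic_Cn_openin[OF f]])
  fix z assume z: "z \<in> D"
  obtain u where u': "caratheodory N D f z u" by (rule holomorphic_Cn_caratheodory[OF f z])
  note u = caratheodoryD[OF u']
  obtain v where v': "caratheodory N D g z v" by (rule holomorphic_Cn_caratheodory[OF g z])
  note v = caratheodoryD[OF v']
  have "f w + g w - (f z + g z) = (\<Sum>i<N. (u i w + v i w) * (w i - z i))" if "w \<in> D" for w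
  proof -
    have "f w + g w - (f z + g z) = (f w - f z) + (g w - g z)" by simp
    also have "\<dots> = (\<Sum>i<N. (u i w + v i w) * (w i - z i))"
      unfolding u(2)[OF that] v(2)[OF that] sum.distrib[symmetric]
      by (intro sum.cong refl) (simp add: algebra_simps)
    finally show ?thesis .
  qed
  then show "\<exists>w. caratheodory N D (\<lambda>z. f z + g z) z w"
    unfolding caratheodory_def using u(1) v(1)
    by (intro exI[of _ "\<lambda>i w. u i w + v i w"]) (auto intro!: continuous_intros)
qed

lemma holomorphic_Cn_continuous:
  assumes f: "holomorphic_Cn N D f"
  shows "continuous_on D f"
  unfolding continuous_on_eq_continuous_within
proof
  fix z assume z: "z \<in> D"
  obtain u where u': "caratheodory N D f z u" by (rule holomorphic_Cn_caratheodory[OF f z])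
  note u = caratheodoryD[OF u']
  have c: "continuous (at z within D) (\<lambda>w. w i)" for i
    by (rule continuous_on_imp_continuous_within[OF continuous_on_product_coordinates subset_UNIV UNIV_I])
  have "continuous (at z within D) (\<lambda>w. f z + (\<Sum>i<N. u i w * (w i - z i)))"
    by (intro continuous_intros u(1) c) simp
  moreover have eq: "f z + (\<Sum>i<N. u i w * (w i - z i)) = f w" if "w \<in> D" for w
    unfolding u(2)[OF that, symmetric] by simp
  ultimately have "((\<lambda>w. f z + (\<Sum>i<N. u i w * (w i - z i))) \<longlongrightarrow> f z) (at z within D)"
    unfolding continuous_within by simp
  then show "continuous (at z within D) f"
    unfolding continuous_within
    by (rule Lim_transform_eventually) (simp add: eventually_at_filter eq)
qed

lemma holomorphic_Cn_mult:
  assumes f: "holomorphic_Cn N D f" and g: "holomorphic_Cn N D g"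
  shows "holomorphic_Cn N D (\<lambda>z. f z * g z)"
proof (rule holomorphic_CnI[OF holomorphic_Cn_openin[OF f]])
  fix z assume z: "z \<in> D"
  obtain u where u': "caratheodory N D f z u" by (rule holomorphic_Cn_caratheodory[OF f z])
  note u = caratheodoryD[OF u']
  obtain v where v': "caratheodory N D g z v" by (rule holomorphic_Cn_caratheodory[OF g z])
  note v = caratheodoryD[OF v']
  have cf: "continuous (at z within D) f"
    using holomorphic_Cn_continuous[OF f] z by (simp add: continuous_on_eq_continuous_within)
  have "f w * g w - f z * g z = (\<Sum>i<N. (f w * v i w + g z * u i w) * (w i - z i))" if "w \<in> D" for w
  proof -
    have "f w * g w - f z * g z = f w * (g w - g z) + g z * (f w - f z)" by (simp add: algebra_simps)
    also have "\<dots> = (\<Sum>i<N. (f w * v i w + g z * u i w) * (w i - z i))"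
      unfolding u(2)[OF that] v(2)[OF that] sum_distrib_left sum.distrib[symmetric]
      by (intro sum.cong refl) (simp add: algebra_simps)
    finally show ?thesis .
  qed
  then show "\<exists>w. caratheodory N D (\<lambda>z. f z * g z) z w"
    unfolding caratheodory_def using u(1) v(1) cf
    by (intro exI[of _ "\<lambda>i w. f w * v i w + g z * u i w"]) (auto intro!: continuous_intros)
qed

lemma holomorphic_Cn_subset:
  assumes f: "holomorphic_Cn N D f" and E: "open_Cn N E" "E \<subseteq> D"
  shows "holomorphic_Cn N E f"
proof (rule holomorphic_CnI_local[OF E(1)])
  fix z assume "z \<in> E"
  then have z: "z \<in> D" using E(2) by blast
  then show "\<exists>E u. z \<in> E \<and> open_Cn N E \<and> caratheodory N E f z u"
    using holomorphic_Cn_caratheodory[OF f z] holomorphic_Cn_openin[OF f] by blast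
qed

lemma continuous_on_coordinates_Cn:
  assumes "\<And>i. i < N \<Longrightarrow> continuous_on S (\<lambda>t. G t i)" "G ` S \<subseteq> Cn N"
  shows "continuous_on S (G :: 'a::topological_space \<Rightarrow> nat \<Rightarrow> complex)"
proof (rule continuous_on_coordinatewise_then_product)
  fix i
  show "continuous_on S (\<lambda>t. G t i)"
  proof (cases "i < N")
    case False
    then have "continuous_on S (\<lambda>t. G t i) \<longleftrightarrow> continuous_on S (\<lambda>t. 0::complex)"
      using assms(2) by (intro continuous_on_cong) (auto simp: Cn_def)
    then show ?thesis by simp
  qed (use assms in auto)
qed

lemma holomorphic_Cn_compose:
  assumes f: "holomorphic_Cn N D f" and E: "open_Cn M E"
    and G: "\<And>i. i < N \<Longrightarrow> holomorphic_Cn M E (\<lambda>z. G z i)" "G ` E \<subseteq> D"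
  shows "holomorphic_Cn M E (\<lambda>z. f (G z))"
proof (rule holomorphic_CnI[OF E])
  fix z assume z: "z \<in> E"
  have Gz: "G z \<in> D" using z G by auto
  obtain u where u': "caratheodory N D f (G z) u" by (rule holomorphic_Cn_caratheodory[OF f Gz])
  note u = caratheodoryD[OF u']
  have "\<exists>v. caratheodory M E (\<lambda>w. G w i) z v" if "i < N" for i
    using holomorphic_Cn_caratheodory[OF G(1)[OF that] z] by metis
  then obtain v where v': "\<And>i. i < N \<Longrightarrow> caratheodory M E (\<lambda>w. G w i) z (v i)" by metis
  note v = caratheodoryD[OF v']
  have "continuous_on E G"
    using holomorphic_Cn_continuous[OF G(1)] G(2) openin_Cn_subset[OF holomorphic_Cn_openin[OF f]]
    by (intro continuous_on_coordinates_Cn[of N]) auto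
  then have cG: "continuous (at z within E) G" using z by (simp add: continuous_on_eq_continuous_within)
  have cu: "continuous (at z within E) (\<lambda>w. u i (G w))" if "i < N" for i
    by (rule continuous_within_compose2[OF cG continuous_within_subset[OF u(1)[OF that] G(2)]])
  have "f (G w) - f (G z) = (\<Sum>j<M. (\<Sum>i<N. u i (G w) * v i j w) * (w j - z j))" if w: "w \<in> E" for w
  proof -
    have "G w \<in> D" using w G(2) by blast
    then have "f (G w) - f (G z) = (\<Sum>i<N. u i (G w) * (G w i - G z i))" by (rule u(2))
    also have "\<dots> = (\<Sum>i<N. u i (G w) * (\<Sum>j<M. v i j w * (w j - z j)))"
      by (intro sum.cong refl) (simp only: v(2)[OF _ w] lessThan_iff)
    also have "\<dots> = (\<Sum>i<N. \<Sum>j<M. u i (G w) * v i j w * (w j - z j))"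
      by (simp add: sum_distrib_left mult.assoc)
    also have "\<dots> = (\<Sum>j<M. \<Sum>i<N. u i (G w) * v i j w * (w j - z j))" by (rule sum.swap)
    finally show ?thesis by (simp add: sum_distrib_right)
  qed
  moreover have "continuous (at z within E) (\<lambda>w. \<Sum>i<N. u i (G w) * v i j w)" if "j < M" for j
    by (intro continuous_intros cu v(1) that) simp_all
  ultimately show "\<exists>u. caratheodory M E (\<lambda>z. f (G z)) z u"
    unfolding caratheodory_def by (intro exI[of _ "\<lambda>j w. \<Sum>i<N. u i (G w) * v i j w"]) auto
qed

lemma holomorphic_Cn_curve:
  assumes f: "holomorphic_Cn N D f" and S: "open S"
    and G: "\<And>i. i < N \<Longrightarrow> (\<lambda>t. G t i) holomorphic_on S" "G ` S \<subseteq> D"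
  shows "(\<lambda>t. f (G t)) holomorphic_on S"
  unfolding holomorphic_on_def
proof
  fix t0 assume t0: "t0 \<in> S"
  have Gz: "G t0 \<in> D" using t0 G by auto
  obtain u where u': "caratheodory N D f (G t0) u" by (rule holomorphic_Cn_caratheodory[OF f Gz])
  note u = caratheodoryD[OF u']
  have "\<exists>q. (\<forall>t. G t i - G t0 i = q t * (t - t0)) \<and> continuous (at t0 within S) q" if i: "i < N" for i
  proof -
    obtain l where "((\<lambda>t. G t i) has_field_derivative l) (at t0 within S)"
      using G(1)[OF i] t0 unfolding holomorphic_on_def field_differentiable_def by blast
    then show ?thesis unfolding DERIV_caratheodory_within by blast
  qed
  then obtain q where q: "\<And>i t. i < N \<Longrightarrow> G t i - G t0 i = q i t * (t - t0)"
    "\<And>i. i < N \<Longrightarrow> continuous (at t0 within S) (q i)" by metis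
  have "continuous_on S G"
    using holomorphic_on_imp_continuous_on[OF G(1)] G(2) openin_Cn_subset[OF holomorphic_Cn_openin[OF f]]
    by (intro continuous_on_coordinates_Cn[of N]) auto
  then have cG: "continuous (at t0 within S) G" using t0 by (simp add: continuous_on_eq_continuous_within)
  have cu: "continuous (at t0 within S) (\<lambda>w. u i (G w))" if "i < N" for i
    by (rule continuous_within_compose2[OF cG continuous_within_subset[OF u(1)[OF that] G(2)]])
  define g where "g t = (\<Sum>i<N. u i (G t) * q i t)" for t
  have cg: "continuous (at t0 within S) g"
    unfolding g_def by (intro continuous_intros cu q(2)) simp_all
  have eq: "f (G t0) + g t * (t - t0) = f (G t)" if t: "t \<in> S" for t
  proof -
    have "f (G t) - f (G t0) = (\<Sum>i<N. u i (G t) * (q i t * (t - t0)))"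
      using u(2)[of "G t"] t G(2) q(1) by auto
    also have "\<dots> = g t * (t - t0)" by (simp add: g_def sum_distrib_right mult.assoc)
    finally show ?thesis by (simp add: algebra_simps)
  qed
  have "((\<lambda>t. f (G t0) + g t * (t - t0)) has_field_derivative g t0) (at t0 within S)"
    unfolding DERIV_caratheodory_within by (rule exI[of _ g]) (use cg in simp)
  then have "((\<lambda>t. f (G t)) has_field_derivative g t0) (at t0 within S)"
    by (rule has_field_derivative_transform_within[where d=1]) (simp_all add: t0 eq)
  then show "(\<lambda>t. f (G t)) field_differentiable at t0 within S"
    by (auto simp: field_differentiable_def)
qed

section \<open>Separately holomorphic functions and partial derivatives\<close>

text \<open>The disc in the direction of the coordinate \<open>i\<close> is compact, so finitely many of the neighbourhoods given by
  continuity suffice.\<close>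

lemma uniform_on_disc:
  assumes D: "open_Cn N D" and f: "continuous_on D f" and z: "z \<in> Cn N" and i: "i < N"
    and disc: "\<And>t. t \<in> cball (z i) r \<Longrightarrow> z(i := t) \<in> D" and e: "e > 0"
  obtains d where "d > 0" "\<And>w t. w \<in> polydisc N z d \<Longrightarrow> t \<in> cball (z i) r \<Longrightarrow>
    w(i := t) \<in> D \<and> cmod (f (w(i := t)) - f (z(i := t))) < e"
proof -
  have "\<exists>d>0. polydisc N (z(i := t)) d \<subseteq> D \<and>
      (\<forall>w\<in>polydisc N (z(i := t)) d. cmod (f w - f (z(i := t))) < e / 2)" if "t \<in> cball (z i) r" for t
    using f[unfolded continuous_on_polydisc[OF D]] disc[OF that] e half_gt_zero by blast
  then obtain d where d: "\<And>t. t \<in> cball (z i) r \<Longrightarrow> d t > 0"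
    "\<And>t. t \<in> cball (z i) r \<Longrightarrow> polydisc N (z(i := t)) (d t) \<subseteq> D"
    "\<And>t w. t \<in> cball (z i) r \<Longrightarrow> w \<in> polydisc N (z(i := t)) (d t) \<Longrightarrow> cmod (f w - f (z(i := t))) < e / 2"
    by metis
  have "cball (z i) r \<subseteq> (\<Union>t\<in>cball (z i) r. ball t (d t))" using d(1) by (auto simp: dist_commute)
  then obtain T where T: "T \<subseteq> cball (z i) r" "finite T" "cball (z i) r \<subseteq> (\<Union>t\<in>T. ball t (d t))"
    using compactE_image[OF compact_cball, of "cball (z i) r" "\<lambda>t. ball t (d t)" "z i" r] by auto
  define m where "m = Min (insert 1 (d ` T))"
  have m: "m > 0" "\<And>t. t \<in> T \<Longrightarrow> m \<le> d t" using T d(1) by (auto simp: m_def)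
  show thesis
  proof (rule that[OF m(1)])
    fix w t assume w: "w \<in> polydisc N z m" and t: "t \<in> cball (z i) r"
    obtain s where s: "s \<in> T" "t \<in> ball s (d s)" using T(3) t by blast
    have sr: "s \<in> cball (z i) r" using s T by blast
    have ts: "cmod (t - s) < d s" using s(2) by (simp add: dist_norm norm_minus_commute)
    have w1: "w(i := t) \<in> polydisc N (z(i := s)) (d s)"
      using w m(2)[OF s(1)] ts i by (auto simp: polydisc_def Cn_def intro: less_le_trans)
    have z1: "z(i := t) \<in> polydisc N (z(i := s)) (d s)"
      using z d(1)[OF sr] ts i by (auto simp: polydisc_def Cn_def)
    have "cmod (f (w(i := t)) - f (z(i := t))) \<le>
      cmod (f (w(i := t)) - f (z(i := s))) + cmod (f (z(i := t)) - f (z(i := s)))"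
      using norm_triangle_ineq4[of "f (w(i := t)) - f (z(i := s))" "f (z(i := t)) - f (z(i := s))"] by simp
    also have "\<dots> < e" using d(3)[OF sr w1] d(3)[OF sr z1] by simp
    finally show "w(i := t) \<in> D \<and> cmod (f (w(i := t)) - f (z(i := t))) < e"
      using d(2)[OF sr] w1 by blast
  qed
qed

lemma deriv_bound_half_disc:
  assumes f: "f holomorphic_on ball c r" and B: "\<And>s. s \<in> ball c r \<Longrightarrow> cmod (f s) \<le> B"
    and r: "r > 0" and s: "s \<in> ball c (r / 2)"
  shows "cmod (deriv f s) \<le> 4 * B / r"
proof -
  have sub: "cball s (r / 4) \<subseteq> ball c r"
  proof
    fix t assume "t \<in> cball s (r / 4)"
    then have "dist c t < r / 2 + r / 4" using s dist_triangle[of c t s] by (auto simp: dist_commute)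
    then show "t \<in> ball c r" using r by simp
  qed
  have "cmod ((deriv ^^ 1) f s) \<le> fact 1 * B / (r / 4) ^ 1"
  proof (rule Cauchy_inequality)
    show "f holomorphic_on ball s (r / 4)" using f sub by (meson ball_subset_cball holomorphic_on_subset order_trans)
    show "continuous_on (cball s (r / 4)) f"
      using holomorphic_on_imp_continuous_on[OF f] sub continuous_on_subset by blast
    show "cmod (f x) \<le> B" if "cmod (s - x) = r / 4" for x
      using B[of x] sub that by (auto simp: dist_norm)
  qed (use r in auto)
  then show ?thesis by (simp add: field_simps)
qed

lemma difference_bound_half_disc:
  assumes f: "f holomorphic_on ball c r" and B: "\<And>s. s \<in> ball c r \<Longrightarrow> cmod (f s) \<le> B"
    and r: "r > 0" and s: "s \<in> ball c (r / 2)"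
  shows "cmod (f s - f c) \<le> 4 * B / r * cmod (s - c)"
proof (rule field_differentiable_bound[of "ball c (r / 2)" f "deriv f"])
  fix x assume x: "x \<in> ball c (r / 2)"
  then have "x \<in> ball c r" using r by auto
  then show "(f has_field_derivative deriv f x) (at x within ball c (r / 2))"
    using f by (meson DERIV_subset holomorphic_derivI open_ball has_field_derivative_at_within)
  show "cmod (deriv f x) \<le> 4 * B / r" by (rule deriv_bound_half_disc[OF f B r x])
qed (use r s in auto)

text \<open>Cauchy's estimates bound the second derivative of \<open>g\<close> on the disc of radius \<open>r / 4\<close> by \<open>32 * B / r^2\<close>. The
  rate depends on the bound \<open>B\<close> alone, which makes the difference quotients converge uniformly in parameters.\<close>

lemma difference_quotient_bound:
  assumes g: "g holomorphic_on ball c r" and B: "\<And>s. s \<in> ball c r \<Longrightarrow> cmod (g s) \<le> B"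
    and r: "r > 0" and t: "0 < t" "t < r / 4"
  shows "cmod ((g (c + of_real t) - g c) / of_real t - deriv g c) \<le> 32 * B / r\<^sup>2 * t"
proof -
  have g': "deriv g holomorphic_on ball c (r / 2)"
    by (rule holomorphic_on_subset[OF holomorphic_deriv[OF g open_ball]]) (use r in auto)
  have b: "cmod (deriv g s - deriv g c) \<le> 32 * B / r\<^sup>2 * t" if s: "s \<in> cball c t" for s
  proof -
    have "cmod (deriv g s - deriv g c) \<le> 4 * (4 * B / r) / (r / 2) * cmod (s - c)"
      by (rule difference_bound_half_disc[OF g' deriv_bound_half_disc[OF g B r]]) (use r s t in auto)
    also have "\<dots> \<le> 4 * (4 * B / r) / (r / 2) * t"
      using s r order_trans[OF norm_ge_zero B[of c]]
      by (intro mult_left_mono) (auto simp: dist_norm norm_minus_commute)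
    finally show ?thesis by (simp add: power2_eq_square)
  qed
  have "cmod ((g (c + of_real t) - (c + of_real t) * deriv g c) - (g c - c * deriv g c)) \<le> 32 * B / r\<^sup>2 * t * cmod (c + of_real t - c)"
  proof (rule field_differentiable_bound[of "cball c t" "\<lambda>s. g s - s * deriv g c" "\<lambda>s. deriv g s - deriv g c"])
    fix s assume s: "s \<in> cball c t"
    then have "s \<in> ball c r" using t r by auto
    then have "(g has_field_derivative deriv g s) (at s)" by (rule holomorphic_derivI[OF g open_ball])
    then have "((\<lambda>s. g s - s * deriv g c) has_field_derivative deriv g s - 1 * deriv g c) (at s)"
      by (intro DERIV_diff DERIV_cmult_right DERIV_ident)
    then show "((\<lambda>s. g s - s * deriv g c) has_field_derivative deriv g s - deriv g c) (at s within cball c t)"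
      by (simp add: has_field_derivative_at_within)
  qed (use b t in \<open>auto simp: dist_norm\<close>)
  then have "cmod (g (c + of_real t) - g c - of_real t * deriv g c) \<le> 32 * B / r\<^sup>2 * t * t"
    using t by (simp add: algebra_simps)
  moreover have "(g (c + of_real t) - g c) / of_real t - deriv g c = (g (c + of_real t) - g c - of_real t * deriv g c) / of_real t"
    using t by (simp add: field_simps)
  ultimately show ?thesis using t by (simp add: norm_divide divide_le_eq)
qed

definition separately_holomorphic where
  "separately_holomorphic N D f \<longleftrightarrow> open_Cn N D \<and> continuous_on D f \<and>
     (\<forall>z\<in>D. \<forall>i<N. (\<lambda>t. f (z(i := t))) holomorphic_on {t. z(i := t) \<in> D})"

definition partial_deriv :: "nat \<Rightarrow> ((nat \<Rightarrow> complex) \<Rightarrow> complex) \<Rightarrow> (nat \<Rightarrow> complex) \<Rightarrow> complex" where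
  "partial_deriv i f z = deriv (\<lambda>t. f (z(i := t))) (z i)"

lemma open_slice:
  assumes D: "open_Cn N D" and z: "z \<in> Cn N" and i: "i < N"
  shows "open {t. z(i := t) \<in> D}"
  unfolding open_contains_ball
proof clarify
  fix t assume "z(i := t) \<in> D"
  then obtain r where r: "r > 0" "polydisc N (z(i := t)) r \<subseteq> D" using openin_Cn_polydisc[OF D] by blast
  have "z(i := s) \<in> polydisc N (z(i := t)) r" if "s \<in> ball t r" for s
    using that z i r(1) by (auto simp: polydisc_def Cn_def dist_norm norm_minus_commute)
  then show "\<exists>e>0. ball t e \<subseteq> {t. z(i := t) \<in> D}" using r by blast
qed

lemma disc_in_polydisc:
  assumes "z \<in> Cn N" "i < N" "s < r" "0 < r" "t \<in> cball (z i) s"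
  shows "z(i := t) \<in> polydisc N z r"
  using assms by (auto simp: polydisc_def Cn_def dist_norm norm_minus_commute)

lemma holomorphic_imp_separately:
  assumes f: "holomorphic_Cn N D f"
  shows "separately_holomorphic N D f"
  unfolding separately_holomorphic_def
proof (intro conjI ballI allI impI)
  show D: "open_Cn N D" by (rule holomorphic_Cn_openin[OF f])
  show "continuous_on D f" by (rule holomorphic_Cn_continuous[OF f])
  fix z i assume z: "z \<in> D" and i: "i < N"
  show "(\<lambda>t. f (z(i := t))) holomorphic_on {t. z(i := t) \<in> D}"
  proof (rule holomorphic_Cn_curve[OF f])
    show "open {t. z(i := t) \<in> D}" by (rule open_slice[OF D _ i]) (use z openin_Cn_subset[OF D] in blast)
    fix j show "(\<lambda>t. (z(i := t)) j) holomorphic_on {t. z(i := t) \<in> D}"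
      by (cases "j = i") (auto intro: holomorphic_intros)
  qed auto
qed

text \<open>A slice of \<open>f\<close> through \<open>w\<close> and the parallel slice through a nearby \<open>z\<close> differ by a small holomorphic function of one
  variable, whose derivative is small by Cauchy's estimate. This gives the continuity of derivatives and of difference
  quotients with respect to the base point.\<close>

lemma separately_difference:
  assumes f: "separately_holomorphic N D f" and z: "z \<in> D" and i: "i < N" and e: "e > 0"
  obtains r d where "r > 0" "d > 0" "d \<le> r" "polydisc N z (4 * r) \<subseteq> D"
    "\<And>w. w \<in> polydisc N z d \<Longrightarrow> (\<lambda>t. f (w(i := t)) - f (z(i := t))) holomorphic_on ball (z i) (2 * r)"
    "\<And>w t. w \<in> polydisc N z d \<Longrightarrow> t \<in> ball (z i) (2 * r) \<Longrightarrow> cmod (f (w(i := t)) - f (z(i := t))) \<le> e * r"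
proof -
  have D: "open_Cn N D" and c: "continuous_on D f"
    and h: "\<And>z i. z \<in> D \<Longrightarrow> i < N \<Longrightarrow> (\<lambda>t. f (z(i := t))) holomorphic_on {t. z(i := t) \<in> D}"
    using f by (auto simp: separately_holomorphic_def)
  have zC: "z \<in> Cn N" using z openin_Cn_subset[OF D] by blast
  obtain s where s: "s > 0" "polydisc N z s \<subseteq> D" using openin_Cn_polydisc[OF D z] by blast
  define r where "r = s / 4"
  have r: "r > 0" "s = 4 * r" using s by (auto simp: r_def)
  have disc: "z(i := t) \<in> D" if "t \<in> cball (z i) (2 * r)" for t
    using disc_in_polydisc[OF zC i _ s(1) that] r s by auto
  have er: "e * r > 0" using e r by simp
  obtain d where d: "d > 0" "\<And>w t. w \<in> polydisc N z d \<Longrightarrow> t \<in> cball (z i) (2 * r) \<Longrightarrow>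
    w(i := t) \<in> D \<and> cmod (f (w(i := t)) - f (z(i := t))) < e * r"
    using uniform_on_disc[where r="2 * r" and e="e * r", OF D c zC i disc er] by blast
  show thesis
  proof (rule that[of r "min d r"])
    fix w assume w: "w \<in> polydisc N z (min d r)"
    then have wd: "w \<in> polydisc N z d" and wr: "w \<in> polydisc N z s"
      using subsetD[OF polydisc_mono w, of d] subsetD[OF polydisc_mono w, of s] r by linarith+
    have "(\<lambda>t. f (w(i := t))) holomorphic_on ball (z i) (2 * r)"
      by (rule holomorphic_on_subset[OF h[of w i]]) (use wr s d(2)[OF wd] i in auto)
    moreover have "(\<lambda>t. f (z(i := t))) holomorphic_on ball (z i) (2 * r)"
      by (rule holomorphic_on_subset[OF h[of z i]]) (use disc i z in auto)
    ultimately show "(\<lambda>t. f (w(i := t)) - f (z(i := t))) holomorphic_on ball (z i) (2 * r)"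
      by (rule holomorphic_on_diff)
    fix t assume "t \<in> ball (z i) (2 * r)"
    then show "cmod (f (w(i := t)) - f (z(i := t))) \<le> e * r" using d(2)[OF wd, of t] by auto
  qed (use r d s in auto)
qed

text \<open>Osgood's lemma. The increment from \<open>z\<close> to \<open>w\<close> is split into steps which change one coordinate each; the
  difference quotient of a step is the Caratheodory coefficient.\<close>

theorem separately_imp_holomorphic:
  assumes f: "separately_holomorphic N D f"
  shows "holomorphic_Cn N D f"
proof (rule holomorphic_CnI_local)
  show D: "open_Cn N D" using f by (simp add: separately_holomorphic_def)
  have h: "\<And>z i. z \<in> D \<Longrightarrow> i < N \<Longrightarrow> (\<lambda>t. f (z(i := t))) holomorphic_on {t. z(i := t) \<in> D}"
    using f by (auto simp: separately_holomorphic_def)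
  fix z assume z: "z \<in> D"
  have zC: "z \<in> Cn N" using z openin_Cn_subset[OF D] by blast
  obtain r0 where r0: "r0 > 0" "polydisc N z r0 \<subseteq> D" using openin_Cn_polydisc[OF D z] by blast
  let ?E = "polydisc N z r0"
  define h' where "h' k w = (\<lambda>j. if j < k then w j else z j)" for k and w :: "nat \<Rightarrow> complex"
  define u where "u k w = (if w k = z k then partial_deriv k f z
      else (f (h' (Suc k) w) - f (h' k w)) / (w k - z k))" for k w
  have upd: "h' (Suc k) w = (h' k w)(k := w k)" "h' k w = (h' k w)(k := z k)" for k w
    by (auto simp: h'_def less_Suc_eq)
  have h'_in: "h' k w \<in> polydisc N z s" if "w \<in> polydisc N z s" "s > 0" for k w s
    using that zC by (auto simp: polydisc_def h'_def Cn_def)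
  have id: "f w - f z = (\<Sum>k<N. u k w * (w k - z k))" if w: "w \<in> ?E" for w
  proof -
    have "h' N w = w" using w zC by (auto simp: h'_def polydisc_def Cn_def not_less)
    moreover have "h' 0 w = z" by (simp add: h'_def)
    ultimately have "f w - f z = (\<Sum>k<N. f (h' (Suc k) w) - f (h' k w))"
      using sum_lessThan_telescope[of "\<lambda>k. f (h' k w)" N] by simp
    also have "\<dots> = (\<Sum>k<N. u k w * (w k - z k))"
    proof (intro sum.cong refl)
      fix k show "f (h' (Suc k) w) - f (h' k w) = u k w * (w k - z k)"
      proof (cases "w k = z k")
        case True
        then have "h' (Suc k) w = h' k w" by (auto simp: h'_def less_Suc_eq)
        then show ?thesis using True by simp
      qed (simp add: u_def)
    qed
    finally show ?thesis .
  qed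
  have cont: "continuous (at z within ?E) (u k)" if k: "k < N" for k
    unfolding continuous_within_polydisc[OF polydisc_openin polydisc_center[OF zC r0(1)]]
  proof (intro allI impI)
    fix e :: real assume e: "e > 0"
    then have "e / 8 > 0" by simp
    then obtain r d where rd: "r > 0" "d > 0" "d \<le> r" "polydisc N z (4 * r) \<subseteq> D"
      "\<And>w. w \<in> polydisc N z d \<Longrightarrow> (\<lambda>t. f (w(k := t)) - f (z(k := t))) holomorphic_on ball (z k) (2 * r)"
      "\<And>w t. w \<in> polydisc N z d \<Longrightarrow> t \<in> ball (z k) (2 * r) \<Longrightarrow> cmod (f (w(k := t)) - f (z(k := t))) \<le> e / 8 * r"
      using separately_difference[OF f z k] by blast
    let ?g = "\<lambda>t. f (z(k := t))"
    have "z k \<in> {t. z(k := t) \<in> D}" using z by simp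
    then have "(?g has_field_derivative partial_deriv k f z) (at (z k))"
      unfolding partial_deriv_def by (rule holomorphic_derivI[OF h[OF z k] open_slice[OF D zC k]])
    then have "((\<lambda>t. (?g t - ?g (z k)) / (t - z k)) \<longlongrightarrow> partial_deriv k f z) (at (z k))"
      by (simp add: has_field_derivative_iff)
    then obtain d' where d': "d' > 0" "\<And>t. t \<noteq> z k \<Longrightarrow> dist t (z k) < d' \<Longrightarrow>
      cmod ((?g t - ?g (z k)) / (t - z k) - partial_deriv k f z) < e / 2"
      unfolding tendsto_iff eventually_at dist_norm[of _ "partial_deriv k f z"] using e half_gt_zero by (metis UNIV_I)
    define m where "m = Min {r0, d, d'}"
    have m: "m > 0" "m \<le> r0" "m \<le> d" "m \<le> d'" using r0 rd d' by (auto simp: m_def)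
    have "cmod (u k w - u k z) < e" if w: "w \<in> polydisc N z m" for w
    proof (cases "w k = z k")
      case True
      then show ?thesis using e by (simp add: u_def)
    next
      case False
      define y where "y = h' k w"
      have y: "y \<in> polydisc N z d"
        using h'_in[OF w m(1)] polydisc_mono[OF m(3)] by (auto simp: y_def)
      have wk: "cmod (w k - z k) < m" using w k by (auto simp: polydisc_def)
      define G where "G t = f (y(k := t)) - ?g t" for t
      have "cmod (G (w k) - G (z k)) \<le> 4 * (e / 8 * r) / (2 * r) * cmod (w k - z k)"
        unfolding G_def
        by (rule difference_bound_half_disc[OF rd(5)[OF y] rd(6)[OF y]])
          (use rd(1,3) wk m(3) in \<open>auto simp: dist_norm norm_minus_commute\<close>)
      then have "cmod ((G (w k) - G (z k)) / (w k - z k)) \<le> e / 4"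
        using False rd(1) by (simp add: norm_divide field_simps)
      moreover have "cmod ((?g (w k) - ?g (z k)) / (w k - z k) - partial_deriv k f z) < e / 2"
        using d'(2)[OF False] wk m(4) by (simp add: dist_norm)
      moreover have "u k w = (G (w k) - G (z k)) / (w k - z k) + (?g (w k) - ?g (z k)) / (w k - z k)"
        using False upd[of k w] unfolding u_def G_def y_def
        by (simp add: add_divide_distrib[symmetric])
      moreover have "u k z = partial_deriv k f z" by (simp add: u_def)
      ultimately have "cmod (u k w - u k z) \<le> cmod ((G (w k) - G (z k)) / (w k - z k)) +
         cmod ((?g (w k) - ?g (z k)) / (w k - z k) - partial_deriv k f z)"
        by (metis add_diff_eq norm_triangle_ineq)
      then show ?thesis
        using \<open>cmod ((G (w k) - G (z k)) / (w k - z k)) \<le> e / 4\<close> e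
          \<open>cmod ((?g (w k) - ?g (z k)) / (w k - z k) - partial_deriv k f z) < e / 2\<close> by simp
    qed
    then show "\<exists>d>0. polydisc N z d \<subseteq> ?E \<and> (\<forall>w\<in>polydisc N z d. cmod (u k w - u k z) < e)"
      using m polydisc_mono[OF m(2)] by blast
  qed
  show "\<exists>E u. z \<in> E \<and> open_Cn N E \<and> caratheodory N E f z u"
    using polydisc_center[OF zC r0(1)] polydisc_openin cont id
    by (intro exI[of _ ?E] exI[of _ u]) (simp add: caratheodory_def)
qed

text \<open>In the other variables the partial derivative is a uniform limit of holomorphic difference quotients.\<close>

lemma separately_partial_deriv:
  assumes f: "separately_holomorphic N D f" and i: "i < N"
  shows "separately_holomorphic N D (partial_deriv i f)"
  unfolding separately_holomorphic_def
proof (intro conjI ballI allI impI)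
  show D: "open_Cn N D" using f by (simp add: separately_holomorphic_def)
  have h: "\<And>z i. z \<in> D \<Longrightarrow> i < N \<Longrightarrow> (\<lambda>t. f (z(i := t))) holomorphic_on {t. z(i := t) \<in> D}"
    using f by (auto simp: separately_holomorphic_def)
  have Cn: "z \<in> Cn N" if "z \<in> D" for z using that openin_Cn_subset[OF D] by blast
  show "continuous_on D (partial_deriv i f)"
    unfolding continuous_on_polydisc[OF D]
  proof (intro ballI allI impI)
    fix z e assume z: "z \<in> D" and e: "e > (0::real)"
    then have "e / 8 > 0" by simp
    then obtain r d where rd: "r > 0" "d > 0" "d \<le> r" "polydisc N z (4 * r) \<subseteq> D"
      "\<And>w. w \<in> polydisc N z d \<Longrightarrow> (\<lambda>t. f (w(i := t)) - f (z(i := t))) holomorphic_on ball (z i) (2 * r)"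
      "\<And>w t. w \<in> polydisc N z d \<Longrightarrow> t \<in> ball (z i) (2 * r) \<Longrightarrow> cmod (f (w(i := t)) - f (z(i := t))) \<le> e / 8 * r"
      using separately_difference[OF f z i] by blast
    let ?g = "\<lambda>t. f (z(i := t))" and ?S = "{t. z(i := t) \<in> D}"
    have oS: "open ?S" by (rule open_slice[OF D Cn[OF z] i])
    have zS: "z i \<in> ?S" using z by simp
    have "deriv ?g holomorphic_on ?S" by (rule holomorphic_deriv[OF h[OF z i] oS])
    then have "continuous_on ?S (deriv ?g)" by (rule holomorphic_on_imp_continuous_on)
    then have "isCont (deriv ?g) (z i)" using oS zS by (simp add: continuous_on_eq_continuous_at)
    then obtain d' where d': "d' > 0" "\<And>t. dist t (z i) < d' \<Longrightarrow> dist (deriv ?g t) (deriv ?g (z i)) < e / 2"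
      unfolding continuous_at_eps_delta using e half_gt_zero by metis
    define m where "m = Min {d, d'}"
    have m: "m > 0" "m \<le> d" "m \<le> d'" using rd d' by (auto simp: m_def)
    have "cmod (partial_deriv i f w - partial_deriv i f z) < e" if w: "w \<in> polydisc N z m" for w
    proof -
      have wd: "w \<in> polydisc N z d" using w polydisc_mono[OF m(2)] by blast
      have wi: "cmod (w i - z i) < m" using w i by (auto simp: polydisc_def)
      have wD: "w \<in> D"
        using wd polydisc_mono[of d "4 * r" N z] rd by auto
      have "cmod (deriv (\<lambda>t. f (w(i := t)) - ?g t) (w i)) \<le> 4 * (e / 8 * r) / (2 * r)"
        by (rule deriv_bound_half_disc[OF rd(5)[OF wd] rd(6)[OF wd]])
          (use rd(1,3) wi m(2) in \<open>auto simp: dist_norm norm_minus_commute\<close>)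
      moreover have "deriv (\<lambda>t. f (w(i := t)) - ?g t) (w i) = partial_deriv i f w - deriv ?g (w i)"
      proof -
        have "w i \<in> ?S"
          using disc_in_polydisc[OF Cn[OF z] i, of r "4 * r" "w i"] rd wi m(2)
          by (auto simp: dist_norm norm_minus_commute)
        moreover have "w i \<in> {t. w(i := t) \<in> D}" using wD by simp
        ultimately show ?thesis
          unfolding partial_deriv_def
          by (intro deriv_diff holomorphic_on_imp_differentiable_at[OF h[OF z i] oS]
              holomorphic_on_imp_differentiable_at[OF h[OF wD i] open_slice[OF D Cn[OF wD] i]])
      qed
      moreover have "dist (deriv ?g (w i)) (deriv ?g (z i)) < e / 2"
        by (rule d'(2)) (use wi m(3) in \<open>simp add: dist_norm\<close>)
      ultimately have "cmod (partial_deriv i f w - deriv ?g (w i)) \<le> e / 4"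
        "cmod (deriv ?g (w i) - partial_deriv i f z) < e / 2"
        using rd(1) by (simp_all add: partial_deriv_def dist_norm)
      then show ?thesis
        using norm_triangle_ineq[of "partial_deriv i f w - deriv ?g (w i)" "deriv ?g (w i) - partial_deriv i f z"] e
        by simp
    qed
    moreover have "polydisc N z m \<subseteq> D"
      using polydisc_mono[of m "4 * r" N z] rd m by auto
    ultimately show "\<exists>d>0. polydisc N z d \<subseteq> D \<and> (\<forall>w\<in>polydisc N z d. cmod (partial_deriv i f w - partial_deriv i f z) < e)"
      using m(1) by blast
  qed
  fix z j assume z: "z \<in> D" and j: "j < N"
  let ?S = "{t. z(j := t) \<in> D}"
  have oS: "open ?S" by (rule open_slice[OF D Cn[OF z] j])
  show "(\<lambda>t. partial_deriv i f (z(j := t))) holomorphic_on ?S"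
  proof (cases "j = i")
    case True
    have "(\<lambda>t. partial_deriv i f (z(j := t))) = deriv (\<lambda>s. f (z(i := s)))"
      using True by (simp add: partial_deriv_def)
    then show ?thesis using holomorphic_deriv[OF h[OF z j] oS] True by simp
  next
    case False
    show ?thesis
      unfolding holomorphic_on_def
    proof
      fix t0 assume "t0 \<in> ?S"
      then have yD': "z(j := t0) \<in> D" by simp
      define y where "y = z(j := t0)"
      have yD: "y \<in> D" and yC: "y \<in> Cn N" using yD' Cn[OF yD'] by (auto simp: y_def)
      have ztoy: "z(j := t) = y(j := t)" for t by (simp add: y_def)
      have yj: "y j = t0" by (simp add: y_def)
      have cf: "continuous_on D f" using f by (simp add: separately_holomorphic_def)
      obtain r where r: "r > 0" "polydisc N y r \<subseteq> D" "\<And>w. w \<in> polydisc N y r \<Longrightarrow> cmod (f w - f y) < 1"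
        using cf[unfolded continuous_on_polydisc[OF D], rule_format, OF yD, of 1, simplified] by blast
      define B where "B = cmod (f y) + 1"
      have B: "cmod (f w) \<le> B" if "w \<in> polydisc N y r" for w
        using r(3)[OF that] norm_triangle_ineq2[of "f w" "f y"] by (simp add: B_def)
      have two: "y(j := t, i := s) \<in> polydisc N y r" if "t \<in> ball t0 r" "s \<in> ball (y i) r" for t s
        using that yC i j yj r(1) False
        by (auto simp: polydisc_def Cn_def dist_norm norm_minus_commute)
      define \<tau> where "\<tau> n = r / (8 * (real n + 1))" for n
      have \<tau>: "0 < \<tau> n" "\<tau> n < r / 4" for n
        using r(1) by (auto simp: \<tau>_def field_simps intro: add_pos_nonneg)
      define q where "q n t = (f (y(j := t, i := y i + of_real (\<tau> n))) - f (y(j := t))) / of_real (\<tau> n)" for n t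
      have "(\<lambda>t. partial_deriv i f (y(j := t))) holomorphic_on ball t0 r"
      proof (rule holomorphic_uniform_sequence[OF open_ball])
        fix n
        have *: "(\<lambda>t. f (y(j := t, i := s))) holomorphic_on ball t0 r" if s: "s \<in> ball (y i) r" for s
        proof -
          have "y(i := s) \<in> D"
            using two[of t0 s] s r by (auto simp: yj[symmetric])
          then have "(\<lambda>t. f (y(i := s, j := t))) holomorphic_on ball t0 r"
            by (rule holomorphic_on_subset[OF h[OF _ j]])
              (use two s r(2) False in \<open>auto simp: fun_upd_twist[of i j y]\<close>)
          then show ?thesis using False by (simp add: fun_upd_twist[of i j y])
        qed
        have "y i + of_real (\<tau> n) \<in> ball (y i) r" using \<tau>[of n] by (simp add: dist_norm)
        moreover have "(\<lambda>t. f (y(j := t, i := y i))) = (\<lambda>t. f (y(j := t)))"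
          using False by (intro ext arg_cong[where f=f]) auto
        ultimately show "q n holomorphic_on ball t0 r"
          unfolding q_def using *[of "y i + of_real (\<tau> n)"] *[of "y i"] r(1) \<tau>[of n]
          by (intro holomorphic_intros) auto
      next
        fix x assume "x \<in> ball t0 r"
        then obtain d where d: "d > 0" "cball x d \<subseteq> ball t0 r"
          using open_contains_cball[of "ball t0 r"] open_ball by blast
        have est: "dist (q n t) (partial_deriv i f (y(j := t))) \<le> 4 * B / r / (real n + 1)" if t: "t \<in> ball t0 r" for n t
        proof -
          let ?g = "\<lambda>s. f (y(j := t, i := s))"
          have yy: "y(j := t, i := y i) = y(j := t)" using False by auto
          have "y(j := t) \<in> D" using subsetD[OF r(2) two[OF t, of "y i"]] r(1) by (simp add: yy)
          then have "?g holomorphic_on ball (y i) r"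
            by (rule holomorphic_on_subset[OF h[OF _ i]]) (use two[OF t] r in auto)
          then have "cmod ((?g (y i + of_real (\<tau> n)) - ?g (y i)) / of_real (\<tau> n) - deriv ?g (y i)) \<le> 32 * B / r\<^sup>2 * \<tau> n"
            by (rule difference_quotient_bound[OF _ _ r(1) \<tau>]) (use B two[OF t] in auto)
          moreover note yy
          moreover have "deriv ?g (y i) = partial_deriv i f (y(j := t))"
            using False by (simp add: partial_deriv_def)
          moreover have "32 * B / r\<^sup>2 * \<tau> n = 4 * B / r / (real n + 1)"
          proof -
            have of_nat_1_pos: "real n + 1 > 0" by simp
            have "32 * B / r\<^sup>2 * (r / (8 * k)) = 4 * B / r / k" if "k > 0" for k
              using r(1) that by (simp add: field_simps power2_eq_square)
            from this[of "real n + 1", OF of_nat_1_pos] show ?thesis unfolding \<tau>_def .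
          qed
          ultimately show ?thesis by (simp add: q_def dist_norm)
        qed
        have "uniform_limit (cball x d) q (\<lambda>t. partial_deriv i f (y(j := t))) sequentially"
        proof (rule uniform_limitI)
          fix e :: real assume e: "e > 0"
          obtain n0 where n0: "4 * B / r / e < real n0" using reals_Archimedean2 by blast
          show "\<forall>\<^sub>F n in sequentially. \<forall>t\<in>cball x d. dist (q n t) (partial_deriv i f (y(j := t))) < e"
          proof (rule eventually_sequentiallyI[of n0], intro ballI)
            fix n t assume n: "n0 \<le> n" and t: "t \<in> cball x d"
            have "4 * B / r / e < real n + 1" using n0 n by linarith
            moreover have "C / k < e" if "C / e < k" "k > 0" for C k :: real
              using that e by (simp add: field_simps)
            ultimately have "4 * B / r / (real n + 1) < e" by fastforce
            then show "dist (q n t) (partial_deriv i f (y(j := t))) < e"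
              using est[of t n] t d(2) by auto
          qed
        qed
        then show "\<exists>d>0. cball x d \<subseteq> ball t0 r \<and> uniform_limit (cball x d) q (\<lambda>t. partial_deriv i f (y(j := t))) sequentially"
          using d by blast
      qed
      then have "(\<lambda>t. partial_deriv i f (y(j := t))) field_differentiable at t0"
        by (rule holomorphic_on_imp_differentiable_at[OF _ open_ball]) (use r(1) in simp)
      then show "(\<lambda>t. partial_deriv i f (z(j := t))) field_differentiable at t0 within ?S"
        unfolding ztoy by (rule field_differentiable_at_within)
    qed
  qed
qed

theorem holomorphic_Cn_partial_deriv:
  assumes "holomorphic_Cn N D f" "i < N"
  shows "holomorphic_Cn N D (partial_deriv i f)"
  by (rule separately_imp_holomorphic[OF separately_partial_deriv[OF holomorphic_imp_separately[OF assms(1)] assms(2)]])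

section \<open>Identity theorem and implicit functions\<close>

lemma higher_partial_deriv_slice:
  "(deriv ^^ m) (\<lambda>t. f (y(k := t))) = (\<lambda>t. (partial_deriv k ^^ m) f (y(k := t)))"
proof (induction m)
  case (Suc m)
  have "partial_deriv k F (y(k := t)) = deriv (\<lambda>s. F (y(k := s))) t" for F t
    unfolding partial_deriv_def by (simp only: fun_upd_upd fun_upd_same)
  then show ?case by (simp only: funpow.simps o_apply Suc.IH)
qed simp

text \<open>Taylor's theorem in one coordinate after the other, without multi-indices: once all functions of the class vanish where
  only the first \<open>k\<close> coordinates differ from those of \<open>p\<close>, so do all derivatives in the direction of the coordinate \<open>k\<close>,
  as these belong to the class too.\<close>

lemma vanishing_of_iterated_partials:
  assumes p: "p \<in> Cn N" and r: "r > 0"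
    and hol: "\<And>f. f \<in> \<C> \<Longrightarrow> holomorphic_Cn N (polydisc N p r) f"
    and pd: "\<And>f i. f \<in> \<C> \<Longrightarrow> i < N \<Longrightarrow> partial_deriv i f \<in> \<C>"
    and zero: "\<And>f. f \<in> \<C> \<Longrightarrow> f p = 0"
    and f: "f \<in> \<C>" and w: "w \<in> polydisc N p r"
  shows "f w = 0"
proof -
  have claim: "f w = 0" if "k \<le> N" "f \<in> \<C>" "w \<in> polydisc N p r" "\<And>j. j \<ge> k \<Longrightarrow> w j = p j" for k f w
    using that
  proof (induction k arbitrary: f w)
    case 0
    then have "w = p" by auto
    then show ?case using zero 0 by simp
  next
    case (Suc k)
    then have k: "k < N" by simp
    let ?y = "w(k := p k)" and ?g = "\<lambda>t. f (w(k := t))"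
    have wC: "w \<in> Cn N" using Suc.prems by (simp add: polydisc_def)
    have sl: "w(k := t) \<in> polydisc N p r" if "t \<in> ball (p k) r" for t
      using Suc.prems(3) that k by (auto simp: polydisc_def Cn_def dist_norm norm_minus_commute)
    have pk: "p k \<in> ball (p k) r" using r by simp
    have pds: "(partial_deriv k ^^ m) f \<in> \<C>" for m
      by (induction m) (use Suc.prems(2) pd k in auto)
    have yj: "?y j = p j" if "j \<ge> k" for j
      using Suc.prems(4)[of j] that by (cases "j = k") auto
    have "(deriv ^^ m) ?g (p k) = 0" for m
      unfolding higher_partial_deriv_slice
      by (rule Suc.IH[OF _ pds sl[OF pk] yj]) (use k in auto)
    moreover have "?g holomorphic_on ball (p k) r"
    proof (rule holomorphic_Cn_curve[OF hol[OF Suc.prems(2)] open_ball])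
      show "(\<lambda>t. (w(k := t)) i) holomorphic_on ball (p k) r" for i
        by (cases "i = k") (auto intro: holomorphic_intros)
      show "(\<lambda>t. w(k := t)) ` ball (p k) r \<subseteq> polydisc N p r" using sl by blast
    qed
    moreover have "w k \<in> ball (p k) r"
      using Suc.prems(3) k by (auto simp: polydisc_def dist_norm norm_minus_commute)
    ultimately have "?g (w k) = 0" using holomorphic_fun_eq_0_on_ball by blast
    then show ?case by simp
  qed
  show ?thesis
    by (rule claim[OF order_refl f w]) (use w p in \<open>auto simp: polydisc_def Cn_def\<close>)
qed

definition insert_coord :: "nat \<Rightarrow> complex \<Rightarrow> (nat \<Rightarrow> complex) \<Rightarrow> nat \<Rightarrow> complex" where
  "insert_coord j t w = (\<lambda>i. if i < j then w i else if i = j then t else w (i - 1))"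

definition drop_coord :: "nat \<Rightarrow> (nat \<Rightarrow> complex) \<Rightarrow> nat \<Rightarrow> complex" where
  "drop_coord j z = (\<lambda>i. if i < j then z i else z (Suc i))"

lemma insert_drop [simp]: "insert_coord j (z j) (drop_coord j z) = z"
  by (auto simp: insert_coord_def drop_coord_def fun_eq_iff)

lemma drop_insert [simp]: "drop_coord j (insert_coord j t w) = w"
  by (auto simp: insert_coord_def drop_coord_def fun_eq_iff)

lemma insert_coord_same [simp]: "insert_coord j t w j = t"
  by (simp add: insert_coord_def)

lemma insert_coord_upd: "insert_coord j s w = (insert_coord j t w)(j := s)"
  by (auto simp: insert_coord_def fun_eq_iff)

lemma insert_coord_Cn: "w \<in> Cn M \<Longrightarrow> j \<le> M \<Longrightarrow> insert_coord j t w \<in> Cn (Suc M)"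
  by (auto simp: insert_coord_def Cn_def)

lemma drop_coord_Cn: "z \<in> Cn (Suc M) \<Longrightarrow> j \<le> M \<Longrightarrow> drop_coord j z \<in> Cn M"
  by (auto simp: drop_coord_def Cn_def)

lemma insert_coord_polydisc:
  assumes "p \<in> Cn (Suc M)" "j \<le> M" "w \<in> polydisc M (drop_coord j p) r" "cmod (t - p j) < r"
  shows "insert_coord j t w \<in> polydisc (Suc M) p r"
proof -
  have "cmod (insert_coord j t w i - p i) < r" if "i < Suc M" for i
  proof (cases i j rule: linorder_cases)
    case greater
    then obtain i' where i': "i = Suc i'" by (cases i) auto
    then have "i' < M" "\<not> i' < j" using that greater by auto
    then show ?thesis using assms(3) greater by (force simp: polydisc_def insert_coord_def drop_coord_def i')
  next
    case less
    then have "i < M" using assms(2) by simp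
    then have "cmod (w i - drop_coord j p i) < r" using assms(3) by (simp add: polydisc_def)
    then show ?thesis using less by (simp add: insert_coord_def drop_coord_def)
  next
    case equal
    then show ?thesis using assms(4) by simp
  qed
  then show ?thesis using assms insert_coord_Cn by (simp add: polydisc_def)
qed

lemma sum_skip:
  fixes F :: "nat \<Rightarrow> complex"
  assumes "j \<le> M"
  shows "(\<Sum>i<Suc M. F i) = F j + (\<Sum>i<M. F (if i < j then i else Suc i))"
proof -
  have "(\<Sum>i<M. F (if i < j then i else Suc i)) = (\<Sum>i\<in>{..<Suc M} - {j}. F i)"
    by (rule sum.reindex_bij_witness[of _ "\<lambda>i. if i < j then i else i - 1" "\<lambda>i. if i < j then i else Suc i"])
      (use assms in \<open>auto split: if_splits\<close>)
  moreover have "sum F {..<Suc M} = F j + sum F ({..<Suc M} - {j})"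
    by (rule sum.remove) (use assms in auto)
  ultimately show ?thesis by (simp only:)
qed

lemma holomorphic_Cn_insert_coord:
  assumes E: "open_Cn M E" and g: "holomorphic_Cn M E g" and j: "j \<le> M" and i: "i < Suc M"
  shows "holomorphic_Cn M E (\<lambda>w. insert_coord j (g w) w i)"
proof (cases i j rule: linorder_cases)
  case less
  then show ?thesis using holomorphic_Cn_coordinate[OF E, of i] j by (simp add: insert_coord_def)
next
  case equal
  then show ?thesis using g by simp
next
  case greater
  then show ?thesis using holomorphic_Cn_coordinate[OF E, of "i - 1"] i by (simp add: insert_coord_def)
qed

text \<open>Only the coefficient \<open>u j\<close> contributes along the slice in the direction of the coordinate \<open>j\<close>.\<close>

lemma caratheodory_partial:
  assumes D: "open_Cn N D" and z: "z \<in> D" and j: "j < N"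
    and u': "caratheodory N D f z u"
  shows "u j z = partial_deriv j f z"
proof -
  note u = caratheodoryD[OF u']
  let ?S = "{t. z(j := t) \<in> D}"
  have zC: "z \<in> Cn N" using z openin_Cn_subset[OF D] by blast
  have oS: "open ?S" by (rule open_slice[OF D zC j])
  have zS: "z j \<in> ?S" using z by simp
  have "continuous_on ?S (\<lambda>t. z(j := t))"
  proof (rule continuous_on_coordinatewise_then_product)
    show "continuous_on ?S (\<lambda>t. (z(j := t)) i)" for i
      by (cases "i = j") (simp_all add: continuous_on_id continuous_on_const)
  qed
  then have c1: "continuous (at (z j) within ?S) (\<lambda>t. z(j := t))"
    using zS by (simp add: continuous_on_eq_continuous_within)
  have c2: "continuous (at (z j) within ?S) (\<lambda>t. u j (z(j := t)))"
    by (rule continuous_within_compose2[OF c1]) (rule continuous_within_subset[of _ D], use u(1)[OF j] in auto)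
  have "((\<lambda>t. f z + u j (z(j := t)) * (t - z j)) has_field_derivative u j z) (at (z j) within ?S)"
    unfolding DERIV_caratheodory_within by (rule exI[of _ "\<lambda>t. u j (z(j := t))"]) (use c2 in simp)
  then have d: "((\<lambda>t. f z + u j (z(j := t)) * (t - z j)) has_field_derivative u j z) (at (z j))"
    using at_within_open[OF zS oS] by simp
  have eq: "f z + u j (z(j := t)) * (t - z j) = f (z(j := t))" if "t \<in> ?S" for t
  proof -
    have "f (z(j := t)) - f z = (\<Sum>i<N. u i (z(j := t)) * ((z(j := t)) i - z i))"
      by (rule u(2)) (use that in simp)
    also have "\<dots> = (\<Sum>i<N. if i = j then u j (z(j := t)) * (t - z j) else 0)"
      by (intro sum.cong) auto
    also have "\<dots> = u j (z(j := t)) * (t - z j)" using j by simp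
    finally show ?thesis by (simp add: algebra_simps)
  qed
  have "((\<lambda>t. f (z(j := t))) has_field_derivative u j z) (at (z j))"
    by (rule has_field_derivative_transform_within_open[OF d oS zS eq])
  then show ?thesis unfolding partial_deriv_def by (simp add: DERIV_imp_deriv)
qed

text \<open>The solution \<open>g w\<close> is the fixed point of a contraction; its holomorphy is read off from the Caratheodory form of
  \<open>f\<close> along the zero set, where the increment of \<open>f\<close> is zero and can be solved for the increment of \<open>g\<close>.\<close>

lemma implicit_function:
  assumes f: "holomorphic_Cn (Suc M) D f" and p: "p \<in> D" and j: "j \<le> M"
    and fp: "f p = 0" and pd: "partial_deriv j f p \<noteq> 0"
  obtains \<rho> \<sigma> g where "\<rho> > 0" "\<sigma> > 0" "holomorphic_Cn M (polydisc M (drop_coord j p) \<rho>) g"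
    "\<And>w. w \<in> polydisc M (drop_coord j p) \<rho> \<Longrightarrow> cmod (g w - p j) < \<sigma>"
    "\<And>w t. w \<in> polydisc M (drop_coord j p) \<rho> \<Longrightarrow> cmod (t - p j) < \<sigma> \<Longrightarrow>
      insert_coord j t w \<in> D \<and> (f (insert_coord j t w) = 0 \<longleftrightarrow> t = g w)"
proof -
  let ?N = "Suc M"
  have D: "open_Cn ?N D" by (rule holomorphic_Cn_openin[OF f])
  have pC: "p \<in> Cn ?N" using p openin_Cn_subset[OF D] by blast
  have jN: "j < ?N" using j by simp
  define q where "q = drop_coord j p"
  have qC: "q \<in> Cn M" unfolding q_def by (rule drop_coord_Cn[OF pC j])
  define c where "c = partial_deriv j f p"
  have c: "c \<noteq> 0" using pd by (simp add: c_def)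
  have pdh: "holomorphic_Cn ?N D (partial_deriv j f)" by (rule holomorphic_Cn_partial_deriv[OF f jN])
  have c2: "cmod c / 2 > 0" using c by simp
  obtain r where r: "r > 0" "polydisc ?N p r \<subseteq> D"
    "\<And>w. w \<in> polydisc ?N p r \<Longrightarrow> cmod (partial_deriv j f w - c) < cmod c / 2"
    using holomorphic_Cn_continuous[OF pdh, unfolded continuous_on_polydisc[OF D], rule_format, OF p c2]
    unfolding c_def by blast
  define \<sigma> where "\<sigma> = r / 2"
  have \<sigma>: "\<sigma> > 0" "\<sigma> < r" using r by (auto simp: \<sigma>_def)
  have c4: "cmod c * \<sigma> / 2 > 0" using c \<sigma> by simp
  obtain \<rho>1 where \<rho>1: "\<rho>1 > 0" "\<And>w. w \<in> polydisc ?N p \<rho>1 \<Longrightarrow> cmod (f w - f p) < cmod c * \<sigma> / 2"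
    using holomorphic_Cn_continuous[OF f, unfolded continuous_on_polydisc[OF D], rule_format, OF p c4] by blast
  define \<rho> where "\<rho> = min r \<rho>1"
  have \<rho>: "\<rho> > 0" "\<rho> \<le> r" "\<rho> \<le> \<rho>1" using r \<rho>1 by (auto simp: \<rho>_def)
  let ?E = "polydisc M q \<rho>"
  have in_r: "insert_coord j t w \<in> polydisc ?N p r" if "w \<in> ?E" "cmod (t - p j) < r" for t w
    by (rule insert_coord_polydisc[OF pC j _ that(2)]) (use that(1) polydisc_mono[OF \<rho>(2)] in \<open>auto simp: q_def\<close>)
  \<comment> \<open>Newton's map with the fixed derivative \<open>c\<close>, a contraction uniformly in the parameter \<open>w\<close>\<close>
  define \<phi> where "\<phi> w t = t - f (insert_coord j t w) / c" for w t
  have contr: "cmod (\<phi> w t - \<phi> w s) \<le> 1 / 2 * cmod (t - s)"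
    if w: "w \<in> ?E" and t: "t \<in> ball (p j) r" and s: "s \<in> ball (p j) r" for w t s
  proof (rule field_differentiable_bound[of "ball (p j) r" "\<phi> w" "\<lambda>t. 1 - partial_deriv j f (insert_coord j t w) / c"])
    fix t assume t: "t \<in> ball (p j) r"
    let ?y = "insert_coord j t w"
    have y: "?y \<in> polydisc ?N p r" by (rule in_r[OF w]) (use t in \<open>simp add: dist_norm norm_minus_commute\<close>)
    then have yD: "?y \<in> D" and yC: "?y \<in> Cn ?N" using r(2) by (auto simp: polydisc_def)
    have "(\<lambda>s. f (?y(j := s))) holomorphic_on {s. ?y(j := s) \<in> D}"
      using holomorphic_imp_separately[OF f] yD jN unfolding separately_holomorphic_def by blast
    then have "((\<lambda>s. f (?y(j := s))) has_field_derivative deriv (\<lambda>s. f (?y(j := s))) t) (at t)"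
      by (rule holomorphic_derivI[OF _ open_slice[OF D yC jN]])
        (use yD in \<open>simp add: insert_coord_upd[of j t w t, symmetric]\<close>)
    then have "((\<lambda>s. f (insert_coord j s w)) has_field_derivative partial_deriv j f ?y) (at t)"
      by (simp add: insert_coord_upd[of j _ w t, symmetric] partial_deriv_def)
    then have "(\<phi> w has_field_derivative 1 - partial_deriv j f ?y / c) (at t)"
      unfolding \<phi>_def by (intro DERIV_diff DERIV_ident DERIV_cdivide)
    then show "(\<phi> w has_field_derivative 1 - partial_deriv j f ?y / c) (at t within ball (p j) r)"
      by (rule has_field_derivative_at_within)
    have "1 - partial_deriv j f ?y / c = - ((partial_deriv j f ?y - c) / c)"
      using c by (simp add: field_simps)
    then have "cmod (1 - partial_deriv j f ?y / c) = cmod (partial_deriv j f ?y - c) / cmod c"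
      by (simp only: norm_minus_cancel norm_divide)
    also have "\<dots> \<le> 1 / 2" using r(3)[OF y] c by (simp add: field_simps)
    finally show "cmod (1 - partial_deriv j f ?y / c) \<le> 1 / 2" .
  qed (use t s in auto)
  have into: "cmod (\<phi> w t - p j) < \<sigma>" if w: "w \<in> ?E" and t: "t \<in> cball (p j) \<sigma>" for w t
  proof -
    have "insert_coord j (p j) w \<in> polydisc ?N p \<rho>1"
      by (rule insert_coord_polydisc[OF pC j]) (use w \<rho>1(1) polydisc_mono[OF \<rho>(3)] in \<open>auto simp: q_def\<close>)
    from \<rho>1(2)[OF this] have "cmod (f (insert_coord j (p j) w)) < cmod c * \<sigma> / 2" by (simp add: fp)
    then have "cmod (f (insert_coord j (p j) w) / c) < \<sigma> / 2"
      using c by (simp add: norm_divide field_simps)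
    then have "cmod (\<phi> w (p j) - p j) < \<sigma> / 2" by (simp add: \<phi>_def)
    moreover have "cmod (\<phi> w t - \<phi> w (p j)) \<le> 1 / 2 * cmod (t - p j)"
      by (rule contr[OF w]) (use t \<sigma> in auto)
    moreover have "cmod (t - p j) \<le> \<sigma>" using t by (simp add: dist_norm norm_minus_commute)
    moreover have "cmod (\<phi> w t - p j) \<le> cmod (\<phi> w t - \<phi> w (p j)) + cmod (\<phi> w (p j) - p j)"
      using norm_triangle_ineq[of "\<phi> w t - \<phi> w (p j)" "\<phi> w (p j) - p j"] by simp
    ultimately show ?thesis by simp
  qed
  have fixp: "\<exists>!t. t \<in> cball (p j) \<sigma> \<and> \<phi> w t = t" if w: "w \<in> ?E" for w
  proof (rule Banach_fix[of "cball (p j) \<sigma>" "1/2" "\<phi> w"])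
    show "complete (cball (p j) \<sigma>)" by (simp add: compact_imp_complete)
    show "cball (p j) \<sigma> \<noteq> {}" using \<sigma> by simp
    show "\<phi> w ` cball (p j) \<sigma> \<subseteq> cball (p j) \<sigma>"
      using into[OF w] by (force simp: dist_norm norm_minus_commute)
    show "dist (\<phi> w x) (\<phi> w y) \<le> 1 / 2 * dist x y" if "x \<in> cball (p j) \<sigma>" "y \<in> cball (p j) \<sigma>" for x y
      unfolding dist_norm by (rule contr[OF w]) (use that \<sigma> in auto)
  qed auto
  define g where "g w = (THE t. t \<in> cball (p j) \<sigma> \<and> \<phi> w t = t)" for w
  have g: "g w \<in> cball (p j) \<sigma>" "\<phi> w (g w) = g w" if "w \<in> ?E" for w
    using theI'[OF fixp[OF that]] unfolding g_def by auto
  have g_in: "cmod (g w - p j) < \<sigma>" if "w \<in> ?E" for w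
    using into[OF that g(1)[OF that]] g(2)[OF that] by simp
  have zero_iff: "\<phi> w t = t \<longleftrightarrow> f (insert_coord j t w) = 0" for w t
    using c by (simp add: \<phi>_def)
  have g_zero: "f (insert_coord j (g w) w) = 0" if "w \<in> ?E" for w
    using g(2)[OF that] zero_iff by blast
  have g_iff: "f (insert_coord j t w) = 0 \<longleftrightarrow> t = g w" if "w \<in> ?E" "cmod (t - p j) < \<sigma>" for w t
  proof
    assume "f (insert_coord j t w) = 0"
    moreover have "t \<in> cball (p j) \<sigma>" using that by (simp add: dist_norm norm_minus_commute)
    ultimately show "t = g w" using fixp[OF that(1)] g[OF that(1)] zero_iff by blast
  qed (use g_zero that in simp)
  have inD: "insert_coord j t w \<in> D" if "w \<in> ?E" "cmod (t - p j) < \<sigma>" for t w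
    using in_r[OF that(1), of t] that(2) \<sigma>(2) r(2) by (meson less_trans subsetD)
  have oE: "open_Cn M ?E" by (rule polydisc_openin)
  have g_cont: "continuous (at z within ?E) g" if z: "z \<in> ?E" for z
    unfolding continuous_within_polydisc[OF oE z]
  proof (intro allI impI)
    fix e :: real assume e: "e > 0"
    have gz: "cmod (g z - p j) < \<sigma>" by (rule g_in[OF z])
    have "holomorphic_Cn M ?E (\<lambda>w. f (insert_coord j (g z) w))"
    proof (rule holomorphic_Cn_compose[OF f oE])
      show "holomorphic_Cn M ?E (\<lambda>w. insert_coord j (g z) w i)" if "i < ?N" for i
        by (rule holomorphic_Cn_insert_coord[OF oE holomorphic_Cn_const[OF oE] j that])
      show "insert_coord j (g z) ` ?E \<subseteq> D" using inD[OF _ gz] by blast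
    qed
    then have cf: "continuous_on ?E (\<lambda>w. f (insert_coord j (g z) w))" by (rule holomorphic_Cn_continuous)
    have e': "e * cmod c / 2 > 0" using e c by simp
    obtain d where d: "d > 0" "polydisc M z d \<subseteq> ?E"
      "\<And>w. w \<in> polydisc M z d \<Longrightarrow> cmod (f (insert_coord j (g z) w) - f (insert_coord j (g z) z)) < e * cmod c / 2"
      using cf[unfolded continuous_on_polydisc[OF oE], rule_format, OF z e'] by blast
    have "cmod (g w - g z) < e" if w: "w \<in> polydisc M z d" for w
    proof -
      have wE: "w \<in> ?E" using w d(2) by blast
      have co: "cmod (\<phi> w (g w) - \<phi> w (g z)) \<le> 1 / 2 * cmod (g w - g z)"
        by (rule contr[OF wE]) (use g(1)[OF wE] g(1)[OF z] \<sigma>(2) in auto)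
      have "\<phi> w (g z) - g z = - ((f (insert_coord j (g z) w) - f (insert_coord j (g z) z)) / c)"
        by (simp add: \<phi>_def g_zero[OF z])
      then have "cmod (\<phi> w (g z) - g z) = cmod (f (insert_coord j (g z) w) - f (insert_coord j (g z) z)) / cmod c"
        by (simp only: norm_minus_cancel norm_divide)
      moreover have "cmod (f (insert_coord j (g z) w) - f (insert_coord j (g z) z)) / cmod c < e / 2"
        using d(3)[OF w] c by (simp add: pos_divide_less_eq)
      ultimately have "cmod (\<phi> w (g z) - g z) < e / 2" by simp
      moreover have "cmod (g w - g z) \<le> cmod (\<phi> w (g w) - \<phi> w (g z)) + cmod (\<phi> w (g z) - g z)"
        using norm_triangle_ineq[of "g w - \<phi> w (g z)" "\<phi> w (g z) - g z"] g(2)[OF wE] by simp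
      ultimately show ?thesis using co by simp
    qed
    then show "\<exists>d>0. polydisc M z d \<subseteq> ?E \<and> (\<forall>w\<in>polydisc M z d. cmod (g w - g z) < e)"
      using d(1,2) by blast
  qed
  define G where "G w = insert_coord j (g w) w" for w
  have GD: "G ` ?E \<subseteq> D" using inD g_in by (auto simp: G_def)
  have G_cont: "continuous_on ?E G"
  proof (rule continuous_on_coordinates_Cn[of ?N])
    have cg: "continuous_on ?E g" using g_cont by (simp add: continuous_on_eq_continuous_within)
    fix i assume "i < ?N"
    have "continuous_on ?E (\<lambda>w. w k)" for k :: nat
      by (rule continuous_on_subset[OF continuous_on_product_coordinates subset_UNIV])
    then show "continuous_on ?E (\<lambda>w. G w i)"
      using cg by (cases i j rule: linorder_cases) (simp_all add: G_def insert_coord_def)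
  qed (use GD openin_Cn_subset[OF D] in blast)
  have "holomorphic_Cn M ?E g"
  proof (rule holomorphic_CnI_local[OF oE])
    fix z assume z: "z \<in> ?E"
    have Gz: "G z \<in> D" using GD z by blast
    obtain u where u': "caratheodory ?N D f (G z) u" by (rule holomorphic_Cn_caratheodory[OF f Gz])
    note u = caratheodoryD[OF u']
    have cG: "continuous (at z within ?E) G" using G_cont z by (simp add: continuous_on_eq_continuous_within)
    have cu: "continuous (at z within ?E) (\<lambda>w. u i (G w))" if "i < ?N" for i
      by (rule continuous_within_compose2[OF cG continuous_within_subset[OF u(1)[OF that] GD]])
    have Gzr: "G z \<in> polydisc ?N p r" unfolding G_def by (rule in_r[OF z]) (use g_in[OF z] \<sigma>(2) in simp)
    have uj: "u j (G z) = partial_deriv j f (G z)" by (rule caratheodory_partial[OF D Gz jN u'])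
    have uj0: "u j (G z) \<noteq> 0"
    proof
      assume "u j (G z) = 0"
      then show False using r(3)[OF Gzr] uj c by simp
    qed
    then have "cmod (u j (G z)) > 0" by simp
    then obtain d where d: "d > 0" "polydisc M z d \<subseteq> ?E"
      "\<And>w. w \<in> polydisc M z d \<Longrightarrow> cmod (u j (G w) - u j (G z)) < cmod (u j (G z))"
      using cu[OF jN, unfolded continuous_within_polydisc[OF oE z], rule_format] by blast
    have ujw: "u j (G w) \<noteq> 0" if "w \<in> polydisc M z d" for w
      using d(3)[OF that] by auto
    have zC: "z \<in> Cn M" using z by (simp add: polydisc_def)
    have zd: "z \<in> polydisc M z d" by (rule polydisc_center[OF zC d(1)])
    define s where "s i = (if i < j then i else Suc i)" for i
    have s: "s i < ?N" if "i < M" for i using that by (auto simp: s_def)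
    define v where "v i w = - u (s i) (G w) / u j (G w)" for i w
    have id: "g w - g z = (\<Sum>i<M. v i w * (w i - z i))" if w: "w \<in> polydisc M z d" for w
    proof -
      have wE: "w \<in> ?E" using w d(2) by blast
      have Gs: "G x (s i) = x i" for x i by (simp add: G_def s_def insert_coord_def)
      have "0 = f (G w) - f (G z)" using g_zero[OF wE] g_zero[OF z] by (simp add: G_def)
      also have "\<dots> = (\<Sum>i<?N. u i (G w) * (G w i - G z i))" by (rule u(2)) (use GD wE in blast)
      also have "\<dots> = u j (G w) * (G w j - G z j) + (\<Sum>i<M. u (s i) (G w) * (G w (s i) - G z (s i)))"
        unfolding s_def by (rule sum_skip[OF j])
      also have "\<dots> = u j (G w) * (g w - g z) + (\<Sum>i<M. u (s i) (G w) * (w i - z i))"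
        unfolding Gs by (simp add: G_def)
      finally have "g w - g z = - (\<Sum>i<M. u (s i) (G w) * (w i - z i)) / u j (G w)"
        using ujw[OF w] by (simp add: field_simps eq_neg_iff_add_eq_0)
      also have "\<dots> = (\<Sum>i<M. v i w * (w i - z i))"
        by (simp add: v_def sum_divide_distrib sum_negf[symmetric])
      finally show ?thesis .
    qed
    have cv: "continuous (at z within polydisc M z d) (v i)" if "i < M" for i
    proof (rule continuous_within_subset[OF _ d(2)])
      show "continuous (at z within ?E) (v i)"
        unfolding v_def[abs_def]
        by (intro continuous_at_within_divide continuous_minus cu s that jN uj0)
    qed
    show "\<exists>E u. z \<in> E \<and> open_Cn M E \<and> caratheodory M E g z u"
      unfolding caratheodory_def
      by (rule exI[of _ "polydisc M z d"], rule exI[of _ v]) (use zd polydisc_openin cv id in simp)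
  qed
  then show thesis
    using that[of \<rho> \<sigma> g] \<rho>(1) \<sigma>(1) g_in inD g_iff unfolding q_def by blast
qed

section \<open>Biholomorphic maps between subsets of number spaces\<close>

lemma holomorphic_subset_subset:
  assumes "holomorphic_subset N W g" "V \<subseteq> W"
  shows "holomorphic_subset N V g"
  unfolding holomorphic_subset_def
proof
  fix z assume "z \<in> V"
  then have "z \<in> W" using assms(2) by blast
  then obtain D h where Dh: "z \<in> D" "holomorphic_Cn N D h" "\<forall>w\<in>D \<inter> W. g w = h w"
    using assms(1) unfolding holomorphic_subset_def by meson
  show "\<exists>D h. z \<in> D \<and> holomorphic_Cn N D h \<and> (\<forall>w\<in>D \<inter> V. g w = h w)"
    by (rule exI[of _ D], rule exI[of _ h]) (use Dh assms(2) in auto)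
qed

lemma holomorphic_subset_cong:
  assumes "holomorphic_subset N W g" "\<And>z. z \<in> W \<Longrightarrow> f z = g z"
  shows "holomorphic_subset N W f"
  unfolding holomorphic_subset_def
proof
  fix z assume "z \<in> W"
  then obtain D h where Dh: "z \<in> D" "holomorphic_Cn N D h" "\<forall>w\<in>D \<inter> W. g w = h w"
    using assms(1) unfolding holomorphic_subset_def by meson
  show "\<exists>D h. z \<in> D \<and> holomorphic_Cn N D h \<and> (\<forall>w\<in>D \<inter> W. f w = h w)"
    by (rule exI[of _ D], rule exI[of _ h]) (use Dh assms(2) in auto)
qed

lemma holomorphic_Cn_imp_subset:
  assumes "holomorphic_Cn N D f" "W \<subseteq> D"
  shows "holomorphic_subset N W f"
  unfolding holomorphic_subset_def
proof
  fix z assume "z \<in> W"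
  then show "\<exists>D h. z \<in> D \<and> holomorphic_Cn N D h \<and> (\<forall>w\<in>D \<inter> W. f w = h w)"
    by (intro exI[of _ D] exI[of _ f]) (use assms in auto)
qed

lemma holomorphic_subset_coordinate:
  assumes "W \<subseteq> Cn N" "i < N"
  shows "holomorphic_subset N W (\<lambda>z. z i)"
  by (rule holomorphic_Cn_imp_subset[OF holomorphic_Cn_coordinate[OF openin_subtopology_self assms(2)] assms(1)])

lemma holomorphic_subset_binop:
  assumes f: "holomorphic_subset N W f" and g: "holomorphic_subset N W g"
    and op: "\<And>D f g. holomorphic_Cn N D f \<Longrightarrow> holomorphic_Cn N D g \<Longrightarrow> holomorphic_Cn N D (\<lambda>z. c (f z) (g z))"
  shows "holomorphic_subset N W (\<lambda>z. c (f z) (g z))"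
  unfolding holomorphic_subset_def
proof
  fix z assume z: "z \<in> W"
  obtain D h where Dh: "z \<in> D" "holomorphic_Cn N D h" "\<forall>w\<in>D \<inter> W. f w = h w"
    using f z unfolding holomorphic_subset_def by meson
  obtain E k where Ek: "z \<in> E" "holomorphic_Cn N E k" "\<forall>w\<in>E \<inter> W. g w = k w"
    using g z unfolding holomorphic_subset_def by meson
  have o: "open_Cn N (D \<inter> E)"
    by (intro openin_Int holomorphic_Cn_openin[OF Dh(2)] holomorphic_Cn_openin[OF Ek(2)])
  have "holomorphic_Cn N (D \<inter> E) (\<lambda>z. c (h z) (k z))"
    by (rule op[OF holomorphic_Cn_subset[OF Dh(2) o] holomorphic_Cn_subset[OF Ek(2) o]]) auto
  then show "\<exists>D h. z \<in> D \<and> holomorphic_Cn N D h \<and> (\<forall>w\<in>D \<inter> W. c (f w) (g w) = h w)"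
    by (intro exI[of _ "D \<inter> E"] exI[of _ "\<lambda>z. c (h z) (k z)"]) (use Dh Ek in auto)
qed

lemma holomorphic_subset_continuous:
  assumes W: "W \<subseteq> Cn N" and g: "holomorphic_subset N W g"
  shows "continuous_on W g"
  unfolding continuous_on_eq_continuous_within
proof
  fix z assume z: "z \<in> W"
  then obtain D h where Dh: "z \<in> D" "holomorphic_Cn N D h" "\<forall>w\<in>D \<inter> W. g w = h w"
    using g unfolding holomorphic_subset_def by meson
  obtain T where T: "open T" "D = Cn N \<inter> T"
    using holomorphic_Cn_openin[OF Dh(2)] by (auto simp: openin_open)
  have DW: "D \<inter> W = W \<inter> T" using T W by auto
  have "continuous_on (W \<inter> T) h"
    using holomorphic_Cn_continuous[OF Dh(2)] by (rule continuous_on_subset) (use DW in auto)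
  then have "continuous_on (W \<inter> T) g"
    by (rule continuous_on_eq) (use Dh(3) DW in auto)
  then have "continuous (at z within (W \<inter> T)) g"
    using z Dh(1) T by (auto simp: continuous_on_eq_continuous_within)
  moreover have "at z within (W \<inter> T) = at z within W"
    by (rule at_within_nhd[of z T]) (use T Dh(1) in auto)
  ultimately show "continuous (at z within W) g" by simp
qed

lemma holomorphic_subset_compose:
  assumes g: "holomorphic_subset N W g" and W: "W \<subseteq> Cn N" and V: "V \<subseteq> Cn M"
    and \<psi>: "\<psi> ` V \<subseteq> W" "\<And>i. i < N \<Longrightarrow> holomorphic_subset M V (\<lambda>z. \<psi> z i)"
  shows "holomorphic_subset M V (\<lambda>z. g (\<psi> z))"
  unfolding holomorphic_subset_def
proof
  fix z assume z: "z \<in> V"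
  then have zC: "z \<in> Cn M" using V by blast
  have "\<psi> z \<in> W" using z \<psi>(1) by blast
  then obtain D h where Dh: "\<psi> z \<in> D" "holomorphic_Cn N D h" "\<forall>w\<in>D \<inter> W. g w = h w"
    using g unfolding holomorphic_subset_def by meson
  have "\<exists>E k. z \<in> E \<and> holomorphic_Cn M E k \<and> (\<forall>w\<in>E \<inter> V. \<psi> w i = k w)" if "i < N" for i
    using \<psi>(2)[OF that] z unfolding holomorphic_subset_def by blast
  then obtain E k where Ek: "\<And>i. i < N \<Longrightarrow> z \<in> E i" "\<And>i. i < N \<Longrightarrow> holomorphic_Cn M (E i) (k i)"
    "\<And>i w. i < N \<Longrightarrow> w \<in> E i \<Longrightarrow> w \<in> V \<Longrightarrow> \<psi> w i = k i w" by (metis IntI)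
  define E0 where "E0 = Cn M \<inter> (\<Inter>i<N. E i)"
  have "open_Cn M ((\<Inter>i\<in>{..<N}. E i) \<inter> topspace (top_of_set (Cn M)))"
    by (rule openin_INT) (use holomorphic_Cn_openin[OF Ek(2)] in auto)
  then have oE0: "open_Cn M E0" by (simp add: E0_def Int_commute)
  have hk: "holomorphic_Cn M E0 (k i)" if "i < N" for i
    by (rule holomorphic_Cn_subset[OF Ek(2)[OF that] oE0]) (use that in \<open>auto simp: E0_def\<close>)
  define H where "H w = (\<lambda>i. if i < N then k i w else 0)" for w
  have HC: "H w \<in> Cn N" for w by (simp add: H_def Cn_def)
  have hH: "holomorphic_Cn M E0 (\<lambda>w. H w i)" if "i < N" for i using hk[OF that] that by (simp add: H_def)
  have cH: "continuous_on E0 H"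
    by (rule continuous_on_coordinates_Cn[of N]) (use holomorphic_Cn_continuous[OF hH] HC in auto)
  have H\<psi>: "H w = \<psi> w" if "w \<in> E0" "w \<in> V" for w
  proof
    fix i
    have "\<psi> w \<in> Cn N" using that \<psi>(1) W by blast
    then show "H w i = \<psi> w i"
      using Ek(3)[of i w] that by (cases "i < N") (auto simp: H_def E0_def Cn_def)
  qed
  define E1 where "E1 = E0 \<inter> H -` D"
  have "openin (top_of_set E0) E1"
    unfolding E1_def
    by (rule continuous_openin_preimage[OF cH _ holomorphic_Cn_openin[OF Dh(2)]]) (use HC in auto)
  then have oE1: "open_Cn M E1" using oE0 openin_trans by blast
  have zE: "z \<in> E0" using zC Ek(1) by (auto simp: E0_def)
  have "holomorphic_Cn M E1 (\<lambda>w. h (H w))"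
  proof (rule holomorphic_Cn_compose[OF Dh(2) oE1])
    show "holomorphic_Cn M E1 (\<lambda>w. H w i)" if "i < N" for i
      by (rule holomorphic_Cn_subset[OF hH[OF that] oE1]) (auto simp: E1_def)
  qed (auto simp: E1_def)
  moreover have "z \<in> E1" using zE z H\<psi>[OF zE z] Dh(1) by (simp add: E1_def)
  moreover have "g (\<psi> w) = h (H w)" if "w \<in> E1 \<inter> V" for w
    using that H\<psi>[of w] Dh(3) \<psi>(1) by (auto simp: E1_def)
  ultimately show "\<exists>D h. z \<in> D \<and> holomorphic_Cn M D h \<and> (\<forall>w\<in>D \<inter> V. g (\<psi> w) = h w)"
    by (intro exI[of _ E1] exI[of _ "\<lambda>w. h (H w)"]) simp
qed

definition biholomorphic where
  "biholomorphic N W k E \<psi> \<psi>' \<longleftrightarrow> W \<subseteq> Cn N \<and> E \<subseteq> Cn k \<and> \<psi> ` W \<subseteq> E \<and> \<psi>' ` E \<subseteq> W \<and>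
     (\<forall>w\<in>W. \<psi>' (\<psi> w) = w) \<and> (\<forall>z\<in>E. \<psi> (\<psi>' z) = z) \<and>
     (\<forall>i<k. holomorphic_subset N W (\<lambda>w. \<psi> w i)) \<and> (\<forall>i<N. holomorphic_subset k E (\<lambda>z. \<psi>' z i))"

lemma biholomorphicD:
  assumes "biholomorphic N W k E \<psi> \<psi>'"
  shows "W \<subseteq> Cn N" "E \<subseteq> Cn k" "\<psi> ` W \<subseteq> E" "\<psi>' ` E \<subseteq> W"
    "\<And>w. w \<in> W \<Longrightarrow> \<psi>' (\<psi> w) = w" "\<And>z. z \<in> E \<Longrightarrow> \<psi> (\<psi>' z) = z"
    "\<And>i. i < k \<Longrightarrow> holomorphic_subset N W (\<lambda>w. \<psi> w i)"
    "\<And>i. i < N \<Longrightarrow> holomorphic_subset k E (\<lambda>z. \<psi>' z i)"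
  using assms unfolding biholomorphic_def by simp_all

lemma biholomorphic_id: "W \<subseteq> Cn N \<Longrightarrow> biholomorphic N W N W (\<lambda>z. z) (\<lambda>z. z)"
  by (simp add: biholomorphic_def holomorphic_subset_coordinate)

lemma biholomorphic_trans:
  assumes a: "biholomorphic N W M V \<alpha> \<alpha>'" and b: "biholomorphic M V k E \<beta> \<beta>'"
  shows "biholomorphic N W k E (\<lambda>w. \<beta> (\<alpha> w)) (\<lambda>z. \<alpha>' (\<beta>' z))"
  unfolding biholomorphic_def
proof (intro conjI ballI allI impI)
  note A = biholomorphicD[OF a] and B = biholomorphicD[OF b]
  show "W \<subseteq> Cn N" "E \<subseteq> Cn k" by (rule A B)+
  show "(\<lambda>w. \<beta> (\<alpha> w)) ` W \<subseteq> E" using A(3) B(3) by blast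
  show "(\<lambda>z. \<alpha>' (\<beta>' z)) ` E \<subseteq> W" using A(4) B(4) by blast
  show "\<alpha>' (\<beta>' (\<beta> (\<alpha> w))) = w" if "w \<in> W" for w using A(3,5) B(5) that by auto
  show "\<beta> (\<alpha> (\<alpha>' (\<beta>' z))) = z" if "z \<in> E" for z using A(6) B(4,6) that by auto
  show "holomorphic_subset N W (\<lambda>w. \<beta> (\<alpha> w) i)" if "i < k" for i
    by (rule holomorphic_subset_compose[OF B(7)[OF that] B(1) A(1,3,7)])
  show "holomorphic_subset k E (\<lambda>z. \<alpha>' (\<beta>' z) i)" if "i < N" for i
    by (rule holomorphic_subset_compose[OF A(8)[OF that] A(2) B(2,4,8)])
qed

lemma biholomorphic_continuous:
  assumes a: "biholomorphic N W k E \<psi> \<psi>'"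
  shows "continuous_on W \<psi>" "continuous_on E \<psi>'"
proof -
  note A = biholomorphicD[OF a]
  show "continuous_on W \<psi>"
    by (rule continuous_on_coordinates_Cn[of k, OF holomorphic_subset_continuous[OF A(1) A(7)]]) (use A(2,3) in auto)
  show "continuous_on E \<psi>'"
    by (rule continuous_on_coordinates_Cn[of N, OF holomorphic_subset_continuous[OF A(2) A(8)]]) (use A(1,4) in auto)
qed

section \<open>Regular points of analytic sets\<close>

text \<open>The set need not be described by its defining functions in an optimal way, so all functions on smaller open sets
  which vanish on it are taken into account. If one of them has a nonzero partial derivative at a point of the set, near
  this point the set is a graph over an analytic set in one dimension less. Otherwise the functions vanishing on the
  set near a point are closed under partial derivatives, hence they are zero near this point.\<close>

theorem analytic_set_regular_point:
  assumes D: "open_Cn N D" and F: "\<And>h. h \<in> F \<Longrightarrow> holomorphic_Cn N D h"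
    and ne: "{z\<in>D. \<forall>h\<in>F. h z = 0} \<noteq> {}"
  shows "\<exists>W k E \<psi> \<psi>'. W \<noteq> {} \<and> openin (top_of_set {z\<in>D. \<forall>h\<in>F. h z = 0}) W \<and>
    open_Cn k E \<and> biholomorphic N W k E \<psi> \<psi>'"
  using D F ne
proof (induction N arbitrary: D F rule: less_induct)
  case (less N)
  let ?Z = "{z\<in>D. \<forall>h\<in>F. h z = 0}"
  note D = less.prems(1) and F = less.prems(2)
  have ZC: "?Z \<subseteq> Cn N" using openin_Cn_subset[OF D] by blast
  show ?case
  proof (cases "\<exists>D' f p j. open_Cn N D' \<and> D' \<subseteq> D \<and> holomorphic_Cn N D' f \<and>
      (\<forall>z\<in>?Z \<inter> D'. f z = 0) \<and> p \<in> ?Z \<inter> D' \<and> j < N \<and> partial_deriv j f p \<noteq> 0")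
    case True
    then obtain D' f p j where D': "open_Cn N D'" "D' \<subseteq> D" and f: "holomorphic_Cn N D' f"
      and fZ0: "\<forall>z\<in>?Z \<inter> D'. f z = 0" and p0: "p \<in> ?Z \<inter> D'" and j: "j < N"
      and pd: "partial_deriv j f p \<noteq> 0" by (elim exE conjE)
    have fZ: "\<And>z. z \<in> ?Z \<Longrightarrow> z \<in> D' \<Longrightarrow> f z = 0" using fZ0 by blast
    have p: "p \<in> ?Z" "p \<in> D'" using p0 by simp_all
    obtain M where N: "N = Suc M" using j by (cases N) auto
    have jM: "j \<le> M" using j N by simp
    obtain \<rho> \<sigma> g where \<rho>: "\<rho> > 0" "\<sigma> > 0" and g: "holomorphic_Cn M (polydisc M (drop_coord j p) \<rho>) g"
      and gin: "\<And>w. w \<in> polydisc M (drop_coord j p) \<rho> \<Longrightarrow> cmod (g w - p j) < \<sigma>"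
      and giff: "\<And>w t. w \<in> polydisc M (drop_coord j p) \<rho> \<Longrightarrow> cmod (t - p j) < \<sigma> \<Longrightarrow>
        insert_coord j t w \<in> D' \<and> (f (insert_coord j t w) = 0 \<longleftrightarrow> t = g w)"
      using implicit_function[OF f[unfolded N] p(2) jM fZ[OF p] pd] by blast
    let ?E = "polydisc M (drop_coord j p) \<rho>"
    define G where "G w = insert_coord j (g w) w" for w
    have oE: "open_Cn M ?E" by (rule polydisc_openin)
    have GD: "G ` ?E \<subseteq> D" using giff[OF _ gin] D'(2) by (auto simp: G_def)
    have GC: "G ` ?E \<subseteq> Cn N" using GD openin_Cn_subset[OF D] by blast
    have hG: "holomorphic_Cn M ?E (\<lambda>w. G w i)" if "i < N" for i
      unfolding G_def by (rule holomorphic_Cn_insert_coord[OF oE g jM]) (use that N in simp)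
    let ?F' = "(\<lambda>h w. h (G w)) ` F"
    let ?Z' = "{w\<in>?E. \<forall>h\<in>?F'. h w = 0}"
    have F': "holomorphic_Cn M ?E h" if "h \<in> ?F'" for h
      using that holomorphic_Cn_compose[OF F oE hG GD] by blast
    have pC: "p \<in> Cn (Suc M)" using p(1) ZC N by blast
    have Zgraph: "z = G (drop_coord j z)" "drop_coord j z \<in> ?Z'"
      if z: "z \<in> ?Z" "drop_coord j z \<in> ?E" "cmod (z j - p j) < \<sigma>" for z
    proof -
      have "z \<in> D'" "f z = 0 \<longleftrightarrow> z j = g (drop_coord j z)" using giff[OF z(2,3)] by simp_all
      then have "z j = g (drop_coord j z)" using fZ[OF z(1)] by blast
      then have "G (drop_coord j z) = insert_coord j (z j) (drop_coord j z)" by (simp only: G_def)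
      then have eq: "G (drop_coord j z) = z" by (simp only: insert_drop)
      then show "z = G (drop_coord j z)" by (rule sym)
      show "drop_coord j z \<in> ?Z'" using z(1,2) by (simp add: eq)
    qed
    have G_Z: "G w \<in> ?Z" if "w \<in> ?Z'" for w using that GD by auto
    have "drop_coord j p \<in> ?E" by (rule polydisc_center[OF drop_coord_Cn[OF pC jM] \<rho>(1)])
    from Zgraph(2)[OF p(1) this] \<rho>(2) have "drop_coord j p \<in> ?Z'" by simp
    then have ne': "?Z' \<noteq> {}" by (rule ex_in_conv[THEN iffD1, OF exI])
    have MN: "M < N" using N by simp
    have "\<exists>W k E \<psi> \<psi>'. W \<noteq> {} \<and> openin (top_of_set ?Z') W \<and>
      open_Cn k E \<and> biholomorphic M W k E \<psi> \<psi>'"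
      by (rule less.IH[OF MN oE _ ne']) (rule F')
    then obtain W' k E' \<psi> \<psi>' where W': "W' \<noteq> {}" "openin (top_of_set ?Z') W'"
      and E': "open_Cn k E'" and b: "biholomorphic M W' k E' \<psi> \<psi>'"
      by (elim exE conjE)
    have W'Z: "W' \<subseteq> ?Z'" by (rule openin_imp_subset[OF W'(2)])
    obtain T where T: "open T" "W' = ?Z' \<inter> T" using W'(2) by (auto simp: openin_open)
    define V0 where "V0 = ?E \<inter> T"
    have oV0: "open_Cn M V0" unfolding V0_def by (rule openin_Int_open[OF oE T(1)])
    define U where "U = Cn N \<inter> drop_coord j -` V0 \<inter> {z. cmod (z j - p j) < \<sigma>}"
    have cd: "continuous_on (Cn N) (drop_coord j)"
    proof (rule continuous_on_coordinatewise_then_product)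
      show "continuous_on (Cn N) (\<lambda>x. drop_coord j x i)" for i
        unfolding drop_coord_def
        by (cases "i < j") (simp_all add: continuous_on_subset[OF continuous_on_product_coordinates subset_UNIV])
    qed
    have dC: "drop_coord j \<in> Cn N \<rightarrow> Cn M" using drop_coord_Cn[OF _ jM] N by blast
    have "open {z :: nat \<Rightarrow> complex. cmod (z j - p j) < \<sigma>}"
      by (intro open_Collect_less continuous_on_norm continuous_on_diff continuous_on_const continuous_on_product_coordinates)
    then have oU: "open_Cn N U"
      unfolding U_def by (intro openin_Int_open continuous_openin_preimage[OF cd dC oV0])
    define W where "W = G ` W'"
    have "W = ?Z \<inter> U"
    proof (intro equalityI subsetI)
      fix z assume "z \<in> W"
      then obtain w where w: "w \<in> W'" "z = G w" by (auto simp: W_def)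
      then have "w \<in> ?Z'" "w \<in> T" "w \<in> ?E" using T by auto
      then show "z \<in> ?Z \<inter> U"
        using G_Z[of w] gin[of w] ZC w by (auto simp: U_def V0_def G_def)
    next
      fix z assume z: "z \<in> ?Z \<inter> U"
      then have zz: "z \<in> ?Z" "drop_coord j z \<in> ?E" "cmod (z j - p j) < \<sigma>" "drop_coord j z \<in> T"
        by (auto simp: U_def V0_def)
      have "drop_coord j z \<in> W'" unfolding T(2) using Zgraph(2)[OF zz(1-3)] zz(4) by blast
      then show "z \<in> W" unfolding W_def using Zgraph(1)[OF zz(1-3)] by blast
    qed
    moreover have "openin (top_of_set ?Z) (?Z \<inter> U)"
    proof -
      obtain S where "open S" "U = Cn N \<inter> S" using oU by (auto simp: openin_open)
      then have "?Z \<inter> U = ?Z \<inter> S" using ZC by blast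
      then show ?thesis using \<open>open S\<close> by (simp add: openin_open_Int)
    qed
    ultimately have oW: "openin (top_of_set ?Z) W" by simp
    have W'E: "W' \<subseteq> ?E" using W'Z by blast
    have bW: "biholomorphic N W M W' (drop_coord j) G"
      unfolding biholomorphic_def
    proof (intro conjI ballI allI impI)
      show WC: "W \<subseteq> Cn N" using GC W'E by (auto simp: W_def)
      show "W' \<subseteq> Cn M" by (rule biholomorphicD(1)[OF b])
      show "drop_coord j ` W \<subseteq> W'" by (auto simp: W_def G_def)
      show "G ` W' \<subseteq> W" by (simp add: W_def)
      show "G (drop_coord j w) = w" if "w \<in> W" for w using that by (auto simp: W_def G_def)
      show "drop_coord j (G z) = z" for z by (simp add: G_def)
      show "holomorphic_subset N W (\<lambda>w. drop_coord j w i)" if "i < M" for i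
        using holomorphic_subset_coordinate[OF WC, of i] holomorphic_subset_coordinate[OF WC, of "Suc i"] that N
        by (cases "i < j") (simp_all add: drop_coord_def)
      show "holomorphic_subset M W' (\<lambda>z. G z i)" if "i < N" for i
        by (rule holomorphic_Cn_imp_subset[OF hG[OF that] W'E])
    qed
    have "W \<noteq> {}" using W'(1) by (simp add: W_def)
    then show ?thesis using oW E' biholomorphic_trans[OF bW b] by blast
  next
    case False
    obtain p where p: "p \<in> ?Z" using less.prems(3) by blast
    then have pC: "p \<in> Cn N" using ZC by blast
    obtain r where r: "r > 0" "polydisc N p r \<subseteq> D" using openin_Cn_polydisc[OF D] p by blast
    let ?P = "polydisc N p r"
    define \<C> where "\<C> = {f. holomorphic_Cn N ?P f \<and> (\<forall>z\<in>?Z \<inter> ?P. f z = 0)}"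
    have pP: "p \<in> ?P" by (rule polydisc_center[OF pC r(1)])
    have pd: "partial_deriv i f \<in> \<C>" if "f \<in> \<C>" "i < N" for f i
    proof -
      have "holomorphic_Cn N ?P f" "\<forall>z\<in>?Z \<inter> ?P. f z = 0" using that(1) by (simp_all add: \<C>_def)
      moreover have "partial_deriv i f z = 0" if "z \<in> ?Z \<inter> ?P" for z
      proof (rule ccontr)
        assume "partial_deriv i f z \<noteq> 0"
        then have "\<exists>D' f p j. open_Cn N D' \<and> D' \<subseteq> D \<and> holomorphic_Cn N D' f \<and>
          (\<forall>z\<in>?Z \<inter> D'. f z = 0) \<and> p \<in> ?Z \<inter> D' \<and> j < N \<and> partial_deriv j f p \<noteq> 0"
          using polydisc_openin r(2) calculation that \<open>i < N\<close>
          by (intro exI[of _ ?P] exI[of _ f] exI[of _ z] exI[of _ i] conjI)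
        then show False using False by (rule notE[rotated])
      qed
      ultimately show ?thesis by (simp add: \<C>_def holomorphic_Cn_partial_deriv \<open>i < N\<close>)
    qed
    have zero: "f p = 0" if "f \<in> \<C>" for f using that p pP unfolding \<C>_def by blast
    have PZ: "?P \<subseteq> ?Z"
    proof
      fix w assume w: "w \<in> ?P"
      have "h w = 0" if "h \<in> F" for h
      proof (rule vanishing_of_iterated_partials[where \<C>=\<C> and f=h])
        show "h \<in> \<C>" using holomorphic_Cn_subset[OF F[OF that] polydisc_openin r(2)] that by (auto simp: \<C>_def)
        show "holomorphic_Cn N ?P f" if "f \<in> \<C>" for f using that by (simp add: \<C>_def)
      qed (fact pC r(1) pd zero w)+
      then show "w \<in> ?Z" using w r(2) by blast
    qed
    have "openin (top_of_set ?Z) ?P" by (rule openin_subset_trans[OF polydisc_openin PZ ZC])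
    moreover have "biholomorphic N ?P N ?P (\<lambda>z. z) (\<lambda>z. z)" by (rule biholomorphic_id[OF polydisc_subset_Cn])
    moreover have "?P \<noteq> {}" using pP by blast
    ultimately show ?thesis using polydisc_openin by blast
  qed
qed

section \<open>Identity theorem on irreducible complex spaces\<close>

lemma holomorphic_subset_open:
  assumes g: "holomorphic_subset N W g" and W: "open_Cn N W"
  shows "holomorphic_Cn N W g"
proof (rule holomorphic_CnI_local[OF W])
  fix z assume z: "z \<in> W"
  then obtain D h where Dh: "z \<in> D" "holomorphic_Cn N D h" "\<forall>w\<in>D \<inter> W. g w = h w"
    using g unfolding holomorphic_subset_def by meson
  have o: "open_Cn N (D \<inter> W)" by (rule openin_Int[OF holomorphic_Cn_openin[OF Dh(2)] W])
  have zDW: "z \<in> D \<inter> W" using z Dh(1) by simp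
  have "holomorphic_Cn N (D \<inter> W) h" by (rule holomorphic_Cn_subset[OF Dh(2) o]) simp
  then obtain u where "caratheodory N (D \<inter> W) h z u" using zDW by (rule holomorphic_Cn_caratheodory)
  then have "caratheodory N (D \<inter> W) g z u" using Dh(3) zDW by (simp add: caratheodory_def)
  then show "\<exists>E u. z \<in> E \<and> open_Cn N E \<and> caratheodory N E g z u" using zDW o by blast
qed

text \<open>A line joining two points of a polydisc meets it in a convex set, so the one variable
  identity theorem applies.\<close>

lemma polydisc_identity:
  assumes g: "holomorphic_Cn N (polydisc N p r) g"
    and Q: "open_Cn N Q" "Q \<noteq> {}" "Q \<subseteq> polydisc N p r" "\<And>z. z \<in> Q \<Longrightarrow> g z = 0"
    and z: "z \<in> polydisc N p r"
  shows "g z = 0"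
proof -
  obtain w where w: "w \<in> Q" using Q(2) by blast
  define \<gamma> where "\<gamma> t = (\<lambda>i. w i + t * (z i - w i))" for t :: complex
  have wP: "w \<in> polydisc N p r" using w Q(3) by blast
  have \<gamma>C: "\<gamma> t \<in> Cn N" for t using wP z by (auto simp: \<gamma>_def polydisc_def Cn_def)
  define S where "S = {t. \<gamma> t \<in> polydisc N p r}"
  have S_eq: "S = {t. \<forall>i<N. cmod (w i - p i + t * (z i - w i)) < r}"
    unfolding S_def polydisc_def using \<gamma>C by (simp add: \<gamma>_def algebra_simps)
  have c\<gamma>: "continuous_on UNIV \<gamma>"
    by (rule continuous_on_coordinatewise_then_product) (auto simp: \<gamma>_def intro!: continuous_intros)
  have open_pre: "open {t. \<gamma> t \<in> V}" if V: "open_Cn N V" for V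
  proof -
    have "openin (top_of_set UNIV) (UNIV \<inter> \<gamma> -` V)"
      by (rule continuous_openin_preimage[OF c\<gamma> _ V]) (use \<gamma>C in auto)
    then show ?thesis by (simp add: vimage_def)
  qed
  have oS: "open S" unfolding S_def by (rule open_pre[OF polydisc_openin])
  have "convex S"
    unfolding convex_def S_eq
  proof (clarify)
    fix x y u v i assume x: "\<forall>i<N. cmod (w i - p i + x * (z i - w i)) < r"
      and y: "\<forall>i<N. cmod (w i - p i + y * (z i - w i)) < r"
      and uv: "0 \<le> (u::real)" "0 \<le> v" "u + v = 1" and i: "i < N"
    have v: "v = 1 - u" using uv by simp
    have "w i - p i + (u *\<^sub>R x + v *\<^sub>R y) * (z i - w i) =
      u *\<^sub>R (w i - p i + x * (z i - w i)) + v *\<^sub>R (w i - p i + y * (z i - w i))"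
      unfolding v by (simp add: scaleR_conv_of_real algebra_simps)
    then have "cmod (w i - p i + (u *\<^sub>R x + v *\<^sub>R y) * (z i - w i)) \<le>
      u * cmod (w i - p i + x * (z i - w i)) + v * cmod (w i - p i + y * (z i - w i))"
      using norm_triangle_ineq[of "u *\<^sub>R (w i - p i + x * (z i - w i))" "v *\<^sub>R (w i - p i + y * (z i - w i))"] uv
      by simp
    also have "\<dots> < r" by (rule convex_bound_lt) (use x y uv i in auto)
    finally show "cmod (w i - p i + (u *\<^sub>R x + v *\<^sub>R y) * (z i - w i)) < r" .
  qed
  then have conS: "connected S" by (rule convex_connected)
  define U where "U = {t. \<gamma> t \<in> Q}"
  have oU: "open U" unfolding U_def by (rule open_pre[OF Q(1)])
  have \<gamma>0: "\<gamma> 0 = w" and \<gamma>1: "\<gamma> 1 = z" by (simp_all add: \<gamma>_def)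
  have 0: "0 \<in> U" using w by (simp add: U_def \<gamma>0)
  have US: "U \<subseteq> S" using Q(3) by (auto simp: U_def S_def)
  have "(\<lambda>t. g (\<gamma> t)) holomorphic_on S"
  proof (rule holomorphic_Cn_curve[OF g oS])
    show "(\<lambda>t. \<gamma> t i) holomorphic_on S" for i unfolding \<gamma>_def by (intro holomorphic_intros)
  qed (auto simp: S_def)
  then have "g (\<gamma> 1) = 0"
  proof (rule analytic_continuation[where \<xi>=0 and U=U])
    show "0 islimpt U" using oU 0 by (simp add: open_imp_islimpt)
    show "g (\<gamma> t) = 0" if "t \<in> U" for t using that Q(4) by (simp add: U_def)
  qed (use oS conS US 0 z \<gamma>1 in \<open>auto simp: S_def\<close>)
  then show ?thesis by (simp add: \<gamma>1)
qed

lemma complex_chartD: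
  assumes "complex_chart X \<O> U N Z \<phi>"
  shows "openin X U" "Z \<subseteq> Cn N" "homeomorphic_map (subtopology X U) (top_of_set Z) \<phi>"
    "\<And>V f. openin X V \<Longrightarrow> V \<subseteq> U \<Longrightarrow> f \<in> \<O> V \<longleftrightarrow> holomorphic_subset N (\<phi> ` V) (f \<circ> inv_into U \<phi>)"
    "\<phi> ` U = Z" "inj_on \<phi> U"
    "\<And>V. V \<subseteq> U \<Longrightarrow> openin X V \<longleftrightarrow> openin (top_of_set Z) (\<phi> ` V)"
proof -
  show o: "openin X U" and "Z \<subseteq> Cn N" and h: "homeomorphic_map (subtopology X U) (top_of_set Z) \<phi>"
    and "\<And>V f. openin X V \<Longrightarrow> V \<subseteq> U \<Longrightarrow> f \<in> \<O> V \<longleftrightarrow> holomorphic_subset N (\<phi> ` V) (f \<circ> inv_into U \<phi>)"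
    using assms unfolding complex_chart_def by simp_all
  have top: "topspace (subtopology X U) = U" using openin_subset[OF o] by auto
  show "\<phi> ` U = Z" using homeomorphic_imp_surjective_map[OF h] top by simp
  show "inj_on \<phi> U" using homeomorphic_imp_injective_map[OF h] top by simp
  show "openin X V \<longleftrightarrow> openin (top_of_set Z) (\<phi> ` V)" if "V \<subseteq> U" for V
  proof -
    have "openin (top_of_set Z) (\<phi> ` V) \<longleftrightarrow> openin (subtopology X U) V"
      by (rule homeomorphic_map_openness[OF h]) (use that top in simp)
    then show ?thesis using that by (simp add: openin_open_subtopology[OF o])
  qed
qed

context reduced_complex_space
begin

lemma obtain_chart:
  assumes "x \<in> topspace X"
  obtains U N D and F :: "((nat \<Rightarrow> complex) \<Rightarrow> complex) set" and \<phi> where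
    "x \<in> U" "open_Cn N D" "\<forall>h\<in>F. holomorphic_Cn N D h"
    "complex_chart X \<O> U N {z\<in>D. \<forall>h\<in>F. h z = 0} \<phi>"
proof -
  from local_model[OF assms] obtain U N D \<phi> and F :: "((nat \<Rightarrow> complex) \<Rightarrow> complex) set" where *: "x \<in> U" "open_Cn N D"
    "\<forall>h\<in>F. holomorphic_Cn N D h" "complex_chart X \<O> U N {z\<in>D. \<forall>h\<in>F. h z = 0} \<phi>"
    by (elim exE conjE)
  show thesis by (rule that[OF *])
qed

lemma obtain_chart':
  assumes "x \<in> topspace X"
  obtains U N Z \<phi> where "x \<in> U" "complex_chart X \<O> U N Z \<phi>"
  by (rule obtain_chart[OF assms]) (rule that)

lemma section_const: "openin X V \<Longrightarrow> (\<lambda>_. c) \<in> \<O> V"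
proof (rule section_glue)
  fix x assume V: "openin X V" and x: "x \<in> V"
  then have "x \<in> topspace X" using openin_subset by blast
  then obtain U N Z \<phi> where ch: "x \<in> U" "complex_chart X \<O> U N Z \<phi>"
    by (rule obtain_chart')
  note C = complex_chartD[OF ch(2)]
  have o: "openin X (V \<inter> U)" by (rule openin_Int[OF V C(1)])
  have "holomorphic_subset N (\<phi> ` (V \<inter> U)) (\<lambda>_. c)"
    by (rule holomorphic_Cn_imp_subset[OF holomorphic_Cn_const[OF openin_subtopology_self]]) (use C(2,5) in blast)
  then have "(\<lambda>_. c) \<in> \<O> (V \<inter> U)" using C(4)[OF o, of "\<lambda>_. c"] by (simp add: o_def)
  then show "\<exists>W. openin X W \<and> x \<in> W \<and> W \<subseteq> V \<and> (\<lambda>_. c) \<in> \<O> W"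
    using o x ch(1) by (intro exI[of _ "V \<inter> U"]) simp
qed

lemma section_binop:
  assumes V: "openin X V" and f: "f \<in> \<O> V" and g: "g \<in> \<O> V"
    and op: "\<And>N D f g. holomorphic_Cn N D f \<Longrightarrow> holomorphic_Cn N D g \<Longrightarrow> holomorphic_Cn N D (\<lambda>z. c (f z) (g z))"
  shows "(\<lambda>x. c (f x) (g x)) \<in> \<O> V"
proof (rule section_glue[OF V])
  fix x assume x: "x \<in> V"
  then have "x \<in> topspace X" using openin_subset[OF V] by blast
  then obtain U N Z \<phi> where ch: "x \<in> U" "complex_chart X \<O> U N Z \<phi>"
    by (rule obtain_chart')
  note C = complex_chartD[OF ch(2)]
  have o: "openin X (V \<inter> U)" by (rule openin_Int[OF V C(1)])
  have res: "k \<in> \<O> V \<Longrightarrow> holomorphic_subset N (\<phi> ` (V \<inter> U)) (\<lambda>z. k (inv_into U \<phi> z))" for k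
    using section_restrict[OF V o _, of k] C(4)[OF o, of k] by (simp add: o_def)
  have "holomorphic_subset N (\<phi> ` (V \<inter> U)) (\<lambda>z. c (f (inv_into U \<phi> z)) (g (inv_into U \<phi> z)))"
    by (rule holomorphic_subset_binop[OF res[OF f] res[OF g] op])
  then have "(\<lambda>x. c (f x) (g x)) \<in> \<O> (V \<inter> U)" using C(4)[OF o, of "\<lambda>x. c (f x) (g x)"] by (simp add: o_def)
  then show "\<exists>W. openin X W \<and> x \<in> W \<and> W \<subseteq> V \<and> (\<lambda>x. c (f x) (g x)) \<in> \<O> W"
    using o x ch(1) by (intro exI[of _ "V \<inter> U"]) simp
qed

lemma section_add: "openin X V \<Longrightarrow> f \<in> \<O> V \<Longrightarrow> g \<in> \<O> V \<Longrightarrow> (\<lambda>x. f x + g x) \<in> \<O> V"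
  by (rule section_binop[where c="(+)"]) (simp_all add: holomorphic_Cn_add)

lemma section_mult: "openin X V \<Longrightarrow> f \<in> \<O> V \<Longrightarrow> g \<in> \<O> V \<Longrightarrow> (\<lambda>x. f x * g x) \<in> \<O> V"
  by (rule section_binop[where c="(*)"]) (simp_all add: holomorphic_Cn_mult)

lemma section_continuous:
  assumes f: "f \<in> \<O> (topspace X)"
  shows "continuous_map X euclidean f"
  unfolding continuous_map_def
proof (intro conjI allI impI)
  fix T :: "complex set" assume "openin euclidean T"
  then have T: "open T" by simp
  show "openin X {x \<in> topspace X. f x \<in> T}"
  proof (subst openin_subopen, intro ballI)
    fix x assume x: "x \<in> {x \<in> topspace X. f x \<in> T}"
    then have "x \<in> topspace X" by simp
    then obtain U N Z \<phi> where ch: "x \<in> U" "complex_chart X \<O> U N Z \<phi>"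
      by (rule obtain_chart')
    note C = complex_chartD[OF ch(2)]
    let ?g = "\<lambda>z. f (inv_into U \<phi> z)"
    have "f \<in> \<O> U" by (rule section_restrict[OF openin_topspace C(1) openin_subset[OF C(1)] f])
    then have "holomorphic_subset N Z ?g" using C(4)[OF C(1) order_refl, of f] C(5) by (simp add: o_def)
    then have "continuous_on Z ?g" by (rule holomorphic_subset_continuous[OF C(2)])
    then have o: "openin (top_of_set Z) (Z \<inter> ?g -` T)" by (rule continuous_openin_preimage_gen[OF _ T])
    let ?W = "{y\<in>U. f y \<in> T}"
    have "\<phi> ` ?W = Z \<inter> ?g -` T"
    proof (intro equalityI subsetI)
      fix z assume "z \<in> \<phi> ` ?W"
      then obtain y where "y \<in> U" "f y \<in> T" "z = \<phi> y" by blast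
      then show "z \<in> Z \<inter> ?g -` T" using C(5) by (auto simp: inv_into_f_f[OF C(6)])
    next
      fix z assume "z \<in> Z \<inter> ?g -` T"
      then obtain y where "y \<in> U" "z = \<phi> y" "f (inv_into U \<phi> z) \<in> T" using C(5) by auto
      then show "z \<in> \<phi> ` ?W" by (auto simp: inv_into_f_f[OF C(6)])
    qed
    then have "openin X ?W" using C(7)[of ?W] o by auto
    then show "\<exists>W. openin X W \<and> x \<in> W \<and> W \<subseteq> {x \<in> topspace X. f x \<in> T}"
      using x ch(1) openin_subset[OF C(1)] by (intro exI[of _ ?W]) auto
  qed
qed auto

text \<open>A chart followed by a biholomorphic map is a chart. This turns regular points of local models into smooth points.\<close>

lemma chart_compose_biholomorphic:
  assumes ch: "complex_chart X \<O> U N Z \<phi>" and W: "openin (top_of_set Z) W"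
    and b: "biholomorphic N W k E \<psi> \<psi>'"
  defines "U1 \<equiv> {y\<in>U. \<phi> y \<in> W}"
  shows "complex_chart X \<O> U1 k E (\<lambda>y. \<psi> (\<phi> y))" "openin X U1" "\<phi> ` U1 = W"
proof -
  note C = complex_chartD[OF ch] and B = biholomorphicD[OF b]
  have WZ: "W \<subseteq> Z" by (rule openin_imp_subset[OF W])
  show im: "\<phi> ` U1 = W" using WZ C(5) by (auto simp: U1_def)
  have U1U: "U1 \<subseteq> U" by (auto simp: U1_def)
  show o: "openin X U1" using C(7)[OF U1U] im W by simp
  have topU: "topspace (subtopology X U) = U" using openin_subset[OF C(1)] by auto
  have "homeomorphic_map (subtopology (subtopology X U) U1) (subtopology (top_of_set Z) W) \<phi>"
    by (rule homeomorphic_map_subtopologies[OF C(3)]) (use topU im U1U WZ in \<open>auto simp: Int_absorb1\<close>)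
  then have h1: "homeomorphic_map (subtopology X U1) (top_of_set W) \<phi>"
    using U1U WZ by (simp add: subtopology_subtopology Int_absorb1)
  have h2: "homeomorphic_map (top_of_set W) (top_of_set E) \<psi>"
    unfolding homeomorphic_map_maps homeomorphic_maps_def
  proof (intro exI[of _ \<psi>'] conjI ballI)
    show "continuous_map (top_of_set W) (top_of_set E) \<psi>"
      using biholomorphic_continuous(1)[OF b] B(3) by (simp add: image_subset_iff_funcset)
    show "continuous_map (top_of_set E) (top_of_set W) \<psi>'"
      using biholomorphic_continuous(2)[OF b] B(4) by (simp add: image_subset_iff_funcset)
    show "\<psi>' (\<psi> x) = x" if "x \<in> topspace (top_of_set W)" for x using B(5)[of x] that by simp
    show "\<psi> (\<psi>' y) = y" if "y \<in> topspace (top_of_set E)" for y using B(6)[of y] that by simp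
  qed
  have hm: "homeomorphic_map (subtopology X U1) (top_of_set E) (\<lambda>y. \<psi> (\<phi> y))"
    using homeomorphic_map_compose[OF h1 h2] by (simp add: o_def)
  have injc: "inj_on (\<lambda>y. \<psi> (\<phi> y)) U1"
  proof (rule inj_onI)
    fix x y assume xy: "x \<in> U1" "y \<in> U1" "\<psi> (\<phi> x) = \<psi> (\<phi> y)"
    have W: "\<phi> x \<in> W" "\<phi> y \<in> W" using xy(1,2) by (simp_all add: U1_def)
    have "\<phi> x = \<psi>' (\<psi> (\<phi> y))" using B(5)[OF W(1)] by (simp only: xy(3))
    then have "\<phi> x = \<phi> y" by (simp only: B(5)[OF W(2)])
    then show "x = y" by (rule inj_onD[OF C(6)]) (use xy(1,2) U1U in blast)+
  qed
  have sec: "f \<in> \<O> V \<longleftrightarrow> holomorphic_subset k ((\<lambda>y. \<psi> (\<phi> y)) ` V) (f \<circ> inv_into U1 (\<lambda>y. \<psi> (\<phi> y)))"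
    if V: "openin X V" "V \<subseteq> U1" for V f
  proof -
    let ?inv = "inv_into U1 (\<lambda>y. \<psi> (\<phi> y))"
    have VU: "V \<subseteq> U" using V U1U by blast
    have VW: "\<phi> ` V \<subseteq> W" using V im by blast
    have inv1: "?inv (\<psi> (\<phi> y)) = y" if "y \<in> V" for y
      using inv_into_f_f[OF injc, of y] that V by auto
    have inv2: "inv_into U \<phi> (\<phi> y) = y" if "y \<in> V" for y
      by (rule inv_into_f_f[OF C(6)]) (use that VU in blast)
    have psi': "\<psi>' (\<psi> (\<phi> y)) = \<phi> y" if "y \<in> V" for y
      by (rule B(5)) (use VW that in blast)
    have VC: "\<phi> ` V \<subseteq> Cn N" and VE: "(\<lambda>y. \<psi> (\<phi> y)) ` V \<subseteq> E" using VW B(1,3) by blast+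
    have VEC: "(\<lambda>y. \<psi> (\<phi> y)) ` V \<subseteq> Cn k" using VE B(2) by blast
    have "holomorphic_subset N (\<phi> ` V) (f \<circ> inv_into U \<phi>) \<longleftrightarrow>
      holomorphic_subset k ((\<lambda>y. \<psi> (\<phi> y)) ` V) (f \<circ> ?inv)"
    proof
      assume a: "holomorphic_subset N (\<phi> ` V) (f \<circ> inv_into U \<phi>)"
      have "holomorphic_subset k ((\<lambda>y. \<psi> (\<phi> y)) ` V) (\<lambda>z. (f \<circ> inv_into U \<phi>) (\<psi>' z))"
        by (rule holomorphic_subset_compose[OF a VC VEC])
          (use psi' holomorphic_subset_subset[OF B(8) VE] in auto)
      then show "holomorphic_subset k ((\<lambda>y. \<psi> (\<phi> y)) ` V) (f \<circ> ?inv)"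
        by (rule holomorphic_subset_cong) (use inv1 inv2 psi' in auto)
    next
      assume a: "holomorphic_subset k ((\<lambda>y. \<psi> (\<phi> y)) ` V) (f \<circ> ?inv)"
      have "holomorphic_subset N (\<phi> ` V) (\<lambda>z. (f \<circ> ?inv) (\<psi> z))"
        by (rule holomorphic_subset_compose[OF a VEC VC])
          (use holomorphic_subset_subset[OF B(7) VW] in auto)
      then show "holomorphic_subset N (\<phi> ` V) (f \<circ> inv_into U \<phi>)"
        by (rule holomorphic_subset_cong) (use inv1 inv2 in auto)
    qed
    then show ?thesis using C(4)[OF V(1) VU] by simp
  qed
  show "complex_chart X \<O> U1 k E (\<lambda>y. \<psi> (\<phi> y))"
    unfolding complex_chart_def using o B(2) hm sec by simp
qed

text \<open>A nonempty open subset of a local model is itself an analytic set, so it has a regular point.\<close>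

theorem smooth_points_dense:
  assumes V: "openin X V" "V \<noteq> {}"
  shows "V \<inter> smooth_points X \<O> \<noteq> {}"
proof -
  obtain x where x: "x \<in> V" using V by blast
  then have "x \<in> topspace X" using openin_subset[OF V(1)] by blast
  then obtain U N D \<phi> and F :: "((nat \<Rightarrow> complex) \<Rightarrow> complex) set" where xU: "x \<in> U" and D: "open_Cn N D"
    and F0: "\<forall>h\<in>F. holomorphic_Cn N D h"
    and ch: "complex_chart X \<O> U N {z\<in>D. \<forall>h\<in>F. h z = 0} \<phi>"
    by (rule obtain_chart)
  note C = complex_chartD[OF ch] and F = F0[rule_format]
  let ?Z = "{z\<in>D. \<forall>h\<in>F. h z = 0}"
  have "openin X (V \<inter> U)" by (rule openin_Int[OF V(1) C(1)])
  then have oVU: "openin (top_of_set ?Z) (\<phi> ` (V \<inter> U))" using C(7)[of "V \<inter> U"] by simp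
  then obtain T where T: "open T" "\<phi> ` (V \<inter> U) = ?Z \<inter> T" by (auto simp: openin_open)
  let ?D1 = "D \<inter> T" and ?Z1 = "{z\<in>D \<inter> T. \<forall>h\<in>F. h z = 0}"
  have D1: "open_Cn N ?D1" by (rule openin_Int_open[OF D T(1)])
  have F1: "holomorphic_Cn N ?D1 h" if "h \<in> F" for h by (rule holomorphic_Cn_subset[OF F[OF that] D1]) simp
  have Z1: "?Z1 = \<phi> ` (V \<inter> U)" unfolding T(2) by auto
  have ne: "?Z1 \<noteq> {}" unfolding Z1 using x xU by blast
  have "\<exists>W k E \<psi> \<psi>'. W \<noteq> {} \<and> openin (top_of_set ?Z1) W \<and>
    open_Cn k E \<and> biholomorphic N W k E \<psi> \<psi>'"
    by (rule analytic_set_regular_point[OF D1 _ ne]) (rule F1)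
  then obtain W k E \<psi> \<psi>' where W: "W \<noteq> {}" "openin (top_of_set ?Z1) W"
    and E: "open_Cn k E" and b: "biholomorphic N W k E \<psi> \<psi>'"
    by (elim exE conjE)
  have oW: "openin (top_of_set ?Z) W" using W(2) oVU unfolding Z1 by (rule openin_trans)
  note K = chart_compose_biholomorphic[OF ch oW b]
  obtain w where w: "w \<in> W" using W(1) by blast
  then have "w \<in> \<phi> ` (V \<inter> U)" using openin_imp_subset[OF W(2)] Z1 by blast
  then obtain y where y: "y \<in> V" "y \<in> U" "w = \<phi> y" by blast
  have "y \<in> topspace X" using y(1) openin_subset[OF V(1)] by blast
  moreover have "y \<in> {y\<in>U. \<phi> y \<in> W}" using y w by simp
  ultimately have "y \<in> smooth_points X \<O>"
    unfolding smooth_points_def mem_Collect_eq[of y]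
    by (intro conjI exI[of _ "{y\<in>U. \<phi> y \<in> W}"] exI[of _ k] exI[of _ E] exI[of _ "\<lambda>y. \<psi> (\<phi> y)"] K(1) E) simp_all
  then show ?thesis using y(1) by blast
qed

text \<open>The neighbourhood is the preimage of a polydisc under a chart of the manifold.\<close>

lemma smooth_point_identity:
  assumes x: "x \<in> smooth_points X \<O>" and f: "f \<in> \<O> (topspace X)"
  obtains U where "openin X U" "x \<in> U"
    "\<And>V. openin X V \<Longrightarrow> V \<subseteq> U \<Longrightarrow> V \<noteq> {} \<Longrightarrow> (\<And>y. y \<in> V \<Longrightarrow> f y = 0) \<Longrightarrow> (\<And>y. y \<in> U \<Longrightarrow> f y = 0)"
proof -
  obtain U k D \<phi> where xU: "x \<in> U" and D: "open_Cn k D" and ch: "complex_chart X \<O> U k D \<phi>"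
    using x unfolding smooth_points_def by blast
  note C = complex_chartD[OF ch]
  have "\<phi> x \<in> D" using xU C(5) by blast
  then obtain r where r: "r > 0" "polydisc k (\<phi> x) r \<subseteq> D" using openin_Cn_polydisc[OF D] by blast
  let ?P = "polydisc k (\<phi> x) r" and ?g = "\<lambda>z. f (inv_into U \<phi> z)"
  have xC: "\<phi> x \<in> Cn k" using \<open>\<phi> x \<in> D\<close> C(2) by blast
  define U' where "U' = {y\<in>U. \<phi> y \<in> ?P}"
  have U'U: "U' \<subseteq> U" by (auto simp: U'_def)
  have im: "\<phi> ` U' = ?P" using r(2) C(5) by (auto simp: U'_def)
  have PD: "openin (top_of_set D) ?P" by (rule openin_subset_trans[OF polydisc_openin r(2) C(2)])
  have oU': "openin X U'" using C(7)[OF U'U] im PD by simp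
  have "f \<in> \<O> U'" by (rule section_restrict[OF openin_topspace oU' openin_subset[OF oU'] f])
  then have "holomorphic_subset k ?P ?g" using C(4)[OF oU' U'U, of f] im by (simp add: o_def)
  then have g: "holomorphic_Cn k ?P ?g" by (rule holomorphic_subset_open[OF _ polydisc_openin])
  show thesis
  proof (rule that[OF oU'])
    show "x \<in> U'" using xU polydisc_center[OF xC r(1)] by (simp add: U'_def)
    fix V y assume V: "openin X V" "V \<subseteq> U'" "V \<noteq> {}" and fV: "\<And>y. y \<in> V \<Longrightarrow> f y = 0" and y: "y \<in> U'"
    have VU: "V \<subseteq> U" using V U'U by blast
    have "openin (top_of_set D) (\<phi> ` V)" using C(7)[OF VU] V(1) by simp
    then have oQ: "open_Cn k (\<phi> ` V)" using D by (rule openin_trans)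
    have "?g (\<phi> y) = 0"
    proof (rule polydisc_identity[OF g oQ])
      show "\<phi> ` V \<noteq> {}" using V(3) by simp
      show "\<phi> ` V \<subseteq> ?P" using V(2) im by blast
      show "\<phi> y \<in> ?P" using y by (simp add: U'_def)
      fix z assume "z \<in> \<phi> ` V"
      then obtain v where v: "v \<in> V" "z = \<phi> v" by blast
      then have "inv_into U \<phi> z = v" using inv_into_f_f[OF C(6), of v] VU by auto
      then show "?g z = 0" using fV[OF v(1)] by simp
    qed
    moreover have "inv_into U \<phi> (\<phi> y) = y" by (rule inv_into_f_f[OF C(6)]) (use y U'U in blast)
    ultimately show "f y = 0" by simp
  qed
qed

text \<open>The interior of the zero set is open and closed relative to the connected set of smooth points; by density and
  continuity the function then vanishes everywhere.\<close>

theorem identity_theorem: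
  assumes irr: "irreducible_complex_space X \<O>" and f: "f \<in> \<O> (topspace X)"
    and U0: "openin X U0" "U0 \<noteq> {}" "\<And>x. x \<in> U0 \<Longrightarrow> f x = 0" and x: "x \<in> topspace X"
  shows "f x = 0"
proof -
  let ?S = "smooth_points X \<O>"
  have con: "connectedin X ?S" using irr by (simp add: irreducible_complex_space_def)
  define T1 where "T1 = \<Union>{V. openin X V \<and> (\<forall>y\<in>V. f y = 0)}"
  define T2 where "T2 = \<Union>{V. openin X V \<and> V \<inter> T1 = {}}"
  have o1: "openin X T1" unfolding T1_def by (rule openin_Union) auto
  have o2: "openin X T2" unfolding T2_def by (rule openin_Union) auto
  have f1: "f y = 0" if "y \<in> T1" for y using that by (auto simp: T1_def)
  have cover: "?S \<subseteq> T1 \<union> T2"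
  proof
    fix s assume s: "s \<in> ?S"
    obtain U where U: "openin X U" "s \<in> U"
      "\<And>V y. openin X V \<Longrightarrow> V \<subseteq> U \<Longrightarrow> V \<noteq> {} \<Longrightarrow> (\<And>y. y \<in> V \<Longrightarrow> f y = 0) \<Longrightarrow> y \<in> U \<Longrightarrow> f y = 0"
      using smooth_point_identity[OF s f] by metis
    show "s \<in> T1 \<union> T2"
    proof (cases "U \<inter> T1 = {}")
      case True
      then show ?thesis using U(1,2) by (auto simp: T2_def)
    next
      case False
      have "f y = 0" if "y \<in> U" for y
        by (rule U(3)[OF openin_Int[OF U(1) o1] _ False _ that]) (use f1 in auto)
      then show ?thesis using U(1,2) by (auto simp: T1_def)
    qed
  qed
  have disj: "T1 \<inter> T2 \<inter> ?S = {}" by (auto simp: T2_def)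
  have "U0 \<subseteq> T1" using U0 by (auto simp: T1_def)
  then have "T1 \<inter> ?S \<noteq> {}" using smooth_points_dense[OF U0(1,2)] by blast
  then have "T2 \<inter> ?S = {}" using connectedinD[OF con o1 o2 cover disj] by blast
  then have S1: "?S \<subseteq> T1" using cover by blast
  have oN: "openin X {y\<in>topspace X. f y \<in> - {0}}"
    by (rule openin_continuous_map_preimage[OF section_continuous[OF f]]) (simp add: open_Compl)
  show ?thesis
  proof (rule ccontr)
    assume "f x \<noteq> 0"
    then have "x \<in> {y\<in>topspace X. f y \<in> - {0}}" using x by simp
    then have "{y\<in>topspace X. f y \<in> - {0}} \<inter> ?S \<noteq> {}" using smooth_points_dense[OF oN] by blast
    then show False using S1 f1 by blast
  qed
qed

end

section \<open>The Blaschke condition\<close>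

definition blaschke_factor :: "complex \<Rightarrow> complex \<Rightarrow> complex" where
  "blaschke_factor a z = (z - a) / (1 - cnj a * z)"

lemma blaschke_denominator:
  assumes "cmod a < 1" "cmod z < 1"
  shows "1 - cnj a * z \<noteq> 0"
proof
  assume "1 - cnj a * z = 0"
  then have "cmod (cnj a * z) = 1" by (metis eq_iff_diff_eq_0 norm_one)
  then have "cmod a * cmod z = 1" by (simp add: norm_mult)
  moreover have "cmod a * cmod z < 1 * 1" by (rule mult_strict_mono') (use assms in auto)
  ultimately show False by simp
qed

lemma blaschke_factor_norm_sq:
  assumes "cmod a < 1" "cmod z < 1"
  shows "1 - (cmod (blaschke_factor a z))\<^sup>2 = (1 - (cmod a)\<^sup>2) * (1 - (cmod z)\<^sup>2) / (cmod (1 - cnj a * z))\<^sup>2"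
proof -
  have d: "cmod (1 - cnj a * z) \<noteq> 0" using blaschke_denominator[OF assms] by simp
  have "complex_of_real ((cmod (1 - cnj a * z))\<^sup>2 - (cmod (z - a))\<^sup>2) =
      complex_of_real ((1 - (cmod a)\<^sup>2) * (1 - (cmod z)\<^sup>2))"
    by (simp only: of_real_diff of_real_mult of_real_1 complex_norm_square complex_cnj_diff complex_cnj_mult
        complex_cnj_cnj complex_cnj_one) (simp add: algebra_simps)
  then have "(cmod (1 - cnj a * z))\<^sup>2 - (cmod (z - a))\<^sup>2 = (1 - (cmod a)\<^sup>2) * (1 - (cmod z)\<^sup>2)"
    using of_real_eq_iff by blast
  then show ?thesis
    using d by (simp add: blaschke_factor_def norm_divide power_divide field_simps)
qed

lemma blaschke_factor_less_1:
  assumes "cmod a < 1" "cmod z < 1"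
  shows "cmod (blaschke_factor a z) < 1"
proof -
  have "(cmod a)\<^sup>2 < 1" "(cmod z)\<^sup>2 < 1" using assms by (simp_all add: power_less_one_iff)
  moreover have "cmod (1 - cnj a * z) > 0" using blaschke_denominator[OF assms] by simp
  ultimately have "1 - (cmod (blaschke_factor a z))\<^sup>2 > 0"
    unfolding blaschke_factor_norm_sq[OF assms] by simp
  then show ?thesis by (simp add: abs_square_less_1)
qed

lemma blaschke_factor_holomorphic:
  assumes "cmod a < 1"
  shows "blaschke_factor a holomorphic_on ball 0 1"
  unfolding blaschke_factor_def by (intro holomorphic_intros) (use blaschke_denominator[OF assms] in auto)

lemma blaschke_factor_inverse:
  assumes "cmod a < 1" "cmod z < 1"
  shows "blaschke_factor (- a) (blaschke_factor a z) = z"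
proof -
  have d: "1 - cnj a * z \<noteq> 0" by (rule blaschke_denominator[OF assms])
  have e: "1 - cnj a * a \<noteq> 0" by (rule blaschke_denominator) (use assms in auto)
  have "blaschke_factor (- a) (blaschke_factor a z) =
    ((z - a) / (1 - cnj a * z) + a) / (1 + cnj a * ((z - a) / (1 - cnj a * z)))"
    by (simp add: blaschke_factor_def)
  also have "(z - a) / (1 - cnj a * z) + a = z * (1 - cnj a * a) / (1 - cnj a * z)"
    using d by (simp add: field_simps)
  also have "1 + cnj a * ((z - a) / (1 - cnj a * z)) = (1 - cnj a * a) / (1 - cnj a * z)"
    using d by (simp add: field_simps)
  finally show ?thesis using d e by simp
qed

text \<open>The Schwarz lemma, moved to the point \<open>a\<close> by the automorphism \<open>blaschke_factor a\<close> of the disc. The \<open>e\<close> in the proof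
  provides the strict bound which the Schwarz lemma asks for.\<close>

lemma bounded_by_blaschke_factor:
  assumes f: "f holomorphic_on ball 0 1" and M: "\<And>z. cmod z < 1 \<Longrightarrow> cmod (f z) \<le> M"
    and a: "cmod a < 1" "f a = 0" and z: "cmod z < 1"
  shows "cmod (f z) \<le> M * cmod (blaschke_factor a z)"
proof (rule field_le_epsilon)
  fix e :: real assume e: "e > 0"
  have M0: "M \<ge> 0" using M[OF z] norm_ge_zero order_trans by blast
  define C where "C = M + e"
  have C: "C > 0" using M0 e by (simp add: C_def)
  have a': "cmod (- a) < 1" using a by simp
  let ?h = "\<lambda>w. f (blaschke_factor (- a) w) / of_real C"
  let ?w = "blaschke_factor a z"
  have w: "cmod ?w < 1" by (rule blaschke_factor_less_1[OF a(1) z])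
  have "(f \<circ> blaschke_factor (- a)) holomorphic_on ball 0 1"
    by (rule holomorphic_on_compose_gen[OF blaschke_factor_holomorphic[OF a'] f])
      (use blaschke_factor_less_1[OF a'] in auto)
  then have "?h holomorphic_on ball 0 1"
    using C by (intro holomorphic_intros) (auto simp: o_def)
  moreover have "cmod (?h w) < 1" if "cmod w < 1" for w
  proof -
    have "cmod (f (blaschke_factor (- a) w)) < C"
      using M[OF blaschke_factor_less_1[OF a' that]] e by (simp add: C_def)
    then show ?thesis using C by (simp add: norm_divide)
  qed
  moreover have "?h 0 = 0" using a by (simp add: blaschke_factor_def)
  ultimately have "cmod (?h ?w) \<le> cmod ?w" using Schwarz_Lemma(1)[of ?h ?w] w by blast
  then have "cmod (f z) \<le> C * cmod ?w"
    using C by (simp add: blaschke_factor_inverse[OF a(1) z] norm_divide field_simps)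
  also have "\<dots> \<le> M * cmod ?w + e"
    using w e by (simp add: C_def algebra_simps mult_left_le)
  finally show "cmod (f z) \<le> M * cmod ?w + e" .
qed

text \<open>Dividing by a Blaschke factor at a zero does not increase the bound, so the zeros can be divided out one by one.\<close>

lemma bounded_by_blaschke_product:
  assumes "finite S" and "f holomorphic_on ball 0 1" and "\<And>z. cmod z < 1 \<Longrightarrow> cmod (f z) \<le> M"
    and "\<And>a. a \<in> S \<Longrightarrow> cmod a < 1 \<and> f a = 0" and "cmod z < 1"
  shows "cmod (f z) \<le> M * (\<Prod>a\<in>S. cmod (blaschke_factor a z))"
  using assms
proof (induction S arbitrary: f z rule: finite_induct)
  case empty
  then show ?case by simp
next
  case (insert a S)
  have a: "cmod a < 1" "f a = 0" using insert.prems(3) by auto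
  note f = insert.prems(1)
  define k where "k z = (if z = a then deriv f a else (f z - f a) / (z - a))" for z
  have k: "k holomorphic_on ball 0 1"
    unfolding k_def by (rule pole_lemma_open[OF f open_ball])
  define g where "g z = k z * (1 - cnj a * z)" for z
  have g: "g holomorphic_on ball 0 1" unfolding g_def by (intro holomorphic_intros k)
  have fg: "f z = g z * blaschke_factor a z" if "cmod z < 1" for z
    using a blaschke_denominator[OF a(1) that]
    by (auto simp: g_def k_def blaschke_factor_def)
  have bf0: "blaschke_factor a z \<noteq> 0" if "cmod z < 1" "z \<noteq> a" for z
    using that blaschke_denominator[OF a(1) that(1)] by (simp add: blaschke_factor_def)
  have g1: "cmod (g z) \<le> M" if "cmod z < 1" "z \<noteq> a" for z
    using bounded_by_blaschke_factor[OF f insert.prems(2) a that(1)] bf0[OF that]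
    unfolding fg[OF that(1)] norm_mult by simp
  have "cmod (g a) \<le> M"
  proof (rule Lim_norm_ubound[of "at a" g])
    have "continuous_on (ball 0 1) g" by (rule holomorphic_on_imp_continuous_on[OF g])
    then have "isCont g a" using a by (simp add: continuous_on_eq_continuous_at)
    then show "(g \<longlongrightarrow> g a) (at a)" by (simp add: isCont_def)
    have "\<forall>\<^sub>F z in at a. z \<in> ball 0 1" by (rule eventually_at_in_open') (use a in auto)
    then show "\<forall>\<^sub>F z in at a. cmod (g z) \<le> M"
      using eventually_neq_at_within[of a a UNIV] by eventually_elim (use g1 in auto)
  qed simp
  then have gM: "cmod (g z) \<le> M" if "cmod z < 1" for z using g1 that by (cases "z = a") auto
  have gS: "cmod b < 1 \<and> g b = 0" if "b \<in> S" for b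
  proof -
    have b: "cmod b < 1" "f b = 0" "b \<noteq> a" using insert.prems(3)[of b] that insert.hyps by auto
    then show ?thesis using fg[OF b(1)] bf0[OF b(1,3)] by simp
  qed
  have "cmod (f z) = cmod (g z) * cmod (blaschke_factor a z)" using fg[OF insert.prems(4)] by (simp add: norm_mult)
  also have "\<dots> \<le> M * (\<Prod>b\<in>S. cmod (blaschke_factor b z)) * cmod (blaschke_factor a z)"
    by (rule mult_right_mono[OF insert.IH[OF g gM gS insert.prems(4)] norm_ge_zero])
  finally show ?case using insert.hyps by (simp add: mult_ac)
qed

text \<open>Evaluating at a point \<open>z0\<close> which is not a zero bounds the products of Blaschke factors from below, uniformly
  in the finite set of zeros; \<open>x \<le> exp (x - 1)\<close> turns the product into a sum. Using an arbitrary \<open>z0\<close>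
  avoids dividing out a zero at the origin.\<close>

theorem blaschke_condition:
  assumes f: "f holomorphic_on ball 0 1" and b: "bounded (f ` ball 0 1)"
    and z0: "z0 \<in> ball 0 1" "f z0 \<noteq> 0"
  shows "(\<lambda>z. 1 - cmod z) summable_on {z\<in>ball 0 1. f z = 0}"
proof (rule nonneg_bdd_above_summable_on)
  obtain M where "\<forall>z\<in>ball 0 1. cmod (f z) \<le> M" using b unfolding bounded_iff by auto
  then have M: "\<And>z. cmod z < 1 \<Longrightarrow> cmod (f z) \<le> M" by simp
  have z1: "cmod z0 < 1" using z0 by simp
  have fz0: "cmod (f z0) > 0" using z0 by simp
  have M0: "M > 0" using M[OF z1] fz0 by linarith
  have z2: "1 - (cmod z0)\<^sup>2 > 0" using z1 by (simp add: power_less_one_iff)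
  define K where "K = 8 / (1 - (cmod z0)\<^sup>2) * ln (M / cmod (f z0))"
  show "bdd_above (sum (\<lambda>z. 1 - cmod z) ` {F. F \<subseteq> {z \<in> ball 0 1. f z = 0} \<and> finite F})"
  proof (rule bdd_aboveI2)
    fix S assume "S \<in> {F. F \<subseteq> {z \<in> ball 0 1. f z = 0} \<and> finite F}"
    then have S: "finite S" "\<And>a. a \<in> S \<Longrightarrow> cmod a < 1 \<and> f a = 0" by auto
    let ?x = "\<lambda>a. cmod (blaschke_factor a z0)"
    have "cmod (f z0) \<le> M * (\<Prod>a\<in>S. ?x a)" by (rule bounded_by_blaschke_product[OF S(1) f M S(2) z1])
    also have "(\<Prod>a\<in>S. ?x a) \<le> (\<Prod>a\<in>S. exp (?x a - 1))"
      by (rule prod_mono) (use exp_ge_add_one_self[of "?x _ - 1"] in auto)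
    also have "\<dots> = exp (- (\<Sum>a\<in>S. 1 - ?x a))"
      using S(1) by (simp add: exp_sum[symmetric] sum_negf[symmetric])
    finally have "cmod (f z0) \<le> M * exp (- (\<Sum>a\<in>S. 1 - ?x a))" using M0 by simp
    then have "exp (\<Sum>a\<in>S. 1 - ?x a) \<le> M / cmod (f z0)"
      using fz0 by (simp add: exp_minus field_simps)
    then have le: "(\<Sum>a\<in>S. 1 - ?x a) \<le> ln (M / cmod (f z0))"
      using M0 fz0 by (simp add: ln_ge_iff)
    have "(1 - (cmod z0)\<^sup>2) / 8 * (1 - cmod a) \<le> 1 - ?x a" if a: "a \<in> S" for a
    proof -
      have a1: "cmod a < 1" using S(2)[OF a] by simp
      have x: "0 \<le> ?x a" "?x a < 1" using blaschke_factor_less_1[OF a1 z1] by auto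
      have d: "0 < cmod (1 - cnj a * z0)" using blaschke_denominator[OF a1 z1] by simp
      have "cmod (cnj a * z0) \<le> 1 * 1" unfolding norm_mult by (rule mult_mono) (use a1 z1 in auto)
      then have "cmod (1 - cnj a * z0) \<le> 2"
        using norm_triangle_ineq4[of 1 "cnj a * z0"] by simp
      then have d2: "(cmod (1 - cnj a * z0))\<^sup>2 \<le> 4" using power_mono[of "cmod (1 - cnj a * z0)" 2 2] by simp
      have "1 - cmod a \<le> 1 - (cmod a)\<^sup>2" using a1 by (simp add: power2_eq_square mult_left_le)
      then have "(1 - (cmod z0)\<^sup>2) / 4 * (1 - cmod a) \<le> (1 - (cmod z0)\<^sup>2) / 4 * (1 - (cmod a)\<^sup>2)"
        using z2 by (intro mult_left_mono) auto
      also have "\<dots> = (1 - (cmod a)\<^sup>2) * (1 - (cmod z0)\<^sup>2) / 4" by simp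
      also have "\<dots> \<le> (1 - (cmod a)\<^sup>2) * (1 - (cmod z0)\<^sup>2) / (cmod (1 - cnj a * z0))\<^sup>2"
        using d d2 z2 a1 by (intro divide_left_mono mult_nonneg_nonneg) (auto simp: power_le_one)
      also have "\<dots> = 1 - (?x a)\<^sup>2" by (rule blaschke_factor_norm_sq[OF a1 z1, symmetric])
      also have "\<dots> = (1 - ?x a) * (1 + ?x a)" by (simp add: power2_eq_square algebra_simps)
      also have "\<dots> \<le> (1 - ?x a) * 2" using x by (intro mult_left_mono) auto
      finally show ?thesis by simp
    qed
    then have "(\<Sum>a\<in>S. (1 - (cmod z0)\<^sup>2) / 8 * (1 - cmod a)) \<le> (\<Sum>a\<in>S. 1 - ?x a)"
      by (rule sum_mono)
    then have "(1 - (cmod z0)\<^sup>2) / 8 * (\<Sum>a\<in>S. 1 - cmod a) \<le> ln (M / cmod (f z0))"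
      using le by (simp add: sum_distrib_left)
    then show "(\<Sum>a\<in>S. 1 - cmod a) \<le> K" using z2 by (simp add: K_def field_simps)
  qed
qed auto

section \<open>Polynomials\<close>

lemma holomorphic_Cn_power: 
  assumes "holomorphic_Cn N D f"
  shows "holomorphic_Cn N D (\<lambda>z. f z ^ m)"
  by (induction m) (simp_all add: holomorphic_Cn_const holomorphic_Cn_mult holomorphic_Cn_openin[OF assms] assms)

lemma holomorphic_Cn_prod:
  assumes "open_Cn N D" "\<And>i. i \<in> I \<Longrightarrow> holomorphic_Cn N D (f i)"
  shows "holomorphic_Cn N D (\<lambda>z. \<Prod>i\<in>I. f i z)"
  using assms(2)
  by (induction I rule: infinite_finite_induct) (simp_all add: holomorphic_Cn_const holomorphic_Cn_mult assms(1))

lemma holomorphic_Cn_sum: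
  assumes "open_Cn N D" "\<And>i. i \<in> I \<Longrightarrow> holomorphic_Cn N D (f i)"
  shows "holomorphic_Cn N D (\<lambda>z. \<Sum>i\<in>I. f i z)"
  using assms(2)
  by (induction I rule: infinite_finite_induct) (simp_all add: holomorphic_Cn_const holomorphic_Cn_add assms(1))

lemma polynomial_Cn_holomorphic:
  assumes "polynomial_Cn N p"
  shows "holomorphic_Cn N (Cn N) p"
proof -
  obtain S and c :: "(nat \<Rightarrow> nat) \<Rightarrow> complex" where S: "finite S"
    "\<And>z. z \<in> Cn N \<Longrightarrow> p z = (\<Sum>\<alpha>\<in>S. c \<alpha> * (\<Prod>i<N. z i ^ \<alpha> i))"
    using assms unfolding polynomial_Cn_def by metis
  have o: "open_Cn N (Cn N)" by simp
  have "holomorphic_Cn N (Cn N) (\<lambda>z. \<Sum>\<alpha>\<in>S. c \<alpha> * (\<Prod>i<N. z i ^ \<alpha> i))"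
    by (intro holomorphic_Cn_sum holomorphic_Cn_mult holomorphic_Cn_const holomorphic_Cn_prod
        holomorphic_Cn_power holomorphic_Cn_coordinate o) simp
  then have "holomorphic_subset N (Cn N) (\<lambda>z. \<Sum>\<alpha>\<in>S. c \<alpha> * (\<Prod>i<N. z i ^ \<alpha> i))"
    by (rule holomorphic_Cn_imp_subset) simp
  then have "holomorphic_subset N (Cn N) p" by (rule holomorphic_subset_cong) (rule S(2))
  then show ?thesis by (rule holomorphic_subset_open[OF _ o])
qed

lemma polynomial_Cn_const: "polynomial_Cn N (\<lambda>_. c)"
  unfolding polynomial_Cn_def
  by (rule exI[of _ "{\<lambda>_. 0}"], rule exI[of _ "\<lambda>_. c"]) simp

lemma polynomial_Cn_add:
  assumes "polynomial_Cn N p" "polynomial_Cn N q"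
  shows "polynomial_Cn N (\<lambda>z. p z + q z)"
proof -
  obtain S and c :: "(nat \<Rightarrow> nat) \<Rightarrow> complex" where S: "finite S"
    "\<And>z. z \<in> Cn N \<Longrightarrow> p z = (\<Sum>\<alpha>\<in>S. c \<alpha> * (\<Prod>i<N. z i ^ \<alpha> i))"
    using assms(1) unfolding polynomial_Cn_def by metis
  obtain T and d :: "(nat \<Rightarrow> nat) \<Rightarrow> complex" where T: "finite T"
    "\<And>z. z \<in> Cn N \<Longrightarrow> q z = (\<Sum>\<alpha>\<in>T. d \<alpha> * (\<Prod>i<N. z i ^ \<alpha> i))"
    using assms(2) unfolding polynomial_Cn_def by metis
  let ?e = "\<lambda>\<alpha>. (if \<alpha> \<in> S then c \<alpha> else 0) + (if \<alpha> \<in> T then d \<alpha> else 0)"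
  have "p z + q z = (\<Sum>\<alpha>\<in>S \<union> T. ?e \<alpha> * (\<Prod>i<N. z i ^ \<alpha> i))" if "z \<in> Cn N" for z
  proof -
    have "(\<Sum>\<alpha>\<in>S. c \<alpha> * (\<Prod>i<N. z i ^ \<alpha> i)) = (\<Sum>\<alpha>\<in>S \<union> T. (if \<alpha> \<in> S then c \<alpha> else 0) * (\<Prod>i<N. z i ^ \<alpha> i))"
      by (rule sum.mono_neutral_cong_left) (use S T in auto)
    moreover have "(\<Sum>\<alpha>\<in>T. d \<alpha> * (\<Prod>i<N. z i ^ \<alpha> i)) = (\<Sum>\<alpha>\<in>S \<union> T. (if \<alpha> \<in> T then d \<alpha> else 0) * (\<Prod>i<N. z i ^ \<alpha> i))"
      by (rule sum.mono_neutral_cong_left) (use S T in auto)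
    ultimately show ?thesis
      unfolding S(2)[OF that] T(2)[OF that] by (simp only: sum.distrib distrib_right)
  qed
  then show ?thesis
    unfolding polynomial_Cn_def by (intro exI[of _ "S \<union> T"] exI[of _ ?e]) (use S T in simp)
qed

lemma polynomial_Cn_sum:
  assumes "\<And>i. i \<in> I \<Longrightarrow> polynomial_Cn N (f i)"
  shows "polynomial_Cn N (\<lambda>z. \<Sum>i\<in>I. f i z)"
  using assms
  by (induction I rule: infinite_finite_induct) (simp_all add: polynomial_Cn_const polynomial_Cn_add)

text \<open>The exponents \<open>\<alpha>\<close> and \<open>\<beta>\<close> are arbitrary from the index \<open>N\<close> on, so different exponents may stand for the same monomial;
  products are therefore treated as sums of single monomials instead of collecting coefficients.\<close>

lemma polynomial_Cn_monomial_mult: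
  "polynomial_Cn N (\<lambda>z. (c * (\<Prod>i<N. z i ^ \<alpha> i)) * (d * (\<Prod>i<N. z i ^ \<beta> i)))"
  unfolding polynomial_Cn_def
  by (rule exI[of _ "{\<lambda>i. \<alpha> i + \<beta> i}"], rule exI[of _ "\<lambda>_. c * d"])
    (simp add: power_add prod.distrib mult_ac)

lemma polynomial_Cn_cong:
  assumes "polynomial_Cn N p" "\<And>z. z \<in> Cn N \<Longrightarrow> q z = p z"
  shows "polynomial_Cn N q"
  using assms unfolding polynomial_Cn_def by simp

lemma polynomial_Cn_mult:
  assumes "polynomial_Cn N p" "polynomial_Cn N q"
  shows "polynomial_Cn N (\<lambda>z. p z * q z)"
proof -
  obtain S and c :: "(nat \<Rightarrow> nat) \<Rightarrow> complex" where S: "finite S"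
    "\<And>z. z \<in> Cn N \<Longrightarrow> p z = (\<Sum>\<alpha>\<in>S. c \<alpha> * (\<Prod>i<N. z i ^ \<alpha> i))"
    using assms(1) unfolding polynomial_Cn_def by metis
  obtain T and d :: "(nat \<Rightarrow> nat) \<Rightarrow> complex" where T: "finite T"
    "\<And>z. z \<in> Cn N \<Longrightarrow> q z = (\<Sum>\<alpha>\<in>T. d \<alpha> * (\<Prod>i<N. z i ^ \<alpha> i))"
    using assms(2) unfolding polynomial_Cn_def by metis
  have "polynomial_Cn N (\<lambda>z. \<Sum>\<alpha>\<in>S. \<Sum>\<beta>\<in>T. (c \<alpha> * (\<Prod>i<N. z i ^ \<alpha> i)) * (d \<beta> * (\<Prod>i<N. z i ^ \<beta> i)))"
    by (intro polynomial_Cn_sum polynomial_Cn_monomial_mult)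
  then show ?thesis
    by (rule polynomial_Cn_cong) (simp only: S(2) T(2) sum_product)
qed

text \<open>Any two points lie in a common polydisc.\<close>

lemma polynomial_Cn_identity:
  assumes p: "polynomial_Cn N p" and U: "open_Cn N U" "U \<noteq> {}"
    and pU: "\<And>z. z \<in> U \<Longrightarrow> p z = 0" and z: "z \<in> Cn N"
  shows "p z = 0"
proof -
  obtain w where w: "w \<in> U" using U(2) by blast
  then have wC: "w \<in> Cn N" using openin_Cn_subset[OF U(1)] by blast
  define r where "r = 1 + (\<Sum>i<N. cmod (z i - w i))"
  have s0: "0 \<le> (\<Sum>i<N. cmod (z i - w i))" by (rule sum_nonneg) simp
  have zr: "z \<in> polydisc N w r"
  proof -
    have "cmod (z i - w i) < r" if "i < N" for i
      using member_le_sum[of i "{..<N}" "\<lambda>i. cmod (z i - w i)"] that by (simp add: r_def)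
    then show ?thesis using z by (simp add: polydisc_def)
  qed
  have wr: "w \<in> polydisc N w r" by (rule polydisc_center[OF wC]) (use s0 in \<open>simp add: r_def\<close>)
  have h: "holomorphic_Cn N (polydisc N w r) p"
    by (rule holomorphic_Cn_subset[OF polynomial_Cn_holomorphic[OF p] polydisc_openin polydisc_subset_Cn])
  show ?thesis
    by (rule polydisc_identity[OF h openin_Int[OF U(1) polydisc_openin] _ _ _ zr]) (use w wr pU in auto)
qed

lemma polynomial_Cn_1_finite_zeros:
  assumes p: "polynomial_Cn 1 p" and x: "x \<in> Cn 1" "p x \<noteq> 0"
  shows "finite {z\<in>Cn 1. p z = 0}"
proof -
  obtain S and c :: "(nat \<Rightarrow> nat) \<Rightarrow> complex" where S: "finite S"
    "\<And>z. z \<in> Cn 1 \<Longrightarrow> p z = (\<Sum>\<alpha>\<in>S. c \<alpha> * (\<Prod>i<1. z i ^ \<alpha> i))"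
    using p unfolding polynomial_Cn_def by metis
  define q where "q = (\<Sum>\<alpha>\<in>S. monom (c \<alpha>) (\<alpha> 0))"
  have q: "p z = poly q (z 0)" if "z \<in> Cn 1" for z
    unfolding S(2)[OF that] q_def poly_sum poly_monom by simp
  then have "q \<noteq> 0" using x by auto
  then have "finite {t. poly q t = 0}" by (rule poly_roots_finite)
  moreover have "(\<lambda>z. z 0) ` {z\<in>Cn 1. p z = 0} \<subseteq> {t. poly q t = 0}" using q by auto
  ultimately have "finite ((\<lambda>z. z 0) ` {z\<in>Cn 1. p z = 0})" by (rule rev_finite_subset)
  moreover have "inj_on (\<lambda>z. z 0) {z\<in>Cn 1. p z = 0}"
  proof (rule inj_onI, rule ext)
    fix y z :: "nat \<Rightarrow> complex" and i
    assume "y \<in> {z\<in>Cn 1. p z = 0}" "z \<in> {z\<in>Cn 1. p z = 0}" "y 0 = z 0"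
    then show "y i = z i" by (cases i) (simp_all add: Cn_def)
  qed
  ultimately show ?thesis by (rule finite_imageD)
qed

section \<open>Bounded matrices\<close>

lemma entry_le_op_norm:
  assumes M: "M \<in> carrier_mat n n" and i: "i < n" and j: "j < n"
  shows "cmod (M $$ (i, j)) \<le> op_norm M"
proof -
  let ?B = "{v \<in> carrier_vec n. L2_set (\<lambda>i. cmod (vec_index v i)) {..<n} \<le> 1}"
  let ?f = "\<lambda>v. L2_set (\<lambda>i. cmod (vec_index (M *\<^sub>v v) i)) {..<n}"
  have on: "op_norm M = (SUP v\<in>?B. ?f v)" using M by (simp add: op_norm_def)
  have mv: "vec_index (M *\<^sub>v v) i = (\<Sum>j<n. M $$ (i, j) * vec_index v j)"
    if "i < n" "v \<in> carrier_vec n" for i v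
    using that M by (auto simp: scalar_prod_def Matrix.row_def atLeast0LessThan intro!: sum.cong)
  have bdd: "bdd_above (?f ` ?B)"
  proof (rule bdd_aboveI2)
    fix v assume v: "v \<in> ?B"
    have v1: "cmod (vec_index v j) \<le> 1" if "j < n" for j
      using member_le_L2_set[of "{..<n}" j "\<lambda>i. cmod (vec_index v i)"] that v by simp
    have "?f v \<le> (\<Sum>i<n. cmod (vec_index (M *\<^sub>v v) i))" by (rule L2_set_le_sum) simp
    also have "\<dots> \<le> (\<Sum>i<n. \<Sum>j<n. cmod (M $$ (i, j)))"
    proof (rule sum_mono)
      fix i assume "i \<in> {..<n}"
      then have "cmod (vec_index (M *\<^sub>v v) i) = cmod (\<Sum>j<n. M $$ (i, j) * vec_index v j)" using mv v by simp
      also have "\<dots> \<le> (\<Sum>j<n. cmod (M $$ (i, j)))"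
        by (rule sum_norm_le) (use v1 in \<open>auto simp: norm_mult mult_left_le\<close>)
      finally show "cmod (vec_index (M *\<^sub>v v) i) \<le> (\<Sum>j<n. cmod (M $$ (i, j)))" .
    qed
    finally show "?f v \<le> (\<Sum>i<n. \<Sum>j<n. cmod (M $$ (i, j)))" .
  qed
  let ?u = "unit_vec n j :: complex vec"
  have "(\<Sum>k<n. (cmod (vec_index ?u k))\<^sup>2) = (\<Sum>k<n. if k = j then 1 else 0)"
    by (intro sum.cong refl) (auto simp: j)
  then have "L2_set (\<lambda>k. cmod (vec_index ?u k)) {..<n} = 1" using j by (simp add: L2_set_def)
  then have u: "?u \<in> ?B" by simp
  have "(\<Sum>k<n. M $$ (i, k) * vec_index ?u k) = (\<Sum>k<n. if k = j then M $$ (i, j) else 0)"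
    by (intro sum.cong refl) (auto simp: j)
  then have "vec_index (M *\<^sub>v ?u) i = M $$ (i, j)" using mv[OF i, of ?u] j by simp
  then have "cmod (M $$ (i, j)) \<le> ?f ?u"
    using member_le_L2_set[of "{..<n}" i "\<lambda>i. cmod (vec_index (M *\<^sub>v ?u) i)"] i by simp
  also have "\<dots> \<le> op_norm M" unfolding on by (rule cSUP_upper[OF u bdd])
  finally show ?thesis .
qed

lemma bounded_matrix_entry:
  assumes "bounded_matrix S A" "\<And>x. x \<in> S \<Longrightarrow> A x \<in> carrier_mat n n" "i < n" "j < n"
  shows "bounded ((\<lambda>x. A x $$ (i, j)) ` S)"
proof -
  obtain C where C: "\<And>x. x \<in> S \<Longrightarrow> op_norm (A x) \<le> C" using assms(1) unfolding bounded_matrix_def by blast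
  have "cmod (A x $$ (i, j)) \<le> C" if "x \<in> S" for x
    using entry_le_op_norm[OF assms(2)[OF that] assms(3,4)] C[OF that] by simp
  then show ?thesis unfolding bounded_iff by blast
qed

section \<open>Jordan stable points\<close>

lemma Jst_cong:
  assumes "\<And>x. x \<in> topspace X \<Longrightarrow> A x = B x"
  shows "Jst n X A = Jst n X B"
proof -
  have eq: "A x = B x" if "openin X U" "x \<in> U" for U x
    using assms openin_subset[OF that(1)] that(2) by blast
  have "splitting_point X A \<xi> \<longleftrightarrow> splitting_point X B \<xi>" if "\<xi> \<in> topspace X" for \<xi>
    unfolding splitting_point_def using eq assms[OF that] by (metis (no_types, lifting))
  moreover have "(\<lambda>\<zeta>. num_jordan_blocks l (A \<zeta>)) constant_on V \<longleftrightarrow> (\<lambda>\<zeta>. num_jordan_blocks l (B \<zeta>)) constant_on V"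
    if "openin X V" for l V
    unfolding constant_on_def using eq[OF that] by auto
  ultimately show ?thesis unfolding Jst_def by (intro Collect_cong conj_cong refl) auto
qed

text \<open>The values of \<open>A\<close> outside the space are arbitrary; they are replaced by matrices of the right size. The last
  conclusion says that the zero set is not the whole space.\<close>

theorem (in identity_ring) Jst_complement_zero_set:
  assumes A: "\<And>x. x \<in> topspace X \<Longrightarrow> A x \<in> carrier_mat n n"
    and R: "\<And>i j. i < n \<Longrightarrow> j < n \<Longrightarrow> (\<lambda>x. A x $$ (i, j)) \<in> R"
    and ne: "topspace X \<noteq> {}"
  obtains F where "finite F" "F \<subseteq> R" "topspace X - Jst n X A = {x\<in>topspace X. \<forall>f\<in>F. f x = 0}"
    "\<exists>x\<in>topspace X. \<exists>f\<in>F. f x \<noteq> 0"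
proof -
  define B where "B x = mat n n (\<lambda>(i, j). A x $$ (i, j))" for x
  have "ring_mat_fun n B" unfolding B_def by (rule ring_mat_fun_mat) (simp add: R)
  then have "cozero (Jst n X B)" using ne by (rule cozero_Jst)
  moreover have "Jst n X A = Jst n X B"
    by (rule Jst_cong) (use carrier_matD[OF A] in \<open>auto simp: B_def intro!: eq_matI\<close>)
  ultimately have "cozero (Jst n X A)" by simp
  then obtain F where F: "finite F" "F \<subseteq> R" "Jst n X A = {x\<in>topspace X. \<exists>f\<in>F. f x \<noteq> 0}"
    and ne': "Jst n X A \<noteq> {}" unfolding cozero_def by (elim conjE exE)
  show thesis by (rule that[of F]) (use F ne' in auto)
qed

lemma bounded_image_add:
  assumes "bounded (f ` S)" "bounded (g ` S)"
  shows "bounded ((\<lambda>x. f x + g x :: complex) ` S)"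
  by (rule bounded_plus_comp[OF assms])

lemma bounded_image_mult:
  assumes "bounded (f ` S)" "bounded (g ` S)"
  shows "bounded ((\<lambda>x. f x * g x :: complex) ` S)"
proof -
  obtain B where B: "\<And>x. x \<in> S \<Longrightarrow> cmod (f x) \<le> B" using assms(1) unfolding bounded_iff by blast
  obtain C where C: "\<And>x. x \<in> S \<Longrightarrow> cmod (g x) \<le> C" using assms(2) unfolding bounded_iff by blast
  have "cmod (f x * g x) \<le> B * C" if "x \<in> S" for x
    unfolding norm_mult using B[OF that] C[OF that] by (intro mult_mono') auto
  then show ?thesis unfolding bounded_iff by blast
qed

lemma (in reduced_complex_space) bounded_sections_identity_ring:
  assumes "irreducible_complex_space X \<O>"
  shows "identity_ring X {f \<in> \<O> (topspace X). bounded (f ` topspace X)}"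
proof
  show "(\<lambda>_. c) \<in> {f \<in> \<O> (topspace X). bounded (f ` topspace X)}" for c
    by (simp add: section_const image_constant_conv)
  fix f assume f: "f \<in> {f \<in> \<O> (topspace X). bounded (f ` topspace X)}"
  show "continuous_map X euclidean f" using f by (simp add: section_continuous)
  show "f x = 0" if "openin X U" "U \<noteq> {}" "\<And>x. x \<in> U \<Longrightarrow> f x = 0" "x \<in> topspace X" for U x
    by (rule identity_theorem[OF assms _ that]) (use f in simp)
  fix g assume g: "g \<in> {f \<in> \<O> (topspace X). bounded (f ` topspace X)}"
  show "(\<lambda>x. f x + g x) \<in> {f \<in> \<O> (topspace X). bounded (f ` topspace X)}"
    using f g by (simp add: section_add bounded_image_add)
  show "(\<lambda>x. f x * g x) \<in> {f \<in> \<O> (topspace X). bounded (f ` topspace X)}"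
    using f g by (simp add: section_mult bounded_image_mult)
qed

lemma disc_identity_ring:
  "identity_ring (top_of_set (ball 0 1)) {f. f holomorphic_on ball (0::complex) 1 \<and> bounded (f ` ball 0 1)}"
proof
  let ?R = "{f. f holomorphic_on ball (0::complex) 1 \<and> bounded (f ` ball 0 1)}"
  show "(\<lambda>_. c) \<in> ?R" for c by (simp add: image_constant_conv)
  fix f assume f: "f \<in> ?R"
  show "continuous_map (top_of_set (ball 0 1)) euclidean f"
    using f by (simp add: holomorphic_on_imp_continuous_on)
  show "f x = 0" if U: "openin (top_of_set (ball 0 1)) U" "U \<noteq> {}" "\<And>x. x \<in> U \<Longrightarrow> f x = 0"
    and x: "x \<in> topspace (top_of_set (ball 0 1))" for U x
  proof -
    have oU: "open U" "U \<subseteq> ball 0 1" using U(1) openin_open_eq[OF open_ball] by blast+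
    obtain u where u: "u \<in> U" using U(2) by blast
    have "f holomorphic_on ball 0 1" using f by simp
    then show ?thesis
    proof (rule analytic_continuation[where \<xi>=u and U=U])
      show "u islimpt U" using oU u by (simp add: open_imp_islimpt)
    qed (use oU u x U(3) in auto)
  qed
  fix g assume g: "g \<in> ?R"
  show "(\<lambda>x. f x + g x) \<in> ?R" using f g by (auto intro!: holomorphic_intros bounded_image_add)
  show "(\<lambda>x. f x * g x) \<in> ?R" using f g by (auto intro!: holomorphic_intros bounded_image_mult)
qed

lemma polynomial_identity_ring:
  "identity_ring (top_of_set (Cn N)) {p. polynomial_Cn N p}"
proof
  show "(\<lambda>_. c) \<in> {p. polynomial_Cn N p}" for c by (simp add: polynomial_Cn_const)
  fix p assume p: "p \<in> {p. polynomial_Cn N p}"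
  show "continuous_map (top_of_set (Cn N)) euclidean p"
    using p holomorphic_Cn_continuous[OF polynomial_Cn_holomorphic] by simp
  show "p x = 0" if "open_Cn N U" "U \<noteq> {}" "\<And>x. x \<in> U \<Longrightarrow> p x = 0"
    "x \<in> topspace (top_of_set (Cn N))" for U x
    by (rule polynomial_Cn_identity[OF _ that(1-3)]) (use p that(4) in simp_all)
  fix q assume q: "q \<in> {p. polynomial_Cn N p}"
  show "(\<lambda>x. p x + q x) \<in> {p. polynomial_Cn N p}" using p q by (simp add: polynomial_Cn_add)
  show "(\<lambda>x. p x * q x) \<in> {p. polynomial_Cn N p}" using p q by (simp add: polynomial_Cn_mult)
qed

lemma Jst_complex_space:
  assumes X: "reduced_complex_space X \<O>" "irreducible_complex_space X \<O>"
    and A: "\<And>x. x \<in> topspace X \<Longrightarrow> A x \<in> carrier_mat n n"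
    and hol: "\<And>i j. i < n \<Longrightarrow> j < n \<Longrightarrow> (\<lambda>x. A x $$ (i, j)) \<in> \<O> (topspace X)"
    and bdd: "bounded_matrix (topspace X) A"
  shows "\<exists>F. finite F \<and> F \<subseteq> \<O> (topspace X) \<and> (\<forall>f\<in>F. bounded (f ` topspace X)) \<and>
    topspace X - Jst n X A = {x\<in>topspace X. \<forall>f\<in>F. f x = 0}"
proof (cases "topspace X = {}")
  case True
  then show ?thesis by (intro exI[of _ "{}"]) auto
next
  case False
  interpret reduced_complex_space X \<O> by (rule X(1))
  interpret R: identity_ring X "{f \<in> \<O> (topspace X). bounded (f ` topspace X)}"
    by (rule bounded_sections_identity_ring[OF X(2)])
  have R: "(\<lambda>x. A x $$ (i, j)) \<in> {f \<in> \<O> (topspace X). bounded (f ` topspace X)}" if "i < n" "j < n" for i j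
    using hol[OF that] bounded_matrix_entry[OF bdd A that] by simp
  obtain F where F: "finite F" "F \<subseteq> {f \<in> \<O> (topspace X). bounded (f ` topspace X)}"
    "topspace X - Jst n X A = {x\<in>topspace X. \<forall>f\<in>F. f x = 0}" "\<exists>x\<in>topspace X. \<exists>f\<in>F. f x \<noteq> 0"
    by (rule R.Jst_complement_zero_set[OF A R False])
  show ?thesis by (rule exI[of _ F]) (use F(1-3) in auto)
qed

lemma Jst_disc:
  assumes A: "\<And>\<zeta>. \<zeta> \<in> ball 0 1 \<Longrightarrow> A \<zeta> \<in> carrier_mat n n"
    and hol: "\<And>i j. i < n \<Longrightarrow> j < n \<Longrightarrow> (\<lambda>\<zeta>. A \<zeta> $$ (i, j)) holomorphic_on ball 0 1"
    and bdd: "bounded_matrix (ball 0 1) A"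
  shows "(\<lambda>\<zeta>. 1 - cmod \<zeta>) summable_on (ball 0 1 - Jst n (top_of_set (ball 0 1)) A)"
proof -
  let ?X = "top_of_set (ball (0::complex) 1)"
  interpret R: identity_ring ?X "{f. f holomorphic_on ball (0::complex) 1 \<and> bounded (f ` ball 0 1)}"
    by (rule disc_identity_ring)
  have R: "(\<lambda>\<zeta>. A \<zeta> $$ (i, j)) \<in> {f. f holomorphic_on ball (0::complex) 1 \<and> bounded (f ` ball 0 1)}"
    if "i < n" "j < n" for i j
    using hol[OF that] bounded_matrix_entry[OF bdd A that] by simp
  have A': "A \<zeta> \<in> carrier_mat n n" if "\<zeta> \<in> topspace ?X" for \<zeta> using A that by simp
  have ne: "topspace ?X \<noteq> {}" by simp
  obtain F where "finite F" and F: "F \<subseteq> {f. f holomorphic_on ball 0 1 \<and> bounded (f ` ball 0 1)}"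
    "topspace ?X - Jst n ?X A = {x\<in>topspace ?X. \<forall>f\<in>F. f x = 0}"
    "\<exists>x\<in>topspace ?X. \<exists>f\<in>F. f x \<noteq> 0"
    by (rule R.Jst_complement_zero_set[OF A' R ne])
  then obtain x f where f: "x \<in> ball 0 1" "f \<in> F" "f x \<noteq> 0" by auto
  then have "f holomorphic_on ball 0 1" "bounded (f ` ball 0 1)" using F(1) by auto
  then have "(\<lambda>z. 1 - cmod z) summable_on {z\<in>ball 0 1. f z = 0}"
    using f(1,3) by (rule blaschke_condition)
  moreover have "ball 0 1 - Jst n ?X A \<subseteq> {z\<in>ball 0 1. f z = 0}" using F(2) f(2) by auto
  ultimately show ?thesis by (rule summable_on_subset_banach)
qed

lemma Jst_polynomial:
  assumes A: "\<And>z. z \<in> Cn N \<Longrightarrow> A z \<in> carrier_mat n n"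
    and pol: "\<And>i j. i < n \<Longrightarrow> j < n \<Longrightarrow> polynomial_Cn N (\<lambda>z. A z $$ (i, j))"
  shows "\<exists>P. finite P \<and> (\<forall>p\<in>P. polynomial_Cn N p) \<and>
      Cn N - Jst n (top_of_set (Cn N)) A = {z\<in>Cn N. \<forall>p\<in>P. p z = 0}"
    and "N = 1 \<Longrightarrow> finite (Cn N - Jst n (top_of_set (Cn N)) A)"
proof -
  let ?X = "top_of_set (Cn N)"
  interpret R: identity_ring ?X "{p. polynomial_Cn N p}" by (rule polynomial_identity_ring)
  have R: "(\<lambda>z. A z $$ (i, j)) \<in> {p. polynomial_Cn N p}" if "i < n" "j < n" for i j using pol[OF that] by simp
  have A': "A z \<in> carrier_mat n n" if "z \<in> topspace ?X" for z using A that by simp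
  have "(\<lambda>_. 0) \<in> Cn N" by (simp add: Cn_def)
  then have ne: "topspace ?X \<noteq> {}" by auto
  obtain P where P: "finite P" "P \<subseteq> {p. polynomial_Cn N p}"
    "topspace ?X - Jst n ?X A = {x\<in>topspace ?X. \<forall>f\<in>P. f x = 0}" "\<exists>x\<in>topspace ?X. \<exists>f\<in>P. f x \<noteq> 0"
    by (rule R.Jst_complement_zero_set[OF A' R ne])
  then show "\<exists>P. finite P \<and> (\<forall>p\<in>P. polynomial_Cn N p) \<and> Cn N - Jst n ?X A = {z\<in>Cn N. \<forall>p\<in>P. p z = 0}"
    by (intro exI[of _ P]) auto
  obtain x p where x: "x \<in> Cn N" "p \<in> P" "p x \<noteq> 0" using P(4) by auto
  show "finite (Cn N - Jst n ?X A)" if "N = 1"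
  proof (rule finite_subset)
    show "Cn N - Jst n ?X A \<subseteq> {z\<in>Cn N. p z = 0}" using P(3) x(2) by auto
    show "finite {z\<in>Cn N. p z = 0}"
      using polynomial_Cn_1_finite_zeros[of p x] x P(2) that by auto
  qed
qed

theorem mainTheorem3:
  fixes n :: nat
  assumes "n \<ge> 1"
  shows
    "(\<forall>(X :: 'a topology) \<O> A.
        reduced_complex_space X \<O> \<and> irreducible_complex_space X \<O> \<and> normal_complex_space X \<O> \<and>
        (\<forall>x\<in>topspace X. A x \<in> carrier_mat n n) \<and>
        (\<forall>i<n. \<forall>j<n. (\<lambda>x. A x $$ (i, j)) \<in> \<O> (topspace X)) \<and>
        bounded_matrix (topspace X) A \<longrightarrow>
        (\<exists>F. finite F \<and> F \<subseteq> \<O> (topspace X) \<and> (\<forall>f\<in>F. bounded (f ` topspace X)) \<and>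
           topspace X - Jst n X A = {x\<in>topspace X. \<forall>f\<in>F. f x = 0})) \<and>
     (\<forall>A :: complex \<Rightarrow> complex mat.
        (\<forall>\<zeta>\<in>ball 0 1. A \<zeta> \<in> carrier_mat n n) \<and>
        (\<forall>i<n. \<forall>j<n. (\<lambda>\<zeta>. A \<zeta> $$ (i, j)) holomorphic_on ball 0 1) \<and>
        bounded_matrix (ball 0 1) A \<longrightarrow>
        (\<lambda>\<zeta>. 1 - cmod \<zeta>) summable_on (ball 0 1 - Jst n (top_of_set (ball 0 1)) A)) \<and>
     (\<forall>N (A :: (nat \<Rightarrow> complex) \<Rightarrow> complex mat).
        (\<forall>z\<in>Cn N. A z \<in> carrier_mat n n) \<and>
        (\<forall>i<n. \<forall>j<n. polynomial_Cn N (\<lambda>z. A z $$ (i, j))) \<longrightarrow>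
        (\<exists>P. finite P \<and> (\<forall>p\<in>P. polynomial_Cn N p) \<and>
           Cn N - Jst n (top_of_set (Cn N)) A = {z\<in>Cn N. \<forall>p\<in>P. p z = 0}) \<and>
        (N = 1 \<longrightarrow> finite (Cn N - Jst n (top_of_set (Cn N)) A)))"
proof (intro conjI allI impI; (elim conjE)?)
  fix X :: "'a topology" and \<O> A
  assume "reduced_complex_space X \<O>" "irreducible_complex_space X \<O>"
    "\<forall>x\<in>topspace X. A x \<in> carrier_mat n n"
    "\<forall>i<n. \<forall>j<n. (\<lambda>x. A x $$ (i, j)) \<in> \<O> (topspace X)" "bounded_matrix (topspace X) A"
  then show "\<exists>F. finite F \<and> F \<subseteq> \<O> (topspace X) \<and> (\<forall>f\<in>F. bounded (f ` topspace X)) \<and>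
    topspace X - Jst n X A = {x\<in>topspace X. \<forall>f\<in>F. f x = 0}"
    by (intro Jst_complex_space) auto
next
  fix A :: "complex \<Rightarrow> complex mat"
  assume "\<forall>\<zeta>\<in>ball 0 1. A \<zeta> \<in> carrier_mat n n"
    "\<forall>i<n. \<forall>j<n. (\<lambda>\<zeta>. A \<zeta> $$ (i, j)) holomorphic_on ball 0 1" "bounded_matrix (ball 0 1) A"
  then show "(\<lambda>\<zeta>. 1 - cmod \<zeta>) summable_on (ball 0 1 - Jst n (top_of_set (ball 0 1)) A)"
    by (intro Jst_disc) auto
next
  fix N and A :: "(nat \<Rightarrow> complex) \<Rightarrow> complex mat"
  assume "\<forall>z\<in>Cn N. A z \<in> carrier_mat n n" "\<forall>i<n. \<forall>j<n. polynomial_Cn N (\<lambda>z. A z $$ (i, j))"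
  then show "\<exists>P. finite P \<and> (\<forall>p\<in>P. polynomial_Cn N p) \<and>
      Cn N - Jst n (top_of_set (Cn N)) A = {z\<in>Cn N. \<forall>p\<in>P. p z = 0}"
    by (intro Jst_polynomial(1)) auto
next
  fix N and A :: "(nat \<Rightarrow> complex) \<Rightarrow> complex mat"
  assume "\<forall>z\<in>Cn N. A z \<in> carrier_mat n n" "\<forall>i<n. \<forall>j<n. polynomial_Cn N (\<lambda>z. A z $$ (i, j))" "N = 1"
  then show "finite (Cn N - Jst n (top_of_set (Cn N)) A)"
    by (intro Jst_polynomial(2)) auto
qed

end
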